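(* Let $k$ be a field with $\mathrm{char}(k)\neq 2,3$ and let $\mathcal{A}$ be an algebraic structurable division algebra over $k$ with space of skew elements $\mathcal{S}$. Let $0\neq x\in\mathcal{A}$ and $0\neq s\in\mathcal{S}$. Then $(x,s)$ is one-invertible. Moreover, the solution $(u,t)\in\mathcal{A}\times\mathcal{S}$ of the system of equations $$V_{x,u}=\mathrm{id}+L_sL_t,\qquad su=-\tfrac13U_x(tx),\qquad \psi(x,s(tx))=0$$ is $$u=\bigl(x-s(q_{\hat x}(s)x)\bigr)^\wedge=-\hat s\bigl((q_{\hat x}(s)+\hat s)^\wedge\hat x\bigr)\quad\text{and}\quad t=\bigl(s+q_x(\hat s)\bigr)^\wedge,$$ where the expressions of which the conjugate inverse is taken are different from zero.
   Context: Structurable algebras. A structurable algebra over $k$ is a finite-dimensional unital (not necessarily associative or commutative) $k$-algebra $\mathcal{A}$ with an involution $x\mapsto\bar x$ (a $k$-linear map of order at most two with $\overline{xy}=\bar y\,\bar x$) such that $[V_{x,y},V_{z,w}]=V_{\{x,y,z\},w}-V_{z,\{y,x,w\}}$ for all $x,y,z,w$, where $V_{x,y}z=\{x,y,z\}=(x\bar y)z+(z\bar y)x-(z\bar x)y$. Put $U_{x,y}z=V_{x,z}y$, $U_xy=U_{x,x}y$, $\mathcal{S}=\{s\mid\bar s=-s\}$, $\psi(x,y)=x\bar y-y\bar x\in\mathcal{S}$, and $L_sx=sx$ for $s\in\mathcal S$. An element $u$ is conjugate invertible if there is $\hat u\in\mathcal{A}$ with $V_{u,\hat u}=\mathrm{id}$;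 then $\hat u$ is unique, is called the conjugate inverse, and is also written $u^\wedge$ (conjugate inverses of skew elements are skew). $\mathcal{A}$ is a structurable division algebra if every nonzero element is conjugate invertible. For $x\neq 0$, $q_x\colon\mathcal{S}\to\mathcal{S}$ is $q_x(s)=\tfrac16\psi(x,U_x(sx))$. The Lie algebra $K(\mathcal{A})$. Let $\mathrm{Instrl}(\mathcal{A})=\mathrm{span}\{V_{x,y}\}$. Then $K(\mathcal{A})=\mathcal{S}_-\oplus\mathcal{A}_-\oplus\mathrm{Instrl}(\mathcal{A})\oplus\mathcal{A}_+\oplus\mathcal{S}_+$ (copies of $\mathcal S,\mathcal A$; graded pieces of degrees $-2,-1,0,1,2$), with the commutator on $\mathrm{Instrl}(\mathcal{A})$ and $[V_{a,b},x_+]=(V_{a,b}x)_+$, $[V_{a,b},y_-]=(-V_{b,a}y)_-$, $[V_{a,b},s_+]=-\psi(a,sb)_+$, $[V_{a,b},t_-]=\psi(b,ta)_-$, $[s_+,x_+]=0=[t_-,y_-]$, $[s_+,y_-]=(sy)_+$, $[t_-,x_+]=(tx)_-$, $[x_+,y_-]=V_{x,y}$, $[x_+,x'_+]=\psi(x,x')_+$, $[y_-,y'_-]=\psi(y,y')_-$, $[s_+,s'_+]=[t_-,t'_-]=0$, $[s_+,t_-]=L_sL_t\in\mathrm{Instrl}(\mathcal A)$. Algebraicity. For a finite-dimensional 5-graded Lie algebra $\mathcal{L}=\bigoplus_{i=-2}^2\mathcal{L}_i$, $\sigma\in\{1,-1\}$ and $(x,s)\in\mathcal{L}_\sigma\oplus\mathcal{L}_{2\sigma}$,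 put $e_\sigma(x,s)=\sum_{i=0}^4\frac1{i!}\mathrm{ad}(x+s)^i$. $\mathcal{L}$ is algebraic if all $e_\sigma(x,s)$ are Lie algebra automorphisms. $\mathcal{A}$ is algebraic if $K(\mathcal{A})$ is. One-invertibility. Let $K'(\mathcal{A})$ be the 5-graded Lie algebra with the same graded space and bracket as $K(\mathcal{A})$ except that $[x_+,y_-]=-2V_{x,y}$, $[x_+,x'_+]=-2\psi(x,x')_+$, $[y_-,y'_-]=-2\psi(y,y')_-$. Let $\zeta$ be its grading derivation ($\zeta(x)=ix$ for $x$ of degree $i$), and let $\mathfrak{g}=\mathcal{S}_-\oplus\mathcal{A}_-\oplus(\mathrm{Instrl}(\mathcal{A})+k\zeta)\oplus\mathcal{A}_+\oplus\mathcal{S}_+$, with $\zeta$ viewed as an element of degree 0 and $[\zeta,x]=\zeta(x)$. Maps act on $\mathfrak{g}$ on the right (in a product the left factor is applied first). $U_\sigma=\{e_\sigma(x,s)\mid(x,s)\in\mathfrak{g}_\sigma\times\mathfrak{g}_{2\sigma}\}\subset\mathrm{Aut}(\mathfrak{g})$, the elementary group is $G=\langle U_+,U_-\rangle$, and $H_-=\{h\in G\mid\zeta.h=-\zeta\}$ (the elements reversing the grading). For $(x,s)\in\mathcal{A}\times\mathcal{S}$ write $e_\pm(x,s)$ by regarding $(x,s)$ in $\mathcal{A}_\pm\times\mathcal{S}_\pm$. $(x,s)$ is one-invertible if there are $(y,t),(z,r)\in\mathcal{A}\times\mathcal{S}$ with $e_-(z,r)e_+(x,s)e_-(y,t)\in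 H_-$. *)

theory Defs
  imports
    Complex_Main
    "HOL-Library.Function_Algebras"
    "HOL-Library.Product_Plus"
    "HOL-Algebra.Generated_Groups"
    "HOL-Algebra.Bij"
begin

section \<open>Structurable algebras\<close>

text \<open>
  The class only provides the operations of a nonassociative unital algebra with involution;
  the axioms, including those that relate the operations to the scalar multiplication
  by \<open>'k\<close>, are in the locale below.
\<close>

class algebra_ops = ab_group_add + times + one +
  fixes bar :: "'a \<Rightarrow> 'a"

definition Vop :: "'a::algebra_ops \<Rightarrow> 'a \<Rightarrow> 'a \<Rightarrow> 'a" where
  "Vop x y z = (x * bar y) * z + (z * bar y) * x - (z * bar x) * y"

definition Uop2 :: "'a::algebra_ops \<Rightarrow> 'a \<Rightarrow> 'a \<Rightarrow> 'a" where
  "Uop2 x y z = Vop x z y"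

definition Uop :: "'a::algebra_ops \<Rightarrow> 'a \<Rightarrow> 'a" where
  "Uop x y = Uop2 x x y"

definition Skew :: "'a::algebra_ops set" where
  "Skew = {s. bar s = - s}"

definition psi :: "'a::algebra_ops \<Rightarrow> 'a \<Rightarrow> 'a" where
  "psi x y = x * bar y - y * bar x"

definition Lop :: "'a::algebra_ops \<Rightarrow> 'a \<Rightarrow> 'a" where
  "Lop s = (\<lambda>x. s * x)"

locale structurable_algebra = vector_space scale
  for scale :: "'k::field \<Rightarrow> 'a::algebra_ops \<Rightarrow> 'a" +
  assumes finite_dimensional: "\<exists>B. finite B \<and> span B = UNIV"
    and mult_add_left: "(x + y) * z = x * z + y * z"
    and mult_add_right: "x * (y + z) = x * y + x * z"
    and mult_scale_left: "scale c x * y = scale c (x * y)"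
    and mult_scale_right: "x * scale c y = scale c (x * y)"
    and one_left: "1 * x = x"
    and one_right: "x * 1 = x"
    and bar_add: "bar (x + y) = bar x + bar y"
    and bar_scale: "bar (scale c x) = scale c (bar x)"
    and bar_bar: "bar (bar x) = x"
    and bar_mult: "bar (x * y) = bar y * bar x"
    and structurable:
      "Vop x y (Vop z w v) - Vop z w (Vop x y v)
        = Vop (Vop x y z) w v - Vop z (Vop y x w) v"

definition conj_invertible :: "'a::algebra_ops \<Rightarrow> bool" where
  "conj_invertible u \<longleftrightarrow> (\<exists>v. Vop u v = id)"

definition conj_inv :: "'a::algebra_ops \<Rightarrow> 'a" where
  "conj_inv u = (THE v. Vop u v = id)"

locale structurable_division_algebra = structurable_algebra scale
  for scale :: "'k::field \<Rightarrow> 'a::algebra_ops \<Rightarrow> 'a" +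
  assumes division: "(u :: 'a) \<noteq> 0 \<Longrightarrow> conj_invertible u"

definition qmap :: "('k::field \<Rightarrow> 'a::algebra_ops \<Rightarrow> 'a) \<Rightarrow> 'a \<Rightarrow> 'a \<Rightarrow> 'a" where
  "qmap scale x s = scale (1 / 6) (psi x (Uop x (s * x)))"


section \<open>The 5-graded Lie algebras\<close>

text \<open>
  An element with components of degrees \<open>-2, -1, 0, 1, 2\<close>. In degree 0 all algebras below
  consist of linear operators on the structurable algebra, recorded through their action on the
  component of degree 1.
\<close>

type_synonym 'a graded = "'a \<times> 'a \<times> ('a \<Rightarrow> 'a) \<times> 'a \<times> 'a"

definition op_scale :: "('k \<Rightarrow> 'a \<Rightarrow> 'a) \<Rightarrow> 'k \<Rightarrow> ('a \<Rightarrow> 'a) \<Rightarrow> 'a \<Rightarrow> 'a" where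
  "op_scale scale c T = (\<lambda>z. scale c (T z))"

fun graded_scale :: "('k \<Rightarrow> 'a \<Rightarrow> 'a) \<Rightarrow> 'k \<Rightarrow> 'a graded \<Rightarrow> 'a graded" where
  "graded_scale scale c (t, y, T, x, s)
     = (scale c t, scale c y, op_scale scale c T, scale c x, scale c s)"

fun pair_scale :: "('k \<Rightarrow> 'a \<Rightarrow> 'a) \<Rightarrow> 'k \<Rightarrow> ('a \<Rightarrow> 'a) \<times> 'a \<Rightarrow> ('a \<Rightarrow> 'a) \<times> 'a" where
  "pair_scale scale c (T, z) = (op_scale scale c T, scale c z)"

definition deg0 ::
    "('k::field \<Rightarrow> 'a::algebra_ops \<Rightarrow> 'a) \<Rightarrow> ('a \<Rightarrow> 'a) set \<Rightarrow> ('a \<Rightarrow> 'a) set" where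
  "deg0 scale E = module.span (op_scale scale) ({Vop x y |x y. True} \<union> E)"

definition Instrl :: "('k::field \<Rightarrow> 'a::algebra_ops \<Rightarrow> 'a) \<Rightarrow> ('a \<Rightarrow> 'a) set" where
  "Instrl scale = deg0 scale {}"

text \<open>
  The set \<open>E\<close> of additional generators in degree 0 is empty for \<open>Instrl\<close> alone and \<open>{id}\<close> when
  the grading derivation \<open>\<zeta>\<close> is adjoined, because \<open>\<zeta>\<close> acts as the identity in degree 1. The sum
  \<open>Instrl + k\<zeta>\<close> is a sum of spaces of operators and not direct: \<open>V\<^sub>1\<^sub>,\<^sub>1 = id\<close> also acts as \<open>\<zeta>\<close>.
  The action of degree 0 on the component of degree \<open>i\<close> is the linear extension in \<open>T\<close> of
  \<open>Vop a b \<mapsto> F a b w\<close> and, for the grading derivation, of \<open>id \<mapsto> i w\<close>: the pair \<open>(T, z)\<close> is in the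
  span of these generating pairs iff \<open>z\<close> is the result of applying \<open>T\<close> to \<open>w\<close>. Below it is shown
  that this is single-valued and gives the intended values on generators.
\<close>

definition deg0_act ::
    "('k::field \<Rightarrow> 'a::algebra_ops \<Rightarrow> 'a) \<Rightarrow> ('a \<Rightarrow> 'a) set \<Rightarrow> int
      \<Rightarrow> ('a \<Rightarrow> 'a \<Rightarrow> 'a \<Rightarrow> 'a) \<Rightarrow> ('a \<Rightarrow> 'a) \<Rightarrow> 'a \<Rightarrow> 'a" where
  "deg0_act scale E i F T w =
     (THE z. (T, z) \<in> module.span (pair_scale scale)
        ({(Vop a b, F a b w) |a b. True} \<union> {(e, scale (of_int i) w) |e. e \<in> E}))"

definition act_S_minus ::
    "('k::field \<Rightarrow> 'a::algebra_ops \<Rightarrow> 'a) \<Rightarrow> ('a \<Rightarrow> 'a) set \<Rightarrow> ('a \<Rightarrow> 'a) \<Rightarrow> 'a \<Rightarrow> 'a" where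
  "act_S_minus scale E = deg0_act scale E (-2) (\<lambda>a b t. psi b (t * a))"

definition act_A_minus ::
    "('k::field \<Rightarrow> 'a::algebra_ops \<Rightarrow> 'a) \<Rightarrow> ('a \<Rightarrow> 'a) set \<Rightarrow> ('a \<Rightarrow> 'a) \<Rightarrow> 'a \<Rightarrow> 'a" where
  "act_A_minus scale E = deg0_act scale E (-1) (\<lambda>a b y. - Vop b a y)"

definition act_A_plus ::
    "('k::field \<Rightarrow> 'a::algebra_ops \<Rightarrow> 'a) \<Rightarrow> ('a \<Rightarrow> 'a) set \<Rightarrow> ('a \<Rightarrow> 'a) \<Rightarrow> 'a \<Rightarrow> 'a" where
  "act_A_plus scale E = deg0_act scale E 1 (\<lambda>a b x. Vop a b x)"

definition act_S_plus ::
    "('k::field \<Rightarrow> 'a::algebra_ops \<Rightarrow> 'a) \<Rightarrow> ('a \<Rightarrow> 'a) set \<Rightarrow> ('a \<Rightarrow> 'a) \<Rightarrow> 'a \<Rightarrow> 'a" where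
  "act_S_plus scale E = deg0_act scale E 2 (\<lambda>a b s. - psi a (s * b))"

text \<open>
  The common bracket: \<open>[x\<^sub>+, y\<^sub>-] = c V\<^sub>x\<^sub>,\<^sub>y\<close>, \<open>[x\<^sub>+, x'\<^sub>+] = c \<psi>(x, x')\<^sub>+\<close> and
  \<open>[y\<^sub>-, y'\<^sub>-] = c \<psi>(y, y')\<^sub>-\<close>, with \<open>c = 1\<close> for \<open>K(A)\<close> and \<open>c = -2\<close> for \<open>K'(A)\<close>.
\<close>

fun graded_bracket ::
    "('k::field \<Rightarrow> 'a::algebra_ops \<Rightarrow> 'a) \<Rightarrow> ('a \<Rightarrow> 'a) set \<Rightarrow> 'k
      \<Rightarrow> 'a graded \<Rightarrow> 'a graded \<Rightarrow> 'a graded" where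
  "graded_bracket scale E c (t, y, T, x, s) (t', y', T', x', s') =
     (act_S_minus scale E T t' - act_S_minus scale E T' t + scale c (psi y y'),
      act_A_minus scale E T y' - act_A_minus scale E T' y + t * x' - t' * x,
      (T \<circ> T') - (T' \<circ> T) + op_scale scale c (Vop x y' - Vop x' y)
        + (Lop s \<circ> Lop t') - (Lop s' \<circ> Lop t),
      act_A_plus scale E T x' - act_A_plus scale E T' x + s * y' - s' * y,
      act_S_plus scale E T s' - act_S_plus scale E T' s + scale c (psi x x'))"

definition graded_carrier ::
    "('k::field \<Rightarrow> 'a::algebra_ops \<Rightarrow> 'a) \<Rightarrow> ('a \<Rightarrow> 'a) set \<Rightarrow> 'a graded set" where
  "graded_carrier scale E = Skew \<times> UNIV \<times> deg0 scale E \<times> UNIV \<times> Skew"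

definition elt_plus :: "'a::algebra_ops \<Rightarrow> 'a \<Rightarrow> 'a graded" where
  "elt_plus x s = (0, 0, 0, x, s)"

definition elt_minus :: "'a::algebra_ops \<Rightarrow> 'a \<Rightarrow> 'a graded" where
  "elt_minus x s = (s, x, 0, 0, 0)"

definition graded_exp ::
    "('k::field \<Rightarrow> 'a::algebra_ops \<Rightarrow> 'a) \<Rightarrow> ('a \<Rightarrow> 'a) set \<Rightarrow> 'k
      \<Rightarrow> 'a graded \<Rightarrow> 'a graded \<Rightarrow> 'a graded" where
  "graded_exp scale E c X = (\<lambda>Z \<in> graded_carrier scale E.
     \<Sum>i\<le>4. graded_scale scale (1 / of_nat (fact i)) ((graded_bracket scale E c X ^^ i) Z))"

definition is_automorphism ::
    "('k::field \<Rightarrow> 'a::algebra_ops \<Rightarrow> 'a) \<Rightarrow> ('a \<Rightarrow> 'a) set \<Rightarrow> 'k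
      \<Rightarrow> ('a graded \<Rightarrow> 'a graded) \<Rightarrow> bool" where
  "is_automorphism scale E c f \<longleftrightarrow>
     bij_betw f (graded_carrier scale E) (graded_carrier scale E) \<and>
     (\<forall>X \<in> graded_carrier scale E. \<forall>Y \<in> graded_carrier scale E. f (X + Y) = f X + f Y) \<and>
     (\<forall>a. \<forall>X \<in> graded_carrier scale E. f (graded_scale scale a X) = graded_scale scale a (f X)) \<and>
     (\<forall>X \<in> graded_carrier scale E. \<forall>Y \<in> graded_carrier scale E.
        f (graded_bracket scale E c X Y) = graded_bracket scale E c (f X) (f Y))"

definition algebraic :: "('k::field \<Rightarrow> 'a::algebra_ops \<Rightarrow> 'a) \<Rightarrow> bool" where
  "algebraic scale \<longleftrightarrow>
     (\<forall>x. \<forall>s \<in> Skew.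
        is_automorphism scale {} 1 (graded_exp scale {} 1 (elt_plus x s)) \<and>
        is_automorphism scale {} 1 (graded_exp scale {} 1 (elt_minus x s)))"


section \<open>One-invertibility\<close>

definition zeta :: "'a::algebra_ops graded" where
  "zeta = (0, 0, id, 0, 0)"

definition g_carrier :: "('k::field \<Rightarrow> 'a::algebra_ops \<Rightarrow> 'a) \<Rightarrow> 'a graded set" where
  "g_carrier scale = graded_carrier scale {id}"

definition e_plus ::
    "('k::field \<Rightarrow> 'a::algebra_ops \<Rightarrow> 'a) \<Rightarrow> 'a \<Rightarrow> 'a \<Rightarrow> 'a graded \<Rightarrow> 'a graded" where
  "e_plus scale x s = graded_exp scale {id} (-2) (elt_plus x s)"

definition e_minus ::
    "('k::field \<Rightarrow> 'a::algebra_ops \<Rightarrow> 'a) \<Rightarrow> 'a \<Rightarrow> 'a \<Rightarrow> 'a graded \<Rightarrow> 'a graded" where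
  "e_minus scale x s = graded_exp scale {id} (-2) (elt_minus x s)"

definition elementary_group ::
    "('k::field \<Rightarrow> 'a::algebra_ops \<Rightarrow> 'a) \<Rightarrow> ('a graded \<Rightarrow> 'a graded) set" where
  "elementary_group scale = generate (BijGroup (g_carrier scale))
     ({e_plus scale x s |x s. s \<in> Skew} \<union> {e_minus scale x s |x s. s \<in> Skew})"

definition H_minus ::
    "('k::field \<Rightarrow> 'a::algebra_ops \<Rightarrow> 'a) \<Rightarrow> ('a graded \<Rightarrow> 'a graded) set" where
  "H_minus scale = {h \<in> elementary_group scale. h zeta = - zeta}"

text \<open>
  Maps are composed from left to right, as for a right action.
\<close>

definition right_comp ::
    "('k::field \<Rightarrow> 'a::algebra_ops \<Rightarrow> 'a)
      \<Rightarrow> ('a graded \<Rightarrow> 'a graded) \<Rightarrow> ('a graded \<Rightarrow> 'a graded) \<Rightarrow> 'a graded \<Rightarrow> 'a graded" where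
  "right_comp scale f g = compose (g_carrier scale) g f"

definition one_invertible ::
    "('k::field \<Rightarrow> 'a::algebra_ops \<Rightarrow> 'a) \<Rightarrow> 'a \<Rightarrow> 'a \<Rightarrow> bool" where
  "one_invertible scale x s \<longleftrightarrow>
     (\<exists>y z. \<exists>t \<in> Skew. \<exists>r \<in> Skew.
        right_comp scale (right_comp scale (e_minus scale z r) (e_plus scale x s))
          (e_minus scale y t) \<in> H_minus scale)"


section \<open>The degree 0 actions are well defined\<close>

context structurable_algebra
begin

lemma bar_zero: "bar (0 :: 'a) = 0"
  using bar_add[of 0 0] by simp

lemma bar_minus: "bar (- x :: 'a) = - bar x"
  using bar_add[of x "- x"] by (simp add: bar_zero eq_neg_iff_add_eq_0 add.commute)

lemma bar_diff: "bar (x - y :: 'a) = bar x - bar y"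
  using bar_add[of x "- y"] by (simp add: bar_minus)

lemma bar_one: "bar (1 :: 'a) = 1"
  by (metis bar_bar bar_mult one_left one_right)

lemma mult_zero_left': "0 * x = (0 :: 'a)"
  using mult_add_left[of 0 0 x] by simp

lemma mult_zero_right': "x * 0 = (0 :: 'a)"
  using mult_add_right[of x 0 0] by simp

lemma mult_minus_left': "(- x) * y = - (x * y :: 'a)"
  using mult_add_left[of x "- x" y] by (simp add: mult_zero_left' eq_neg_iff_add_eq_0 add.commute)

lemma mult_minus_right': "x * (- y) = - (x * y :: 'a)"
  using mult_add_right[of x y "- y"] by (simp add: mult_zero_right' eq_neg_iff_add_eq_0 add.commute)

lemma mult_diff_left': "(x - y) * z = x * z - (y * z :: 'a)"
  using mult_add_left[of x "- y" z] by (simp add: mult_minus_left')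

lemma mult_diff_right': "x * (y - z) = x * y - (x * z :: 'a)"
  using mult_add_right[of x y "- z"] by (simp add: mult_minus_right')

lemmas alg_simps = mult_add_left mult_add_right mult_minus_left' mult_minus_right'
  mult_diff_left' mult_diff_right' mult_scale_left mult_scale_right mult_zero_left' mult_zero_right'
  one_left one_right bar_add bar_minus bar_diff bar_scale bar_zero bar_one bar_bar bar_mult

text \<open>
  The action of \<open>V\<^sub>a\<^sub>,\<^sub>b\<close> in degree 2 depends only on the operator \<open>V\<^sub>a\<^sub>,\<^sub>b\<close>. It suffices to verify this
  for \<open>a\<close> and \<open>b\<close> hermitian or skew, where it is a combination of instances of the defining
  identity.
\<close>

lemma psi_eq_Vop:
  fixes a b s :: 'a
  assumes char: "(2 :: 'k) \<noteq> 0" "(3 :: 'k) \<noteq> 0" and s: "bar s = - s"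
  shows "- psi a (s * b) = Vop a b s + s * bar (Vop a b 1)"
proof -
  have char4: "(4 :: 'k) \<noteq> 0" and char6: "(6 :: 'k) \<noteq> 0"
    using char mult_eq_0_iff[of "2 :: 'k" 2] mult_eq_0_iff[of "2 :: 'k" 3] by simp_all
  define W where "W a b = Vop a b s + s * bar (Vop a b 1) + psi a (s * b)" for a b :: 'a
  obtain B where B: "independent B" "span B = UNIV"
    using maximal_independent_subset[of UNIV] by (metis top.extremum_uniqueI)
  have rep: "representation B (x + y) v = representation B x v + representation B y v"
    "representation B (x - y) v = representation B x v - representation B y v"
    "representation B (- x) v = - representation B x v" for x y v
    using B by (simp_all add: representation_add representation_diff representation_neg)
  have sep: "x = 0" if "\<And>v. representation B x v = 0" for x :: 'a
    using B that sum_nonzero_representation_eq[of B x] by simp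

  have hh: "W a b = 0" if a: "bar a = a" and b: "bar b = b" for a b
  proof (rule sep)
    fix v
    define \<phi> where "\<phi> x = representation B x v" for x
    note phi = rep[where v = v, folded \<phi>_def]
    define D where "D x y z w v = \<phi> (Vop x y (Vop z w v)) - \<phi> (Vop z w (Vop x y v))
        - \<phi> (Vop (Vop x y z) w v) + \<phi> (Vop z (Vop y x w) v)" for x y z w v
    have D: "D x y z w v = 0" for x y z w v
      using arg_cong[OF structurable[of x y z w v], of \<phi>] by (simp add: D_def phi)
    have "2 * \<phi> (W a b) = D a s b 1 1 - D 1 a s 1 b"
      unfolding D_def Vop_def W_def psi_def
      by (simp add: alg_simps s a b phi; simp add: algebra_simps)
    then have "2 * \<phi> (W a b) = 0"
      by (simp add: D)
    then show "representation B (W a b) v = 0"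
      using char char4 char6 by (simp add: \<phi>_def)
  qed
  have hk: "W a b = 0" if a: "bar a = a" and b: "bar b = - b" for a b
  proof (rule sep)
    fix v
    define \<phi> where "\<phi> x = representation B x v" for x
    note phi = rep[where v = v, folded \<phi>_def]
    define D where "D x y z w v = \<phi> (Vop x y (Vop z w v)) - \<phi> (Vop z w (Vop x y v))
        - \<phi> (Vop (Vop x y z) w v) + \<phi> (Vop z (Vop y x w) v)" for x y z w v
    have D: "D x y z w v = 0" for x y z w v
      using arg_cong[OF structurable[of x y z w v], of \<phi>] by (simp add: D_def phi)
    have "2 * \<phi> (W a b) = - D s b a 1 1 + D 1 b a 1 s - D s a b 1 1"
      unfolding D_def Vop_def W_def psi_def
      by (simp add: alg_simps s a b phi; simp add: algebra_simps)
    then have "2 * \<phi> (W a b) = 0"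
      by (simp add: D)
    then show "representation B (W a b) v = 0"
      using char char4 char6 by (simp add: \<phi>_def)
  qed
  have kh: "W a b = 0" if a: "bar a = - a" and b: "bar b = b" for a b
  proof (rule sep)
    fix v
    define \<phi> where "\<phi> x = representation B x v" for x
    note phi = rep[where v = v, folded \<phi>_def]
    define D where "D x y z w v = \<phi> (Vop x y (Vop z w v)) - \<phi> (Vop z w (Vop x y v))
        - \<phi> (Vop (Vop x y z) w v) + \<phi> (Vop z (Vop y x w) v)" for x y z w v
    have D: "D x y z w v = 0" for x y z w v
      using arg_cong[OF structurable[of x y z w v], of \<phi>] by (simp add: D_def phi)
    have "4 * \<phi> (W a b) = - 2 * D 1 s b 1 a + 4 * D 1 b a 1 s - 3 * D b s 1 a 1"
      unfolding D_def Vop_def W_def psi_def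
      by (simp add: alg_simps s a b phi; simp add: algebra_simps)
    then have "4 * \<phi> (W a b) = 0"
      by (simp add: D)
    then show "representation B (W a b) v = 0"
      using char char4 char6 by (simp add: \<phi>_def)
  qed
  have kk: "W a b = 0" if a: "bar a = - a" and b: "bar b = - b" for a b
  proof (rule sep)
    fix v
    define \<phi> where "\<phi> x = representation B x v" for x
    note phi = rep[where v = v, folded \<phi>_def]
    define D where "D x y z w v = \<phi> (Vop x y (Vop z w v)) - \<phi> (Vop z w (Vop x y v))
        - \<phi> (Vop (Vop x y z) w v) + \<phi> (Vop z (Vop y x w) v)" for x y z w v
    have D: "D x y z w v = 0" for x y z w v
      using arg_cong[OF structurable[of x y z w v], of \<phi>] by (simp add: D_def phi)
    have "6 * \<phi> (W a b) = D 1 s a 1 b + 3 * D a b s 1 1 - D 1 s 1 b a"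
      unfolding D_def Vop_def W_def psi_def
      by (simp add: alg_simps s a b phi; simp add: algebra_simps)
    then have "6 * \<phi> (W a b) = 0"
      by (simp add: D)
    then show "representation B (W a b) v = 0"
      using char char4 char6 by (simp add: \<phi>_def)
  qed
  have add: "W (a + a') b = W a b + W a' b" "W a (b + b') = W a b + W a b'" for a a' b b'
    by (simp_all add: W_def Vop_def psi_def alg_simps)
  have decomp: "\<exists>h k. bar h = h \<and> bar k = - k \<and> x = h + k" for x :: 'a
  proof (intro exI conjI)
    show "bar (scale (1 / 2) (x + bar x)) = scale (1 / 2) (x + bar x)"
      by (simp add: alg_simps add.commute)
    show "bar (scale (1 / 2) (x - bar x)) = - scale (1 / 2) (x - bar x)"
      by (simp add: alg_simps scale_right_diff_distrib)
    have "scale (1 / 2) (x + bar x) + scale (1 / 2) (x - bar x) = scale (1 / 2 + 1 / 2) x"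
      by (simp only: scale_right_distrib scale_right_diff_distrib scale_left_distrib) simp
    also have "(1 / 2 + 1 / 2 :: 'k) = 1"
      using char by (simp add: field_simps)
    finally show "x = scale (1 / 2) (x + bar x) + scale (1 / 2) (x - bar x)"
      by simp
  qed
  obtain h k h' k' where "bar h = h" "bar k = - k" "a = h + k" "bar h' = h'" "bar k' = - k'" "b = h' + k'"
    using decomp[of a] decomp[of b] by metis
  then have "W a b = 0"
    by (simp add: add hh hk kh kk)
  then show ?thesis
    by (simp add: W_def neg_eq_iff_add_eq_0 add.commute)
qed

lemma module_op_scale: "module (op_scale scale)"
  by unfold_locales
    (simp_all add: op_scale_def fun_eq_iff scale_right_distrib scale_left_distrib)

lemma module_pair_scale: "module (pair_scale scale)"
  by unfold_locales
    (auto simp: op_scale_def fun_eq_iff scale_right_distrib scale_left_distrib)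

lemma deg0_act_eq:
  assumes T: "T \<in> deg0 scale E"
    and add: "\<And>T T'. G (T + T') = G T + G T'"
    and scl: "\<And>c T. G (op_scale scale c T) = scale c (G T)"
    and V: "\<And>a b. G (Vop a b) = F a b w"
    and E: "\<And>e. e \<in> E \<Longrightarrow> G e = scale (of_int i) w"
  shows "deg0_act scale E i F T w = G T"
proof -
  interpret O: module "op_scale scale" by (rule module_op_scale)
  interpret P: module "pair_scale scale" by (rule module_pair_scale)
  let ?gens = "{(Vop a b, F a b w) |a b. True} \<union> {(e, scale (of_int i) w) |e. e \<in> E}"
  have zero: "G 0 = 0"
    using add[of 0 0] by simp
  have "(T, G T) \<in> P.span ?gens"
    using T[unfolded deg0_def]
  proof (induction rule: O.span_induct_alt)
    case base
    show ?case
      using P.span_zero[of ?gens] by (simp only: zero zero_prod_def)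
  next
    case (step c x y)
    from step(1) consider a b where "x = Vop a b" | "x \<in> E"
      by blast
    then have "(x, G x) \<in> ?gens"
    proof cases
      case (1 a b)
      then have "(x, G x) = (Vop a b, F a b w)"
        by (simp add: V)
      then show ?thesis
        by blast
    qed (auto simp: E)
    then have "pair_scale scale c (x, G x) + (y, G y) \<in> P.span ?gens"
      by (rule P.span_add[OF P.span_scale[OF P.span_base] step(2)])
    then show ?case
      by (simp only: add scl pair_scale.simps add_Pair)
  qed
  moreover have "snd p = G (fst p)" if "p \<in> P.span ?gens" for p
    using that
  proof (induction rule: P.span_induct_alt)
    case base
    show ?case by (simp only: fst_zero snd_zero zero)
  next
    case (step c x y)
    obtain T z where x: "x = (T, z)"
      by fastforce
    have "z = G T"
      using step(1) V E by (auto simp: x)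
    then show ?case
      using step(2) by (simp only: x pair_scale.simps fst_add snd_add fst_conv snd_conv add scl)
  qed
  ultimately show ?thesis
    unfolding deg0_act_def by (intro the_equality) auto
qed

lemma id_eq_Vop: "id = Vop 1 (1 :: 'a)"
  by (simp add: fun_eq_iff Vop_def alg_simps)

lemma Vop_in_deg0: "Vop a b \<in> deg0 scale E"
  unfolding deg0_def by (rule module.span_base[OF module_op_scale]) auto

lemma deg0_id: "deg0 scale {id} = Instrl scale"
proof -
  have "{Vop x y |x y. True} \<union> {id} = ({Vop x y |x y. True} :: ('a \<Rightarrow> 'a) set)"
    using id_eq_Vop by blast
  then show ?thesis
    by (simp add: Instrl_def deg0_def)
qed

lemma scale_two: "scale 2 w = w + w"
  using scale_left_distrib[of 1 1 w] by simp

lemma act_A_plus_eq: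
  assumes "E \<subseteq> {id}" "T \<in> deg0 scale E"
  shows "act_A_plus scale E T w = T w"
  unfolding act_A_plus_def
  by (rule deg0_act_eq[OF assms(2), where G = "\<lambda>T. T w"])
    (use assms(1) in \<open>auto simp: op_scale_def\<close>)

lemma act_A_minus_eq:
  assumes "E \<subseteq> {id}" "T \<in> deg0 scale E"
  shows "act_A_minus scale E T w = T w - (T 1 + bar (T 1)) * w"
  unfolding act_A_minus_def
  by (rule deg0_act_eq[OF assms(2), where G = "\<lambda>T. T w - (T 1 + bar (T 1)) * w"])
    (use assms(1) in \<open>auto simp: op_scale_def Vop_def alg_simps scale_right_distrib
      scale_right_diff_distrib\<close>)

lemma act_S_plus_eq:
  assumes "(2 :: 'k) \<noteq> 0" "(3 :: 'k) \<noteq> 0" "w \<in> Skew" "E \<subseteq> {id}" "T \<in> deg0 scale E"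
  shows "act_S_plus scale E T w = T w + w * bar (T 1)"
  unfolding act_S_plus_def
  by (rule deg0_act_eq[OF assms(5), where G = "\<lambda>T. T w + w * bar (T 1)"])
    (use assms in \<open>auto simp: op_scale_def alg_simps scale_right_distrib scale_two Skew_def
      psi_eq_Vop[symmetric]\<close>)

lemma act_S_minus_eq:
  assumes "(2 :: 'k) \<noteq> 0" "(3 :: 'k) \<noteq> 0" "w \<in> Skew" "E \<subseteq> {id}" "T \<in> deg0 scale E"
  shows "act_S_minus scale E T w = T w - (T 1 + bar (T 1)) * w - w * T 1"
  unfolding act_S_minus_def
proof (rule deg0_act_eq[OF assms(5), where G = "\<lambda>T. T w - (T 1 + bar (T 1)) * w - w * T 1"])
  fix a b
  have "psi b (w * a) = - Vop b a w - w * bar (Vop b a 1)"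
    using psi_eq_Vop[of w b a] assms(1-3) by (simp add: Skew_def minus_equation_iff[of "psi b (w * a)"])
  then show "Vop a b w - (Vop a b 1 + bar (Vop a b 1)) * w - w * Vop a b 1 = psi b (w * a)"
    by (simp add: Vop_def alg_simps)
next
  fix e assume "e \<in> E"
  then have "e = id"
    using assms(4) by auto
  then show "e w - (e 1 + bar (e 1)) * w - w * e 1 = scale (of_int (- 2)) w"
    by (simp add: alg_simps scale_two)
qed (simp_all add: op_scale_def alg_simps scale_right_distrib scale_right_diff_distrib)

lemma deg0_act_Vop:
  assumes "E \<subseteq> {id}"
  shows "act_A_plus scale E (Vop a b) x = Vop a b x"
    and "act_A_minus scale E (Vop a b) y = - Vop b a y"
    and "\<lbrakk>(2 :: 'k) \<noteq> 0; (3 :: 'k) \<noteq> 0; s \<in> Skew\<rbrakk>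
      \<Longrightarrow> act_S_plus scale E (Vop a b) s = - psi a (s * b)"
    and "\<lbrakk>(2 :: 'k) \<noteq> 0; (3 :: 'k) \<noteq> 0; t \<in> Skew\<rbrakk>
      \<Longrightarrow> act_S_minus scale E (Vop a b) t = psi b (t * a)"
proof -
  show "act_A_plus scale E (Vop a b) x = Vop a b x"
    by (simp add: act_A_plus_eq[OF assms Vop_in_deg0])
  show "act_A_minus scale E (Vop a b) y = - Vop b a y"
    by (simp add: act_A_minus_eq[OF assms Vop_in_deg0] Vop_def alg_simps)
  show "act_S_plus scale E (Vop a b) s = - psi a (s * b)"
    if "(2 :: 'k) \<noteq> 0" "(3 :: 'k) \<noteq> 0" "s \<in> Skew"
    using that psi_eq_Vop[of s a b]
    by (simp add: act_S_plus_eq[OF that assms Vop_in_deg0] Skew_def)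
  show "act_S_minus scale E (Vop a b) t = psi b (t * a)"
    if "(2 :: 'k) \<noteq> 0" "(3 :: 'k) \<noteq> 0" "t \<in> Skew"
  proof -
    have "psi b (t * a) = - Vop b a t - t * bar (Vop b a 1)"
      using psi_eq_Vop[of t b a] that by (simp add: Skew_def minus_equation_iff[of "psi b (t * a)"])
    then show ?thesis
      by (simp add: act_S_minus_eq[OF that assms Vop_in_deg0] Vop_def alg_simps)
  qed
qed

lemma deg0_act_id:
  shows "act_A_plus scale {id} id x = x"
    and "act_A_minus scale {id} id y = - y"
    and "\<lbrakk>(2 :: 'k) \<noteq> 0; (3 :: 'k) \<noteq> 0; s \<in> Skew\<rbrakk> \<Longrightarrow> act_S_plus scale {id} id s = scale 2 s"
    and "\<lbrakk>(2 :: 'k) \<noteq> 0; (3 :: 'k) \<noteq> 0; t \<in> Skew\<rbrakk> \<Longrightarrow> act_S_minus scale {id} id t = scale (- 2) t"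
proof -
  have id: "id \<in> deg0 scale {id}"
    unfolding id_eq_Vop by (rule Vop_in_deg0)
  show "act_A_plus scale {id} id x = x" "act_A_minus scale {id} id y = - y"
    by (simp_all add: act_A_plus_eq act_A_minus_eq id alg_simps)
  show "act_S_plus scale {id} id s = scale 2 s"
    if "(2 :: 'k) \<noteq> 0" "(3 :: 'k) \<noteq> 0" "s \<in> Skew"
    using act_S_plus_eq[OF that _ id] by (simp add: alg_simps scale_two)
  show "act_S_minus scale {id} id t = scale (- 2) t"
    if "(2 :: 'k) \<noteq> 0" "(3 :: 'k) \<noteq> 0" "t \<in> Skew"
    using act_S_minus_eq[OF that _ id] by (simp add: alg_simps scale_two)
qed

text \<open>
  Hence \<open>ad \<zeta>\<close> is the grading derivation.
\<close>

lemma bracket_zeta: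
  assumes "(2 :: 'k) \<noteq> 0" "(3 :: 'k) \<noteq> 0"
    and "(t, y, T, x, s) \<in> graded_carrier scale {id}"
  shows "graded_bracket scale {id} c zeta (t, y, T, x, s) = (scale (- 2) t, - y, 0, x, scale 2 s)"
proof -
  from assms(3) have T: "T \<in> deg0 scale {id}" and ts: "t \<in> Skew" "s \<in> Skew"
    by (simp_all add: graded_carrier_def)
  have "0 \<in> (Skew :: 'a set)"
    by (simp add: Skew_def bar_zero)
  moreover have "T 0 = 0"
  proof -
    interpret O: module "op_scale scale" by (rule module_op_scale)
    show ?thesis
    proof (rule O.span_induct_alt[where h = "\<lambda>T. T 0 = 0", OF T[unfolded deg0_def]])
      fix c :: 'k and f g :: "'a \<Rightarrow> 'a"
      assume "f \<in> {Vop x y |x y. True} \<union> {id}" "g 0 = 0"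
      then show "(op_scale scale c f + g) 0 = 0"
        by (auto simp: op_scale_def Vop_def alg_simps)
    qed simp
  qed
  ultimately have "act_S_minus scale {id} T 0 = 0" "act_A_minus scale {id} T 0 = 0"
      "act_A_plus scale {id} T 0 = 0" "act_S_plus scale {id} T 0 = 0"
    using assms(1,2) T
    by (simp_all add: act_S_minus_eq act_A_minus_eq act_A_plus_eq act_S_plus_eq alg_simps)
  moreover have "op_scale scale c (Vop 0 y - Vop x 0) = 0"
    by (simp add: op_scale_def Vop_def alg_simps fun_eq_iff)
  ultimately show ?thesis
    using assms(1,2) ts
    by (simp add: zeta_def deg0_act_id psi_def Lop_def alg_simps fun_eq_iff)
qed

end

end

(*
  In K(A) = L_{-2} + ... + L_2, with grading element \<zeta> = id, the pair (x, s) is one-invertible iff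
  some e_-(Y, R) e_+(x, s) e_-(Z, Q) maps \<zeta> to -\<zeta>. The map L_{-2} \<rightarrow> L_2 sending t to the
  component of degree 2 of E = e_+(x, s) t is injective: if this component of E vanishes, then
  (ad E)^3 = 0 and the division property kills the components of degrees 1 and 0 in turn. Hence
  it is bijective. Take t with top component w \<noteq> 0 and remove the remaining components of E by
  some e_-(Y, R); the same injectivity shows that exactly w is left over, and then \<zeta> is mapped to
  -\<zeta> modulo L_1 + L_2, which is corrected by e_-(Z, Q).

  For e_+(2 x, 2 s) the components of degrees 0, 1, 2 of this condition are the system for (u, t). It
  gives that the resulting automorphism h and its inverse both map t to 4 s, whereas
  h (s^) = 4 (s + q_x (s^)); applying h to [s, s^] = -\<zeta> yields t = (s + q_x (s^))^. The formulas for u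
  follow in the same way from the automorphism belonging to (x, 0) and the sl_2-triple of x and x^.
*)
theory Submission
  imports Defs
begin

text \<open>The obstacle is the component of degree 0. After Y has removed the component of degree
  1, R changes that of degree 0 only by [w, R], and such brackets need not fill
  \<open>Instrl\<close>. So R is chosen only such that the remainder T' commutes with w. If [w, f] =
  -\<zeta>, then the new element E' satisfies [E', f] = -\<zeta>, hence (ad E')^2 f = [\<zeta>, E'],
  and (ad E')^2 f - 2 E' has the components of E' multiplied by i - 2 in degree i. This kills degree
  2, so injectivity makes the whole element zero, and i - 2 is invertible in the degrees 0, -1, -2
  that are left. The factor 2 in e_+(2 x, 2 s) is forced by the first equation: with it, the
  condition in degree 0 reads \<zeta> - 2 [x, u] + 2 [s, t] = -\<zeta>. Algebraicity speaks of K(A)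
  and one-invertibility of K'(A). The argument takes place in K(A), and a rescaling of the
  components carries the result over. Only grading, exponentials and division matter for the main
  part, which is therefore done in an abstract graded algebra.\<close>

definition trunc_exp ::
    "('k::field \<Rightarrow> 'b::ab_group_add \<Rightarrow> 'b) \<Rightarrow> ('b \<Rightarrow> 'b \<Rightarrow> 'b) \<Rightarrow> 'b \<Rightarrow> 'b \<Rightarrow> 'b" where
  "trunc_exp scl br X v = (\<Sum>i\<le>4. scl (1 / of_nat (fact i)) ((br X ^^ i) v))"

text \<open>Coordinates with respect to a basis are linear and separate vectors. Replacing vectors
  by their values under an arbitrary linear functional turns an identity with scalar coefficients
  into one in the field, where ring normalization and \<open>algebra\<close> apply.\<close>

lemma (in vector_space) vec_eqI:
  assumes "\<And>\<phi> :: 'b \<Rightarrow> 'a. \<lbrakk>\<And>u v. \<phi> (u + v) = \<phi> u + \<phi> v; \<And>u v. \<phi> (u - v) = \<phi> u - \<phi> v;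
      \<And>v. \<phi> (- v) = - \<phi> v; \<phi> 0 = 0; \<And>c v. \<phi> (c *s v) = c * \<phi> v\<rbrakk> \<Longrightarrow> \<phi> v = \<phi> w"
  shows "v = w"
proof -
  obtain B where B: "independent B" "span B = UNIV"
    using maximal_independent_subset[of UNIV] by (metis top.extremum_uniqueI)
  have "representation B v b = representation B w b" for b
    using B by (intro assms) (simp_all add: representation_add representation_diff
        representation_neg representation_scale representation_zero)
  then have "representation B (v - w) b = 0" for b
    using B by (simp add: representation_diff)
  then show ?thesis
    using B sum_nonzero_representation_eq[of B "v - w"] by simp
qed

section \<open>5-graded Lie algebras with exponential automorphisms\<close>

text \<open>\<open>cp i\<close> is the projection to degree i. The type may be larger than the
  algebra: by \<open>br_cp\<close> the bracket sees only the sum of the components. The assumptions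
  are stable under reversal of the grading, see \<open>dual\<close>. \<open>inj_imp_surj\<close>
  stands for finite dimension: in K(A) the degrees 2 and -2 are copies of the same
  finite-dimensional space.\<close>

locale graded_exp_algebra = vector_space scl
  for scl :: "'k::field \<Rightarrow> 'b::ab_group_add \<Rightarrow> 'b" (infixr "*s" 75) +
  fixes br :: "'b \<Rightarrow> 'b \<Rightarrow> 'b"
    and cp :: "int \<Rightarrow> 'b \<Rightarrow> 'b"
    and ze :: 'b
  assumes two: "(2 :: 'k) \<noteq> 0" and three: "(3 :: 'k) \<noteq> 0"
    and br_add_left: "br (u + v) w = br u w + br v w"
    and br_scale_left: "br (c *s v) w = c *s br v w"
    and br_anti: "br v w = - br w v"
    and cp_add: "cp i (u + v) = cp i u + cp i v"
    and cp_scale: "cp i (c *s v) = c *s cp i v"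
    and cp_cp: "cp i (cp j v) = (if i = j then cp i v else 0)"
    and cp_out: "i < -2 \<or> 2 < i \<Longrightarrow> cp i v = 0"
    and br_cp: "br (\<Sum>i = -2..2. cp i v) w = br v w"
    and br_deg: "cp i v = v \<Longrightarrow> cp j w = w \<Longrightarrow> cp (i + j) (br v w) = br v w"
    and ze_deg: "cp 0 ze = ze"
    and br_ze: "cp i v = v \<Longrightarrow> br ze v = of_int i *s v"
    and exp_plus: "\<lbrakk>cp 1 x = x; cp 2 s = s; cp i v = v; cp j w = w\<rbrakk> \<Longrightarrow>
      trunc_exp scl br (x + s) (br v w)
        = br (trunc_exp scl br (x + s) v) (trunc_exp scl br (x + s) w)"
    and exp_minus: "\<lbrakk>cp (-1) y = y; cp (-2) t = t; cp i v = v; cp j w = w\<rbrakk> \<Longrightarrow>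
      trunc_exp scl br (y + t) (br v w)
        = br (trunc_exp scl br (y + t) v) (trunc_exp scl br (y + t) w)"
    and deg0_generated: "cp 0 v = v \<Longrightarrow> v \<in> span {br x y |x y. cp 1 x = x \<and> cp (-1) y = y}"
    and deg1_nonzero: "\<exists>x. cp 1 x = x \<and> x \<noteq> 0"
    and division_plus: "cp 1 x = x \<Longrightarrow> x \<noteq> 0 \<Longrightarrow> \<exists>y. cp (-1) y = y \<and> br x y = ze"
    and division_minus: "cp (-1) y = y \<Longrightarrow> y \<noteq> 0 \<Longrightarrow> \<exists>x. cp 1 x = x \<and> br x y = ze"
    and faithful_plus: "\<lbrakk>cp 0 v = v; \<And>x. cp 1 x = x \<Longrightarrow> br v x = 0\<rbrakk> \<Longrightarrow> v = 0"
    and faithful_minus: "\<lbrakk>cp 0 v = v; \<And>y. cp (-1) y = y \<Longrightarrow> br v y = 0\<rbrakk> \<Longrightarrow> v = 0"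
    and inj_imp_surj: "\<lbrakk>i = 2 \<or> i = -2; \<And>u v. F (u + v) = F u + F v; \<And>c v. F (c *s v) = c *s F v;
        \<And>v. cp i v = v \<Longrightarrow> cp (- i) (F v) = F v; \<And>v. cp i v = v \<Longrightarrow> F v = 0 \<Longrightarrow> v = 0;
        cp (- i) w = w\<rbrakk> \<Longrightarrow> \<exists>v. cp i v = v \<and> F v = w"
begin

section \<open>Components and the bilinear bracket\<close>

definition L :: "int \<Rightarrow> 'b set" where "L i = {v. cp i v = v}"

definition pr :: "'b \<Rightarrow> 'b" where "pr v = (\<Sum>i = -2..2. cp i v)"

abbreviation ex :: "'b \<Rightarrow> 'b \<Rightarrow> 'b" where "ex \<equiv> trunc_exp scl br"

lemma LD: "v \<in> L i \<Longrightarrow> cp i v = v" and LI: "cp i v = v \<Longrightarrow> v \<in> L i"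
  by (simp_all add: L_def)

lemma cp_zero [simp]: "cp i 0 = 0"
  using cp_add[of i 0 0] by simp

lemma cp_minus: "cp i (- v) = - cp i v"
  using cp_add[of i v "- v"] by (simp add: eq_neg_iff_add_eq_0 add.commute)

lemma cp_diff: "cp i (u - v) = cp i u - cp i v"
  using cp_add[of i u "- v"] by (simp add: cp_minus)

lemma cp_sum: "cp i (sum f A) = (\<Sum>a\<in>A. cp i (f a))"
  by (induction A rule: infinite_finite_induct) (simp_all add: cp_add)

lemma cp_L: "v \<in> L j \<Longrightarrow> cp i v = (if i = j then v else 0)"
  using cp_cp[of i j v] by (auto simp: L_def)

lemma L_add [simp]: "u \<in> L i \<Longrightarrow> v \<in> L i \<Longrightarrow> u + v \<in> L i"
  and L_minus [simp]: "v \<in> L i \<Longrightarrow> - v \<in> L i"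
  and L_diff [simp]: "u \<in> L i \<Longrightarrow> v \<in> L i \<Longrightarrow> u - v \<in> L i"
  and L_scale [simp]: "v \<in> L i \<Longrightarrow> c *s v \<in> L i"
  and L_zero [simp]: "0 \<in> L i"
  by (simp_all add: L_def cp_add cp_minus cp_diff cp_scale)

lemma L_cp [simp]: "cp i v \<in> L i"
  by (simp add: L_def cp_cp)

lemma L_ze [simp]: "ze \<in> L 0"
  by (simp add: L_def ze_deg)

lemma L_out: "v \<in> L i \<Longrightarrow> i < -2 \<or> 2 < i \<Longrightarrow> v = 0"
  by (metis LD cp_out)

lemma L_br: "v \<in> L i \<Longrightarrow> w \<in> L j \<Longrightarrow> i + j = k \<Longrightarrow> br v w \<in> L k"
  using br_deg[of i v j w] by (auto simp: L_def)

lemma br_zero_left [simp]: "br 0 w = 0"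
  using br_add_left[of 0 0 w] by simp

lemma br_minus_left: "br (- v) w = - br v w"
  using br_add_left[of v "- v" w] by (simp add: eq_neg_iff_add_eq_0 add.commute)

lemma br_zero_right [simp]: "br v 0 = 0"
  using br_anti[of v 0] by simp

lemma br_add_right: "br v (u + w) = br v u + br v w"
  by (subst (1 2 3) br_anti) (simp add: br_add_left)

lemma br_scale_right: "br v (c *s w) = c *s br v w"
  by (subst (1 2) br_anti) (simp add: br_scale_left)

lemma br_minus_right: "br v (- w) = - br v w"
  by (subst (1 2) br_anti) (simp add: br_minus_left)

lemma br_diff_left: "br (u - v) w = br u w - br v w"
  using br_add_left[of u "- v" w] by (simp add: br_minus_left)

lemma br_diff_right: "br v (u - w) = br v u - br v w"
  using br_add_right[of v u "- w"] by (simp add: br_minus_right)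

lemmas br_lin = br_add_left br_add_right br_minus_left br_minus_right br_diff_left br_diff_right
  br_scale_left br_scale_right

lemma br_sum_left: "br (sum f A) w = (\<Sum>a\<in>A. br (f a) w)"
  by (induction A rule: infinite_finite_induct) (simp_all add: br_add_left)

lemma br_sum_right: "br v (sum f A) = (\<Sum>a\<in>A. br v (f a))"
  by (induction A rule: infinite_finite_induct) (simp_all add: br_add_right)

lemma br_self [simp]: "br v v = 0"
proof -
  have "br v v + br v v = 0"
    using br_anti[of v v] by (simp add: eq_neg_iff_add_eq_0)
  then have "2 *s br v v = 0"
    using scale_left_distrib[of 1 1 "br v v"] by simp
  then show ?thesis
    using two by simp
qed

lemma br_pr_left: "br (pr v) w = br v w"
  by (simp add: pr_def br_cp)

lemma br_pr_right: "br v (pr w) = br v w"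
  by (subst (1 2) br_anti) (simp add: br_pr_left)

lemma br_ze_L: "v \<in> L i \<Longrightarrow> br ze v = of_int i *s v"
  by (simp add: L_def br_ze)

lemma ad_pow_L: "X \<in> L d \<Longrightarrow> v \<in> L i \<Longrightarrow> (br X ^^ k) v \<in> L (i + int k * d)"
proof (induction k)
  case (Suc k)
  then show ?case
    using L_br[of X d "(br X ^^ k) v" "i + int k * d"] by (simp add: algebra_simps)
qed simp

section \<open>The Jacobi identity\<close>

lemma exp_hom_L:
  assumes "X \<in> L d" "d \<in> {1, 2, -1, -2}" "v \<in> L i" "w \<in> L j"
  shows "ex X (br v w) = br (ex X v) (ex X w)"
  using assms exp_plus[of X 0 i v j w] exp_plus[of 0 X i v j w]
    exp_minus[of X 0 i v j w] exp_minus[of 0 X i v j w]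
  by (auto simp: L_def)

text \<open>
  Comparing the components of degree \<open>i + j + d\<close> in \<open>e(X)[v, w] = [e(X)v, e(X)w]\<close> shows that
  \<open>ad X\<close> is a derivation, so the Jacobi identity need not be assumed.
\<close>

lemma derivation_hom:
  assumes X: "X \<in> L d" "d \<in> {1, 2, -1, -2}" and v: "v \<in> L i" and w: "w \<in> L j"
  shows "br X (br v w) = br (br X v) w + br v (br X w)"
proof -
  define a :: "nat \<Rightarrow> 'k" where "a k = 1 / of_nat (fact k)" for k
  have d: "d \<noteq> 0" and mult: "int k * d = d \<longleftrightarrow> k = 1" for k
    using X(2) by auto
  have a: "a 0 = 1" "a 1 = 1"
    by (simp_all add: a_def)
  let ?n = "i + j + d"
  have *: "cp ?n ((br X ^^ k) (br v w)) = (if k = 1 then br X (br v w) else 0)" for k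
  proof -
    have "(br X ^^ k) (br v w) \<in> L (i + j + int k * d)"
      using ad_pow_L[OF X(1) L_br[OF v w refl]] .
    moreover have "i + j + d = i + j + int k * d \<longleftrightarrow> k = 1"
      using mult[of k] by auto
    ultimately show ?thesis
      by (simp add: cp_L)
  qed
  have "cp ?n (ex X (br v w)) = (\<Sum>k\<le>(4::nat). a k *s (if k = 1 then br X (br v w) else 0))"
    by (simp add: trunc_exp_def cp_sum cp_scale * a_def)
  also have "\<dots> = (\<Sum>k\<le>(4::nat). if k = 1 then br X (br v w) else 0)"
    by (rule sum.cong) (auto simp: a_def)
  also have "\<dots> = br X (br v w)"
    by simp
  finally have 1: "cp ?n (ex X (br v w)) = br X (br v w)" .
  have **: "cp ?n (br ((br X ^^ k) v) ((br X ^^ l) w))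
      = (if k + l = 1 then br ((br X ^^ k) v) ((br X ^^ l) w) else 0)" for k l
  proof -
    have "br ((br X ^^ k) v) ((br X ^^ l) w) \<in> L ((i + int k * d) + (j + int l * d))"
      by (rule L_br[OF ad_pow_L[OF X(1) v] ad_pow_L[OF X(1) w] refl])
    then have "br ((br X ^^ k) v) ((br X ^^ l) w) \<in> L (i + j + int (k + l) * d)"
      by (simp add: algebra_simps)
    moreover have "i + j + d = i + j + int (k + l) * d \<longleftrightarrow> k + l = 1"
      using mult[of "k + l"] by linarith
    ultimately show ?thesis
      by (simp only: cp_L)
  qed
  have "cp ?n (br (ex X v) (ex X w))
      = (\<Sum>l\<le>(4::nat). \<Sum>k\<le>(4::nat). a l *s a k *s
          (if k + l = 1 then br ((br X ^^ k) v) ((br X ^^ l) w) else 0))"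
    unfolding trunc_exp_def br_sum_left br_sum_right br_scale_left br_scale_right
    by (simp only: cp_sum cp_scale ** a_def[symmetric] scale_sum_right)
  also have "\<dots> = br (br X v) w + br v (br X w)"
    using a by (simp add: eval_nat_numeral atMost_Suc add.commute)
  finally show ?thesis
    using exp_hom_L[OF X v w] 1 by simp
qed

lemma jacobi_hom:
  assumes X: "X \<in> L d" "d \<in> {1, 2, -1, -2}"
  shows "br X (br v w) = br (br X v) w + br v (br X w)"
proof -
  have *: "br X (br (cp i v) w) = br (br X (cp i v)) w + br (cp i v) (br X w)" for i
  proof -
    have "br X (br (cp i v) (cp j w)) = br (br X (cp i v)) (cp j w) + br (cp i v) (br X (cp j w))" for j
      by (rule derivation_hom[OF X L_cp L_cp])
    then have "br X (br (cp i v) (pr w)) = br (br X (cp i v)) (pr w) + br (cp i v) (br X (pr w))"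
      by (simp add: pr_def br_sum_right sum.distrib)
    then show ?thesis
      by (simp add: br_pr_right)
  qed
  have "br X (br (pr v) w) = br (br X (pr v)) w + br (pr v) (br X w)"
    by (simp only: pr_def br_sum_right br_sum_left sum.distrib *)
  then show ?thesis
    by (simp add: br_pr_left br_pr_right)
qed

text \<open>Nonzero degrees are \<open>jacobi_hom\<close>. Degree 0 is spanned by brackets [x, y]
  with x of degree 1 and y of degree -1, and ad [x, y] is the commutator of the derivations ad x and
  ad y, hence a derivation.\<close>

lemma jacobi: "br u (br v w) = br (br u v) w + br v (br u w)"
proof -
  have 0: "br z (br v w) = br (br z v) w + br v (br z w)" if "z \<in> L 0" for z v w
  proof -
    have "z \<in> span {br x y |x y. cp 1 x = x \<and> cp (-1) y = y}"
      using that by (intro deg0_generated) (simp add: L_def)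
    then show ?thesis
    proof (induction rule: span_induct_alt)
      case (step c p q)
      from step(1) obtain x y where p: "p = br x y" and "x \<in> L 1" "y \<in> L (-1)"
        by (auto simp: L_def)
      have J: "br x (br v w) = br (br x v) w + br v (br x w)"
          "br y (br v w) = br (br y v) w + br v (br y w)" for v w
        by (rule jacobi_hom[OF \<open>x \<in> L 1\<close>], simp) (rule jacobi_hom[OF \<open>y \<in> L (-1)\<close>], simp)
      have p': "br p w = br x (br y w) - br y (br x w)" for w
        using J(1)[of y w] by (simp add: p)
      have "br p (br v w) = br (br p v) w + br v (br p w)"
        unfolding p'
        by (simp add: J[of v w] J(1)[of "br y v" w] J(1)[of v "br y w"] J(2)[of "br x v" w]
            J(2)[of v "br x w"] br_lin)
      then show ?case
        using step(2) by (simp add: br_lin scale_right_distrib)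
    qed simp
  qed
  have *: "br (cp i u) (br v w) = br (br (cp i u) v) w + br v (br (cp i u) w)" if "i \<in> {-2..2}" for i
  proof (cases "i = 0")
    case True
    then show ?thesis using 0[of "cp i u" v w] L_cp by simp
  next
    case False
    then have "i \<in> {1, 2, -1, -2}" using that by auto
    then show ?thesis by (intro jacobi_hom[OF L_cp])
  qed
  have "br (pr u) (br v w) = br (br (pr u) v) w + br v (br (pr u) w)"
    unfolding pr_def br_sum_left br_sum_right sum.distrib[symmetric]
    by (rule sum.cong[OF refl *])
  then show ?thesis
    by (simp add: br_pr_left)
qed

lemma L_br_simps [simp]:
  "v \<in> L (-2) \<Longrightarrow> w \<in> L 0 \<Longrightarrow> br v w \<in> L (-2)"
  "v \<in> L (-2) \<Longrightarrow> w \<in> L 1 \<Longrightarrow> br v w \<in> L (-1)"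
  "v \<in> L (-2) \<Longrightarrow> w \<in> L 2 \<Longrightarrow> br v w \<in> L 0"
  "v \<in> L (-1) \<Longrightarrow> w \<in> L (-1) \<Longrightarrow> br v w \<in> L (-2)"
  "v \<in> L (-1) \<Longrightarrow> w \<in> L 0 \<Longrightarrow> br v w \<in> L (-1)"
  "v \<in> L (-1) \<Longrightarrow> w \<in> L 1 \<Longrightarrow> br v w \<in> L 0"
  "v \<in> L (-1) \<Longrightarrow> w \<in> L 2 \<Longrightarrow> br v w \<in> L 1"
  "v \<in> L 0 \<Longrightarrow> w \<in> L (-2) \<Longrightarrow> br v w \<in> L (-2)"
  "v \<in> L 0 \<Longrightarrow> w \<in> L (-1) \<Longrightarrow> br v w \<in> L (-1)"
  "v \<in> L 0 \<Longrightarrow> w \<in> L 0 \<Longrightarrow> br v w \<in> L 0"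
  "v \<in> L 0 \<Longrightarrow> w \<in> L 1 \<Longrightarrow> br v w \<in> L 1"
  "v \<in> L 0 \<Longrightarrow> w \<in> L 2 \<Longrightarrow> br v w \<in> L 2"
  "v \<in> L 1 \<Longrightarrow> w \<in> L (-2) \<Longrightarrow> br v w \<in> L (-1)"
  "v \<in> L 1 \<Longrightarrow> w \<in> L (-1) \<Longrightarrow> br v w \<in> L 0"
  "v \<in> L 1 \<Longrightarrow> w \<in> L 0 \<Longrightarrow> br v w \<in> L 1"
  "v \<in> L 1 \<Longrightarrow> w \<in> L 1 \<Longrightarrow> br v w \<in> L 2"
  "v \<in> L 2 \<Longrightarrow> w \<in> L (-2) \<Longrightarrow> br v w \<in> L 0"
  "v \<in> L 2 \<Longrightarrow> w \<in> L (-1) \<Longrightarrow> br v w \<in> L 1"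
  "v \<in> L 2 \<Longrightarrow> w \<in> L 0 \<Longrightarrow> br v w \<in> L 2"
  by (goal_cases, (rule L_br, assumption+, simp)+)

lemma br_vanish [simp]:
  "v \<in> L (-2) \<Longrightarrow> w \<in> L (-2) \<Longrightarrow> br v w = 0"
  "v \<in> L (-2) \<Longrightarrow> w \<in> L (-1) \<Longrightarrow> br v w = 0"
  "v \<in> L (-1) \<Longrightarrow> w \<in> L (-2) \<Longrightarrow> br v w = 0"
  "v \<in> L 1 \<Longrightarrow> w \<in> L 2 \<Longrightarrow> br v w = 0"
  "v \<in> L 2 \<Longrightarrow> w \<in> L 1 \<Longrightarrow> br v w = 0"
  "v \<in> L 2 \<Longrightarrow> w \<in> L 2 \<Longrightarrow> br v w = 0"
  by (goal_cases, (rule L_out, rule L_br, assumption+, rule refl, simp)+)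

lemma numeral_neq_zero': "(4 :: 'k) \<noteq> 0" "(6 :: 'k) \<noteq> 0" "(8 :: 'k) \<noteq> 0" "(9 :: 'k) \<noteq> 0" "(12 :: 'k) \<noteq> 0"
  "(16 :: 'k) \<noteq> 0" "(18 :: 'k) \<noteq> 0" "(24 :: 'k) \<noteq> 0" "(36 :: 'k) \<noteq> 0"
proof -
  have *: "(2 :: 'k) * 2 \<noteq> 0" "(2 :: 'k) * 3 \<noteq> 0" "(2 :: 'k) * (2 * 2) \<noteq> 0" "(3 :: 'k) * 3 \<noteq> 0"
    "(2 :: 'k) * (2 * 3) \<noteq> 0" "(2 :: 'k) * (2 * (2 * 2)) \<noteq> 0" "(2 :: 'k) * (3 * 3) \<noteq> 0"
    "(2 :: 'k) * (2 * (2 * 3)) \<noteq> 0" "(2 :: 'k) * (2 * (3 * 3)) \<noteq> 0"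
    using two three by (simp_all only: mult_eq_0_iff simp_thms)
  then show "(4 :: 'k) \<noteq> 0" "(6 :: 'k) \<noteq> 0" "(8 :: 'k) \<noteq> 0" "(9 :: 'k) \<noteq> 0" "(12 :: 'k) \<noteq> 0"
    "(16 :: 'k) \<noteq> 0" "(18 :: 'k) \<noteq> 0" "(24 :: 'k) \<noteq> 0" "(36 :: 'k) \<noteq> 0"
    by simp_all
qed

lemmas numeral_neq_zero = two three numeral_neq_zero'

lemma br_ze_simps [simp]:
  "v \<in> L 2 \<Longrightarrow> br ze v = 2 *s v" "v \<in> L 1 \<Longrightarrow> br ze v = v" "v \<in> L 0 \<Longrightarrow> br ze v = 0"
  "v \<in> L (-1) \<Longrightarrow> br ze v = - v" "v \<in> L (-2) \<Longrightarrow> br ze v = - (2 *s v)"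
  "v \<in> L 2 \<Longrightarrow> br v ze = - (2 *s v)" "v \<in> L 1 \<Longrightarrow> br v ze = - v" "v \<in> L 0 \<Longrightarrow> br v ze = 0"
  "v \<in> L (-1) \<Longrightarrow> br v ze = v" "v \<in> L (-2) \<Longrightarrow> br v ze = 2 *s v"
  by (simp_all add: br_ze_L br_anti[of v ze])

section \<open>sl_2-triples and injectivity of ad\<close>

lemma sl2_shift: "br x y = ze \<Longrightarrow> br y (br x v) = br x (br y v) - br ze v"
  using jacobi[of y x v] br_anti[of y x] by (simp add: br_minus_left)

text \<open>t is a lowest weight vector for the sl_2-triple of x and y, with string of length 5.
  Since the semisimple element is 2 \<open>ze\<close>, the k-th constant is k (5 - k) / 2, that is
  2, 3, 3, 2. Their product 36 is invertible as the characteristic is not 2 or 3.\<close>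

lemma sl2_lower:
  assumes x: "x \<in> L 1" and y: "y \<in> L (-1)" and xy: "br x y = ze" and t: "t \<in> L (-2)"
  shows "br y (br x t) = 2 *s t" "br y (br x (br x t)) = 3 *s br x t"
    "br y (br x (br x (br x t))) = 3 *s br x (br x t)"
    "br y (br x (br x (br x (br x t)))) = 2 *s br x (br x (br x t))"
proof -
  note sh = sl2_shift[OF xy]
  have v: "v + 2 *s v = 3 *s v" "3 *s v - v = 2 *s v" for v
    using scale_left_distrib[of 1 2 v] scale_left_diff_distrib[of 3 1 v] by simp_all
  show 1: "br y (br x t) = 2 *s t" using x y t by (simp add: sh)
  show 2: "br y (br x (br x t)) = 3 *s br x t" using x y t
    by (simp add: sh[of "br x t"] 1 br_lin v add.commute[of _ "br x t"])
  show 3: "br y (br x (br x (br x t))) = 3 *s br x (br x t)" using x y t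
    by (simp add: sh[of "br x (br x t)"] 2 br_lin)
  show "br y (br x (br x (br x (br x t)))) = 2 *s br x (br x (br x t))" using x y t
    by (simp add: sh[of "br x (br x (br x t))"] 3 br_lin v)
qed

lemma sl2_raise_lower:
  assumes "x \<in> L 1" "y \<in> L (-1)" "br x y = ze" "t \<in> L (-2)"
  shows "br y (br y (br y (br y (br x (br x (br x (br x t))))))) = 36 *s t"
  using assms by (simp add: sl2_lower br_lin)

lemma ad4_inj:
  assumes "x \<in> L 1" "x \<noteq> 0" "t \<in> L (-2)" "br x (br x (br x (br x t))) = 0"
  shows "t = 0"
proof -
  obtain y where "y \<in> L (-1)" "br x y = ze"
    using division_plus assms by (auto simp: L_def)
  then have "36 *s t = 0"
    using sl2_raise_lower[of x y t] assms by simp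
  then show ?thesis
    using numeral_neq_zero' by simp
qed

text \<open>If [x, w] = 0 and [x, y] = \<zeta>, then w = -[x, r] with r = [y, w] of degree -2. So
  [x, [x, r]] = 0, whereas [y, [x, [x, r]]] = 3 [x, r].\<close>

lemma ad_inj_minus1:
  assumes x: "x \<in> L 1" "x \<noteq> 0" and w: "w \<in> L (-1)" "br x w = 0"
  shows "w = 0"
proof -
  obtain y where y: "y \<in> L (-1)" "br x y = ze"
    using division_plus x by (auto simp: L_def)
  have r: "br y w \<in> L (-2)" using y w by simp
  have w': "br x (br y w) = - w"
    using jacobi[of x y w] y w by simp
  then have "3 *s br x (br y w) = 0"
    using sl2_lower(2)[OF x(1) y r] w by (simp add: br_lin)
  then show ?thesis
    using three w' by simp
qed

text \<open>With [x, y] = \<zeta> and [s, x] = 0 one gets -2 s = [s, \<zeta>] = [x, [s, y]].\<close>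

lemma skew_ad_inj:
  assumes "s \<in> L 2" "y \<in> L (-1)" "y \<noteq> 0" "br s y = 0"
  shows "s = 0"
proof -
  obtain x where x: "x \<in> L 1" "br x y = ze"
    using division_minus assms by (auto simp: L_def)
  then have "br s ze = 0"
    using jacobi[of s x y] assms by simp
  then show ?thesis
    using assms(1) two by simp
qed

lemma skew_ad_inj':
  assumes "t \<in> L (-2)" "x \<in> L 1" "x \<noteq> 0" "br t x = 0"
  shows "t = 0"
proof -
  obtain y where y: "y \<in> L (-1)" "br x y = ze"
    using division_plus assms by (auto simp: L_def)
  then have "br t ze = 0"
    using jacobi[of t x y] assms by simp
  then show ?thesis
    using assms(1) two by simp
qed

text \<open>Take e, g of degrees 1, -1 with [e, g] = \<zeta>. From [s, t] = 0 follow [s, [t, e]] = 0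
  and, because [g, [t, e]] = -2 t, also [[s, g], [t, e]] = 0. Here [s, g] is a nonzero element of
  degree 1, so [t, e] = 0 and then t = 0.\<close>

lemma skew_commute:
  assumes s: "s \<in> L 2" "s \<noteq> 0" and t: "t \<in> L (-2)" and st: "br s t = 0"
  shows "t = 0"
proof -
  obtain e where e: "e \<in> L 1" "e \<noteq> 0"
    using deg1_nonzero by (auto simp: L_def)
  obtain g where g: "g \<in> L (-1)" "br e g = ze"
    using division_plus e by (auto simp: L_def)
  have "g \<noteq> 0"
    using g(2) e by (metis br_zero_right br_ze_simps(2) br_zero_left)
  have ge: "br g e = - ze" using g br_anti[of g e] by simp
  have "br t (br s e) = br s (br t e)"
    using jacobi[of t s e] st br_anti[of t s] by simp
  then have *: "br s (br t e) = 0" using s e by simp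
  have "br g (br t e) = - (2 *s t)"
    using jacobi[of g t e] t g e by (simp add: ge br_lin)
  then have "br s (br g (br t e)) = 0"
    using st by (simp add: br_lin)
  then have "br (br s g) (br t e) = 0"
    using jacobi[of s g "br t e"] * by simp
  moreover have "br s g \<noteq> 0"
    using skew_ad_inj[OF s(1) g(1) \<open>g \<noteq> 0\<close>] s by auto
  ultimately have "br t e = 0"
    using ad_inj_minus1[of "br s g" "br t e"] s g t e by simp
  then show ?thesis
    using skew_ad_inj'[OF t e] by simp
qed

text \<open>If T is nonzero, there are y of degree 1 with c = [T, y] nonzero and [T, c] = 0, and v
  nonzero of degree -2 with [T, v] = 0. When (ad T)^3 is distributed over (ad y)^3 v, each y absorbs
  exactly one T, which leaves 3! (ad c)^3 v. As (ad y)^3 v has degree 1, this is 0, against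
  \<open>ad4_inj\<close>.\<close>

lemma nilpotent_deg0:
  assumes T: "T \<in> L 0" and T1: "\<And>v. v \<in> L 1 \<Longrightarrow> br T (br T (br T v)) = 0"
    and T2: "\<And>v. v \<in> L (-2) \<Longrightarrow> br T (br T (br T v)) = 0"
    and S: "t0 \<in> L (-2)" "t0 \<noteq> 0"
  shows "T = 0"
proof (rule ccontr)
  assume "T \<noteq> 0"
  then obtain z where z: "z \<in> L 1" "br T z \<noteq> 0"
    using faithful_plus[of T] T by (auto simp: L_def)
  obtain y where y: "y \<in> L 1" "br T y \<noteq> 0" "br T (br T y) = 0"
  proof (cases "br T (br T z) = 0")
    case False
    then show ?thesis using that[of "br T z"] z T T1 by simp
  qed (use that z in auto)
  obtain v where v: "v \<in> L (-2)" "v \<noteq> 0" "br T v = 0"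
  proof (cases "br T t0 = 0")
    case False
    note 1 = False
    show ?thesis
    proof (cases "br T (br T t0) = 0")
      case False
      then show ?thesis using that[of "br T (br T t0)"] S T T2 by simp
    qed (use that[of "br T t0"] S T 1 in simp)
  qed (use that S in auto)
  define c where "c = br T y"
  have c: "c \<in> L 1" "c \<noteq> 0" "br T c = 0" using y T by (simp_all add: c_def)
  have Ty: "br T (br y u) = br c u + br y (br T u)" for u
    using jacobi[of T y u] by (simp add: c_def)
  have Tc: "br T (br c u) = br c (br T u)" for u
    using jacobi[of T c u] c by simp
  have "br T (br T (br T (br y (br y (br y v))))) = 6 *s br c (br c (br c v))"
    by (rule vec_eqI) (simp add: Ty Tc v br_lin)
  moreover have "br y (br y (br y v)) \<in> L 1" using y v by simp
  ultimately have "br c (br c (br c v)) = 0"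
    using T1 numeral_neq_zero' by simp
  then show False
    using ad4_inj[OF c(1,2) v(1)] v by simp
qed

section \<open>Components of brackets and exponentials\<close>

lemma cp_out' [simp]: "2 < i \<Longrightarrow> cp i v = 0" "i < -2 \<Longrightarrow> cp i v = 0"
  by (auto intro: cp_out)

lemma cp_br_L: "v \<in> L i \<Longrightarrow> cp n (br v w) = br v (cp (n - i) w)"
proof -
  assume v: "v \<in> L i"
  have "cp n (br v (pr w)) = (\<Sum>j = -2..2. cp n (br v (cp j w)))"
    by (simp add: pr_def br_sum_right cp_sum)
  also have "\<dots> = (\<Sum>j = -2..2. if j = n - i then br v (cp j w) else 0)"
    by (rule sum.cong) (auto simp: cp_L[OF L_br[OF v L_cp refl]])
  also have "\<dots> = br v (cp (n - i) w)"
    by (auto simp: not_le)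
  finally show ?thesis
    by (simp add: br_pr_right)
qed

lemma cp_br_simps [simp]:
  "v \<in> L 2 \<Longrightarrow> cp n (br v w) = br v (cp (n - 2) w)"
  "v \<in> L 1 \<Longrightarrow> cp n (br v w) = br v (cp (n - 1) w)"
  "v \<in> L 0 \<Longrightarrow> cp n (br v w) = br v (cp n w)"
  "v \<in> L (-1) \<Longrightarrow> cp n (br v w) = br v (cp (n + 1) w)"
  "v \<in> L (-2) \<Longrightarrow> cp n (br v w) = br v (cp (n + 2) w)"
  by (simp_all add: cp_br_L)

lemma cp_L_simps [simp]:
  "v \<in> L 2 \<Longrightarrow> cp n v = (if n = 2 then v else 0)"
  "v \<in> L 1 \<Longrightarrow> cp n v = (if n = 1 then v else 0)"
  "v \<in> L 0 \<Longrightarrow> cp n v = (if n = 0 then v else 0)"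
  "v \<in> L (-1) \<Longrightarrow> cp n v = (if n = -1 then v else 0)"
  "v \<in> L (-2) \<Longrightarrow> cp n v = (if n = -2 then v else 0)"
  by (simp_all add: cp_L)

lemmas cp_lin = cp_add cp_minus cp_diff cp_scale

lemma pr_eq: "pr v = cp (-2) v + cp (-1) v + cp 0 v + cp 1 v + cp 2 v"
proof -
  have "{-2..2 :: int} = {-2, -1, 0, 1, 2}" by auto
  then show ?thesis by (simp add: pr_def add.assoc)
qed

lemma pr_lin: "pr (u + v) = pr u + pr v" "pr (c *s v) = c *s pr v" "pr (- v) = - pr v"
  "pr (u - v) = pr u - pr v"
  by (simp_all add: pr_eq cp_lin scale_right_distrib)

lemma pr_L [simp]: "v \<in> L i \<Longrightarrow> pr v = v"
proof -
  assume v: "v \<in> L i"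
  show ?thesis
  proof (cases "i \<in> {-2..2}")
    case True
    then show ?thesis using v by (simp add: pr_def cp_L[OF v])
  next
    case False
    then show ?thesis using L_out[OF v] by (auto simp: pr_eq)
  qed
qed

lemma pr_pr [simp]: "pr (pr v) = pr v"
  by (simp add: pr_eq[of v] pr_lin pr_L[OF L_cp])

lemma pr_br [simp]: "pr (br v w) = br v w"
proof -
  have *: "pr (br (cp i v) (cp j w)) = br (cp i v) (cp j w)" for i j
    by (rule pr_L[OF L_br[OF L_cp L_cp refl]])
  have "pr (br (pr v) (pr w)) = br (pr v) (pr w)"
    by (simp add: pr_eq[of v] pr_eq[of w] br_lin pr_lin *)
  then show ?thesis
    by (simp add: br_pr_left br_pr_right)
qed

lemma eq_by_cp:
  assumes "pr u = u" "pr v = v" "cp (-2) u = cp (-2) v" "cp (-1) u = cp (-1) v" "cp 0 u = cp 0 v"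
    "cp 1 u = cp 1 v" "cp 2 u = cp 2 v"
  shows "u = v"
  by (metis assms pr_eq)

lemma ex_eq: "ex X v = v + br X v + (1/2) *s br X (br X v) + (1/6) *s br X (br X (br X v))
    + (1/24) *s br X (br X (br X (br X v)))"
  by (simp add: trunc_exp_def eval_nat_numeral atMost_Suc algebra_simps)

lemma ex_add: "ex X (u + v) = ex X u + ex X v"
  by (rule vec_eqI) (simp add: ex_eq br_lin algebra_simps)

lemma ex_scale: "ex X (c *s v) = c *s ex X v"
  by (rule vec_eqI) (simp add: ex_eq br_lin algebra_simps)

lemma ex_sum: "ex X (sum f A) = (\<Sum>a\<in>A. ex X (f a))"
  using ex_scale[of X 0 0] by (induction A rule: infinite_finite_induct) (simp_all add: ex_add)

definition pos :: "'b \<Rightarrow> bool" where "pos X \<longleftrightarrow> (\<exists>x\<in>L 1. \<exists>s\<in>L 2. X = x + s)"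
definition neg :: "'b \<Rightarrow> bool" where "neg X \<longleftrightarrow> (\<exists>x\<in>L (-1). \<exists>s\<in>L (-2). X = x + s)"

lemma nil5:
  assumes "pos X \<or> neg X"
  shows "br X (br X (br X (br X (br X v)))) = 0"
proof -
  have *: "br X (br X (br X (br X (br X (cp i v))))) = 0" if "i \<in> {-2, -1, 0, 1, 2}" for i
  proof -
    have "cp i v \<in> L i" by simp
    then show ?thesis
      using assms that by (auto simp: pos_def neg_def br_lin simp del: L_cp)
  qed
  have "br X (br X (br X (br X (br X (pr v))))) = 0"
    by (simp add: pr_eq br_lin *)
  then show ?thesis by (simp add: br_pr_right)
qed

text \<open>All fractions become integer multiples of one scalar w with 24 w = 1, so identities
  between exponentials turn into polynomial identities that \<open>algebra\<close> can
  decide.\<close>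

lemma denominators:
  obtains w :: 'k where "24 * w = 1" "1 / 2 = 12 * w" "1 / 6 = 4 * w" "1 / 24 = w"
    "1 / 4 = 6 * w" "1 / 3 = 8 * w"
proof
  show "24 * (1 / 24) = (1 :: 'k)" "1 / 2 = 12 * (1 / 24 :: 'k)" "1 / 6 = 4 * (1 / 24 :: 'k)"
      "1 / 4 = 6 * (1 / 24 :: 'k)"
      "1 / 3 = 8 * (1 / 24 :: 'k)"
    using numeral_neq_zero by (simp_all add: field_simps)
qed simp

lemma ex_inverse:
  assumes "pos X \<or> neg X"
  shows "ex (- X) (ex X v) = v" "ex X (ex (- X) v) = v"
proof -
  note nil = nil5[OF assms]
  obtain w :: 'k where w: "24 * w = 1" and c: "1 / 2 = 12 * w" "1 / 6 = 4 * w" "1 / 24 = w"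
    "1 / 4 = 6 * w" "1 / 3 = 8 * w"
    by (rule denominators)
  show "ex (- X) (ex X v) = v"
  proof (rule vec_eqI, goal_cases)
    case (1 \<phi>)
    show ?case
      by (simp add: ex_eq br_lin nil c 1) (use w in algebra)
  qed
  show "ex X (ex (- X) v) = v"
  proof (rule vec_eqI, goal_cases)
    case (1 \<phi>)
    show ?case
      by (simp add: ex_eq br_lin nil c 1) (use w in algebra)
  qed
qed

text \<open>Endomorphisms that also preserve the range of \<open>pr\<close>, the sum of the
  components, because only there is an element determined by its components.\<close>

definition reg :: "('b \<Rightarrow> 'b) \<Rightarrow> bool" where
  "reg h \<longleftrightarrow> (\<forall>u v. h (u + v) = h u + h v) \<and> (\<forall>c v. h (c *s v) = c *s h v)
    \<and> (\<forall>u v. h (br u v) = br (h u) (h v)) \<and> (\<forall>u. pr u = u \<longrightarrow> pr (h u) = h u)"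

lemma pr_ex: "pr u = u \<Longrightarrow> pr (ex X u) = ex X u"
  by (simp add: ex_eq pr_lin)

lemma reg_ex:
  assumes "pos X \<or> neg X"
  shows "reg (ex X)"
proof -
  have *: "ex X (br (cp i u) (cp j v)) = br (ex X (cp i u)) (ex X (cp j v))" for i j u v
    using assms unfolding pos_def neg_def
  proof (elim disjE bexE)
    fix x s assume "x \<in> L 1" "s \<in> L 2" "X = x + s"
    then show ?thesis using exp_plus[of x s i "cp i u" j "cp j v"] by (simp only: L_def cp_cp) simp
  next
    fix x s assume "x \<in> L (-1)" "s \<in> L (-2)" "X = x + s"
    then show ?thesis using exp_minus[of x s i "cp i u" j "cp j v"] by (simp only: L_def cp_cp) simp
  qed
  have "ex X (br u v) = br (ex X u) (ex X v)" for u v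
  proof -
    have 1: "br (ex X (pr u)) w = br (ex X u) w" for u w
      by (simp add: ex_eq br_pr_right br_add_left br_pr_left)
    then have 2: "br w (ex X (pr u)) = br w (ex X u)" for u w
      by (metis br_anti)
    have "ex X (br (pr u) (pr v)) = br (ex X (pr u)) (ex X (pr v))"
      by (simp add: pr_def br_sum_left br_sum_right ex_sum *)
    then show ?thesis
      by (simp add: br_pr_left br_pr_right 1 2)
  qed
  then show ?thesis
    by (simp add: reg_def ex_add ex_scale pr_ex)
qed

lemma reg_comp: "reg g \<Longrightarrow> reg h \<Longrightarrow> reg (\<lambda>v. g (h v))"
  by (simp add: reg_def)

lemma regD:
  assumes "reg h"
  shows "h (u + v) = h u + h v" "h (c *s v) = c *s h v" "h (br u v) = br (h u) (h v)"
    "pr u = u \<Longrightarrow> pr (h u) = h u" "h (- v) = - h v" "h 0 = 0" "h (u - v) = h u - h v"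
proof -
  show 1: "h (u + v) = h u + h v" "h (c *s v) = c *s h v" "h (br u v) = br (h u) (h v)"
    "pr u = u \<Longrightarrow> pr (h u) = h u" for u v c
    using assms by (simp_all add: reg_def)
  show 2: "h (- v) = - h v" "h 0 = 0" for v
    using 1(2)[of "-1"] 1(2)[of 0 0] by simp_all
  show "h (u - v) = h u - h v"
    using 1(1)[of u "- v"] 2(1)[of v] by simp
qed

lemma skew_comm: "x \<in> L 1 \<Longrightarrow> s \<in> L 2 \<Longrightarrow> br x (br s v) = br s (br x v)"
  using jacobi[of x s v] by simp

lemma skew_comm': "x \<in> L (-1) \<Longrightarrow> s \<in> L (-2) \<Longrightarrow> br x (br s v) = br s (br x v)"
  using jacobi[of x s v] by simp

text \<open>For t of degree -2 this is the component of degree 2 of e(x + s) t, see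
  \<open>ex_plus\<close>. Written out, it is linear in t on the whole type, as
  \<open>inj_imp_surj\<close> requires.\<close>

definition top :: "'b \<Rightarrow> 'b \<Rightarrow> 'b \<Rightarrow> 'b" where
  "top x s t = (1/2) *s br s (br s t) + (1/2) *s br s (br x (br x t))
    + (1/24) *s br x (br x (br x (br x t)))"

lemma ad_powers:
  assumes c: "\<And>v. br x (br s v) = br s (br x v)"
  shows "br (x + s) v = br x v + br s v"
    "br (x + s) (br (x + s) v) = br x (br x v) + 2 *s br s (br x v) + br s (br s v)"
    "br (x + s) (br (x + s) (br (x + s) v)) = br x (br x (br x v)) + 3 *s br s (br x (br x v))
      + 3 *s br s (br s (br x v)) + br s (br s (br s v))"
    "br (x + s) (br (x + s) (br (x + s) (br (x + s) v))) = br x (br x (br x (br x v)))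
      + 4 *s br s (br x (br x (br x v))) + 6 *s br s (br s (br x (br x v)))
      + 4 *s br s (br s (br s (br x v))) + br s (br s (br s (br s v)))"
proof -
  show 1: "br (x + s) v = br x v + br s v" for v by (rule br_add_left)
  show 2: "br (x + s) (br (x + s) v) = br x (br x v) + 2 *s br s (br x v) + br s (br s v)" for v
    by (rule vec_eqI) (simp add: 1 br_lin c)
  show 3: "br (x + s) (br (x + s) (br (x + s) v)) = br x (br x (br x v)) + 3 *s br s (br x (br x v))
      + 3 *s br s (br s (br x v)) + br s (br s (br s v))" for v
    unfolding 2 by (rule vec_eqI) (simp add: 1 br_lin c)
  show "br (x + s) (br (x + s) (br (x + s) (br (x + s) v))) = br x (br x (br x (br x v)))
      + 4 *s br s (br x (br x (br x v))) + 6 *s br s (br s (br x (br x v)))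
      + 4 *s br s (br s (br s (br x v))) + br s (br s (br s (br s v)))"
    unfolding 3 by (rule vec_eqI) (simp add: 1 br_lin c)
qed

text \<open>Assuming only that ad x and ad s commute makes the formula serve degrees (1, 2) and (-1,
  -2) alike. The summands are ordered by weight, where x has weight 1 and s weight 2.\<close>

lemma ex_graded:
  assumes c: "\<And>v. br x (br s v) = br s (br x v)"
  shows "ex (x + s) u = u + br x u + (br s u + (1/2) *s br x (br x u))
    + (br s (br x u) + (1/6) *s br x (br x (br x u)))
    + ((1/2) *s br s (br s u) + (1/2) *s br s (br x (br x u)) + (1/24) *s br x (br x (br x (br x u))))
    + ((1/2) *s br s (br s (br x u)) + (1/6) *s br s (br x (br x (br x u))))
    + ((1/6) *s br s (br s (br s u)) + (1/4) *s br s (br s (br x (br x u))))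
    + (1/6) *s br s (br s (br s (br x u))) + (1/24) *s br s (br s (br s (br s u)))"
proof -
  obtain w :: 'k where w: "24 * w = 1" and d: "1 / 2 = 12 * w" "1 / 6 = 4 * w" "1 / 24 = w"
    "1 / 4 = 6 * w" "1 / 3 = 8 * w"
    by (rule denominators)
  show ?thesis
  proof (rule vec_eqI, goal_cases)
    case (1 \<phi>)
    show ?case
      by (subst ex_eq, subst ad_powers(4)[OF c], subst ad_powers(3)[OF c], subst ad_powers(2)[OF c],
          subst ad_powers(1)[OF c]) (simp add: d 1, use w in algebra)
  qed
qed

lemma ex_plus:
  assumes [simp]: "x \<in> L 1" "s \<in> L 2"
  shows "cp 2 (ex (x + s) u) = cp 2 u + br x (cp 1 u) + (br s (cp 0 u) + (1/2) *s br x (br x (cp 0 u)))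
      + (br s (br x (cp (-1) u)) + (1/6) *s br x (br x (br x (cp (-1) u)))) + top x s (cp (-2) u)"
    and "cp 1 (ex (x + s) u) = cp 1 u + br x (cp 0 u)
      + (br s (cp (-1) u) + (1/2) *s br x (br x (cp (-1) u)))
      + (br s (br x (cp (-2) u)) + (1/6) *s br x (br x (br x (cp (-2) u))))"
    and "cp 0 (ex (x + s) u) = cp 0 u + br x (cp (-1) u)
      + (br s (cp (-2) u) + (1/2) *s br x (br x (cp (-2) u)))"
    and "cp (-1) (ex (x + s) u) = cp (-1) u + br x (cp (-2) u)"
    and "cp (-2) (ex (x + s) u) = cp (-2) u"
  by (simp_all add: ex_graded skew_comm cp_lin top_def)

lemma ex_minus_top:
  assumes [simp]: "y \<in> L (-1)" "r \<in> L (-2)"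
  shows "cp 2 (ex (y + r) u) = cp 2 u"
    and "cp 1 (ex (y + r) u) = cp 1 u + br y (cp 2 u)"
    and "cp 0 (ex (y + r) u) = cp 0 u + br y (cp 1 u)
      + (br r (cp 2 u) + (1/2) *s br y (br y (cp 2 u)))"
  by (simp_all add: ex_graded skew_comm' cp_lin)

text \<open>Reversing the grading turns statements about degree 2 into statements about degree -2.
  The grading element changes its sign, and so does [x, y] when x and y exchange their
  roles.\<close>

lemma dual: "graded_exp_algebra scl br (\<lambda>i. cp (- i)) (- ze)"
proof (unfold_locales, goal_cases)
  case (5 v w) show ?case by (rule br_anti)
next
  case (10 v w)
  have "(\<Sum>i = -2..2. cp (- i) v) = (\<Sum>i = -2..2. cp i v)"
    by (rule sum.reindex_bij_witness[of _ uminus uminus]) auto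
  then show ?case by (simp only: br_cp)
next
  case (11 i v j w) then show ?case using br_deg[of "- i" v "- j" w] by simp
next
  case (13 i v) then show ?case using br_ze[of "- i" v] by (simp add: br_minus_left)
next
  case (14 x s i v j w) then show ?case using exp_minus[of x s "- i" v "- j" w] by simp
next
  case (15 y t i v j w) then show ?case using exp_plus[of y t "- i" v "- j" w] by simp
next
  case (16 v)
  then have "v \<in> span {br x y |x y. cp 1 x = x \<and> cp (-1) y = y}"
    by (intro deg0_generated) simp
  also have "\<dots> \<subseteq> span {br x y |x y. cp (-1) x = x \<and> cp 1 y = y}"
  proof (intro span_minimal subspace_span subsetI)
    fix u assume "u \<in> {br x y |x y. cp 1 x = x \<and> cp (-1) y = y}"
    then obtain x y where xy: "cp 1 x = x" "cp (-1) y = y" "u = - br y x"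
      using br_anti by blast
    then have "br y x \<in> {br x y |x y. cp (-1) x = x \<and> cp 1 y = y}"
      by blast
    then show "u \<in> span {br x y |x y. cp (-1) x = x \<and> cp 1 y = y}"
      unfolding xy(3) by (intro span_neg span_base)
  qed
  finally show ?case by simp
next
  case 17
  obtain x where x: "cp 1 x = x" "x \<noteq> 0" using deg1_nonzero by blast
  then obtain y where y: "cp (-1) y = y" "br x y = ze" using division_plus by blast
  moreover have "y \<noteq> 0"
    using br_ze[of 1 x] x y by auto
  ultimately show ?case by auto
next
  case (18 x)
  then obtain y where "cp 1 y = y" "br y x = ze" using division_minus[of x] by auto
  then show ?case by (intro exI[of _ y]) (simp add: br_anti[of x y])
next
  case (19 y)
  then obtain x where "cp (-1) x = x" "br y x = ze" using division_plus[of y] by auto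
  then show ?case by (intro exI[of _ x]) (simp add: br_anti[of x y])
next
  case (20 v) then show ?case using faithful_minus[of v] by simp
next
  case (21 v) then show ?case using faithful_plus[of v] by simp
next
  case (22 i F w)
  show ?case by (rule inj_imp_surj[of "- i" F w]) (use 22 in auto)
next
  case (8 i j v) show ?case by (simp add: cp_cp)
next
  case (9 i v) then show ?case by (intro cp_out) auto
qed (rule two three br_add_left br_scale_left cp_add cp_scale | simp add: cp_minus ze_deg)+

subsection \<open>Reversing the grading\<close>

lemma pr_L_simps [simp]:
  "v \<in> L 2 \<Longrightarrow> pr v = v" "v \<in> L 1 \<Longrightarrow> pr v = v" "v \<in> L 0 \<Longrightarrow> pr v = v"
  "v \<in> L (-1) \<Longrightarrow> pr v = v" "v \<in> L (-2) \<Longrightarrow> pr v = v"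
  by (rule pr_L, assumption)+

lemma faithful_L: "T \<in> L 0 \<Longrightarrow> (\<And>y. y \<in> L 1 \<Longrightarrow> br T y = 0) \<Longrightarrow> T = 0"
  by (rule faithful_plus) (blast intro: LI LD)+

lemma reg_plus: "x \<in> L 1 \<Longrightarrow> s \<in> L 2 \<Longrightarrow> reg (ex (x + s))"
  and reg_minus: "y \<in> L (-1) \<Longrightarrow> r \<in> L (-2) \<Longrightarrow> reg (ex (y + r))"
  by (rule reg_ex, unfold pos_def neg_def, blast)+

lemma ad_skew_pow3: "t \<in> L (-2) \<Longrightarrow> br t (br t (br t v)) = 0"
proof -
  assume t: "t \<in> L (-2)"
  have *: "br t (br t (br t (cp i v))) = 0" if "i \<in> {-2, -1, 0, 1, 2}" for i
  proof -
    have "cp i v \<in> L i" by simp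
    then show ?thesis
      using that t by (auto simp del: L_cp)
  qed
  have "br t (br t (br t (pr v))) = 0"
    by (simp add: pr_eq br_lin *)
  then show ?thesis
    by (simp add: br_pr_right)
qed

lemma ad_skew_pow2: "t \<in> L (-2) \<Longrightarrow> br t (br t v) \<in> L (-2)"
proof -
  assume t: "t \<in> L (-2)"
  have "br t (br t (pr v)) = br t (br t (cp 2 v))"
  proof -
    have "br t (br t (cp i v)) = 0" if "i \<in> {-2, -1, 0, 1}" for i
    proof -
      have "cp i v \<in> L i" by simp
      then show ?thesis
        using that t by (auto simp del: L_cp)
    qed
    then show ?thesis by (simp add: pr_eq br_lin)
  qed
  then show ?thesis
    using t by (simp add: br_pr_right)
qed

lemma top_lin: "top x s (u + v) = top x s u + top x s v" "top x s (c *s v) = c *s top x s v"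
  "top x s (u - v) = top x s u - top x s v"
  by (rule vec_eqI; simp add: top_def br_lin algebra_simps)+

lemma top_L: "\<lbrakk>x \<in> L 1; s \<in> L 2; t \<in> L (-2)\<rbrakk> \<Longrightarrow> top x s t \<in> L 2"
  by (simp add: top_def)

text \<open>
  If the component of degree 2 of \<open>E = e(x + s) t\<close> vanishes, then \<open>(ad E)\<^sup>3 = 0\<close> makes the
  component of degree 1 nilpotent, which contradicts the division property unless it vanishes,
  and after that the component of degree 0.
\<close>

lemma top_inj:
  assumes x: "x \<in> L 1" and s: "s \<in> L 2" and xs: "x \<noteq> 0 \<or> s \<noteq> 0"
    and t: "t \<in> L (-2)" and top: "top x s t = 0"
  shows "t = 0"
proof (rule ccontr)
  assume t0: "t \<noteq> 0"
  have s0: "s \<noteq> 0"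
  proof
    assume "s = 0"
    then have "(1 / 24) *s br x (br x (br x (br x t))) = 0"
      using top by (simp add: top_def)
    then have "br x (br x (br x (br x t))) = 0"
      using numeral_neq_zero by simp
    then show False
      using ad4_inj x xs t t0 \<open>s = 0\<close> by blast
  qed
  define a where "a = br x t"
  define T where "T = br s t + (1/2) *s br x (br x t)"
  define b where "b = br s (br x t) + (1/6) *s br x (br x (br x t))"
  define E where "E = ex (x + s) t"
  note [simp] = x s t
  have L [simp]: "a \<in> L (-1)" "T \<in> L 0" "b \<in> L 1"
    by (simp_all add: a_def T_def b_def)
  have E: "E = t + a + T + b"
    unfolding E_def by (rule eq_by_cp) (simp_all add: pr_ex ex_plus cp_lin pr_lin top a_def T_def b_def)
  \<comment> \<open>e(x + s) is an invertible automorphism that maps t to E, so (ad E)^3 is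
    conjugate to (ad t)^3, which vanishes because it lowers the degree by 6.\<close>
  have E3: "br E (br E (br E v)) = 0" for v
  proof -
    have "pos (x + s)" unfolding pos_def using x s by blast
    then have v: "v = ex (x + s) (ex (- (x + s)) v)"
      by (metis ex_inverse(2))
    show ?thesis
      by (subst v) (simp add: E_def regD(3)[OF reg_plus, symmetric] ad_skew_pow3 ex_scale[of _ 0 0, simplified])
  qed
  have b0: "b = 0"
  proof (rule ccontr)
    assume "b \<noteq> 0"
    have "cp 1 (br E (br E (br E t))) = br b (br b (br b t))"
      by (simp add: E br_lin cp_lin)
    then show False
      using E3[of t] ad4_inj[of b t] \<open>b \<noteq> 0\<close> t0 by simp
  qed
  have T0: "T = 0"
  proof (rule nilpotent_deg0)
    fix v assume "v \<in> L 1"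
    then have "cp 1 (br E (br E (br E v))) = br T (br T (br T v))"
      by (simp add: E b0 br_lin cp_lin)
    then show "br T (br T (br T v)) = 0" using E3[of v] by simp
  next
    fix v assume "v \<in> L (-2)"
    then have "cp (-2) (br E (br E (br E v))) = br T (br T (br T v))"
      by (simp add: E b0 br_lin cp_lin)
    then show "br T (br T (br T v)) = 0" using E3[of v] by simp
  qed (use t0 in auto)
  \<comment> \<open>The terms [s, [x, t]] cancel in [x, T] - b, so T = b = 0 isolates the cubic term
    in x.\<close>
  have "3 *s br x T - 3 *s b = br x (br x (br x t))"
  proof (rule vec_eqI, goal_cases)
    case (1 \<phi>)
    show ?case
      using numeral_neq_zero by (simp add: T_def b_def br_lin skew_comm 1) (simp add: field_simps)
  qed
  then have "br x (br x (br x t)) = 0"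
    by (simp add: T0 b0)
  then have "br s (br x t) = 0"
    using b0 by (simp add: b_def)
  then have "br x t = 0"
    using skew_ad_inj[of s "br x t"] s0 by auto
  then have "br s t = 0"
    using T0 by (simp add: T_def)
  then show False
    using skew_commute[of s t] s0 t0 by simp
qed

lemma top_surj:
  assumes "x \<in> L 1" "s \<in> L 2" "x \<noteq> 0 \<or> s \<noteq> 0" "w \<in> L 2"
  obtains t where "t \<in> L (-2)" "top x s t = w"
proof -
  have "\<exists>t. cp (-2) t = t \<and> top x s t = w"
  proof (rule inj_imp_surj)
    fix t assume t: "cp (-2) t = t"
    have "top x s t \<in> L 2"
      by (rule top_L[OF assms(1,2) LI[OF t]])
    then show "cp (- (-2)) (top x s t) = top x s t"
      by (simp del: cp_L_simps add: LD)
    assume "top x s t = 0"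
    then show "t = 0"
      by (rule top_inj[OF assms(1-3) LI[OF t]])
  next
    show "cp (- (-2)) w = w"
      using LD[OF assms(4)] by (simp del: cp_L_simps)
  qed (simp_all add: top_lin)
  then show ?thesis
    using that LI by blast
qed

section \<open>Inverses in degrees 2 and -2\<close>

lemma skew_ad2_inj:
  assumes "s \<in> L 2" "s \<noteq> 0" "t \<in> L (-2)" "br s (br s t) = 0"
  shows "t = 0"
  using top_inj[of 0 s t] assms by (simp add: top_def)

text \<open>
  The Morozov argument: from \<open>[s, [s, f]] = 2 s\<close> one recovers an \<open>sl\<^sub>2\<close>-triple, whose semisimple
  element acts on degree 1 as \<open>-\<zeta>\<close>.
\<close>

lemma skew_inverse:
  assumes s: "s \<in> L 2" "s \<noteq> 0"
  obtains f where "f \<in> L (-2)" "br s f = - ze"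
proof -
  obtain f where f: "f \<in> L (-2)" and sf: "top 0 s f = s"
    using top_surj[of 0 s s] s by auto
  define H where "H = br s f"
  note [simp] = s(1) f
  have H [simp]: "H \<in> L 0" by (simp add: H_def)
  have sH: "br s H = 2 *s s"
  proof -
    have "2 *s ((1/2) *s br s (br s f)) = 2 *s s" using sf by (simp add: top_def)
    then show ?thesis using two by (simp add: H_def)
  qed
  have "br s (br H f - 2 *s f) = 0"
    using jacobi[of s H f] sH by (simp add: br_lin H_def[symmetric])
  then have Hf: "br H f = 2 *s f"
    using skew_commute[of s "br H f - 2 *s f"] s by simp
  have f0: "f \<noteq> 0"
    using sf s by (auto simp: top_def)
  \<comment> \<open>As [s, y] = 0, H acts on y as (ad s)(ad f). Since (ad f)^2 y = 0, moving f past
    s gives [f, [H, y]] = -[H, [f, y]], and [H, f] = 2 f gives [H, [f, y]] = 2 [f, y] + [f, [H, y]].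
    Hence f annihilates [H, y] + y.\<close>
  have "br H y = - y" if y [simp]: "y \<in> L 1" for y
  proof -
    have 1: "br s (br f y) = br H y"
      using jacobi[of s f y] by (simp add: H_def)
    have "br f (br H y) = - br H (br f y)"
      using jacobi[of f s "br f y"] 1 br_anti[of f s] by (simp add: H_def br_lin)
    moreover have "br H (br f y) = 2 *s br f y + br f (br H y)"
      using jacobi[of H f y] by (simp add: Hf br_lin)
    ultimately have "2 *s br f (br H y) = 2 *s (- br f y)"
      by (smt (verit) add.right_inverse add_diff_cancel_left' diff_minus_eq_add minus_diff_eq
          scale_minus_right scale_left_distrib one_add_one scale_one)
    then have "br f (br H y + y) = 0"
      using two by (simp add: br_lin del: scale_minus_right)
    then show ?thesis
      using skew_ad_inj'[of f "br H y + y"] f0 by (auto simp: eq_neg_iff_add_eq_0)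
  qed
  then have "br (H + ze) y = 0" if "y \<in> L 1" for y
    using that by (simp add: br_lin)
  then have "H + ze = 0"
    using faithful_L[of "H + ze"] L_add[OF H L_ze] by blast
  then show ?thesis
    by (intro that[OF f]) (simp add: H_def eq_neg_iff_add_eq_0)
qed

lemma skew_inverse':
  assumes "t \<in> L (-2)" "t \<noteq> 0"
  obtains s where "s \<in> L 2" "br s t = - ze"
proof -
  interpret opp: graded_exp_algebra scl br "\<lambda>i. cp (- i)" "- ze"
    by (rule dual)
  obtain s where s: "s \<in> L 2" "br t s = ze"
    using opp.skew_inverse[of t] assms unfolding L_def opp.L_def by auto
  show ?thesis
    by (rule that[OF s(1)]) (simp add: br_anti[of s t] s(2))
qed

section \<open>Automorphisms that map \<zeta> to -\<zeta>\<close>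

lemma of_int_neq_zero: "m \<noteq> 0 \<Longrightarrow> -4 \<le> m \<Longrightarrow> m \<le> 4 \<Longrightarrow> (of_int m :: 'k) \<noteq> 0"
proof -
  assume "m \<noteq> 0" "-4 \<le> m" "m \<le> 4"
  then have "m \<in> {-4, -3, -2, -1, 1, 2, 3, 4}" by auto
  then show ?thesis using numeral_neq_zero by auto
qed

text \<open>The components are the eigenspaces of ad \<zeta>: the eigenvalues -2, ..., 2 differ by
  at most 4 in absolute value, and 1, 2, 3, 4 are invertible when the characteristic is not 2 or
  3.\<close>

lemma eigen_L:
  assumes u: "pr u = u" and e: "br ze u = of_int j *s u" and j: "-2 \<le> j" "j \<le> 2"
  shows "u \<in> L j"
proof -
  have *: "cp n u = 0" if "n \<noteq> j" for n
  proof (cases "-2 \<le> n \<and> n \<le> 2")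
    case True
    have "of_int n *s cp n u = of_int j *s cp n u"
      using arg_cong[OF e, of "cp n"] br_ze_L[OF L_cp, of n u] by (simp add: cp_scale)
    then have "of_int (n - j) *s cp n u = 0"
      by (simp add: scale_left_diff_distrib)
    moreover have "(of_int (n - j) :: 'k) \<noteq> 0"
      using that True j by (intro of_int_neq_zero) auto
    ultimately show ?thesis by simp
  next
    case False
    then show ?thesis by (intro cp_out) auto
  qed
  have "pr u = (\<Sum>n = -2..2. if n = j then cp j u else 0)"
    unfolding pr_def by (rule sum.cong) (auto simp: *)
  then have "u = cp j u"
    using u j by simp
  then show ?thesis
    by (metis L_cp)
qed

lemma reversing_L:
  assumes h: "reg h" "h ze = - ze" and v: "v \<in> L i" "-2 \<le> i" "i \<le> 2"
  shows "h v \<in> L (- i)"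
proof (rule eigen_L)
  have "br (- ze) (h v) = h (of_int i *s v)"
    using regD(3)[OF h(1), of ze v] h(2) br_ze_L[OF v(1)] by simp
  then show "br ze (h v) = of_int (- i) *s h v"
    by (simp add: regD(2)[OF h(1)] br_lin minus_equation_iff[of "br ze (h v)"])
  show "pr (h v) = h v"
    by (rule regD(4)[OF h(1) pr_L[OF v(1)]])
qed (use v in auto)

lemma reversing_inverse_L:
  assumes h: "reg h" "h ze = - ze" and inj: "\<And>u. k (h u) = u"
    and v: "h v' \<in> L i" "-2 \<le> i" "i \<le> 2" and v': "pr v' = v'"
  shows "v' \<in> L (- i)"
proof (rule eigen_L)
  have "h (br ze v') = h (of_int (- i) *s v')"
    using regD(3)[OF h(1), of ze v'] h(2) br_ze_L[OF v(1)] by (simp add: regD[OF h(1)] br_lin)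
  then show "br ze v' = of_int (- i) *s v'"
    by (metis inj)
qed (use v v' in auto)

text \<open>The sign in [s, f] = -\<zeta> is that of the conjugate inverse: in K(A) the equation
  reads L_s L_f = -id, which means that f is the conjugate inverse of s.\<close>

lemma skew_sl2:
  assumes s: "s \<in> L 2" and f: "f \<in> L (-2)" and sf: "br s f = - ze"
  shows "v \<in> L 1 \<Longrightarrow> br s (br f v) = - v"
    and "v \<in> L (-1) \<Longrightarrow> br f (br s v) = - v"
    and "v \<in> L 2 \<Longrightarrow> br s (br f v) = - (2 *s v)"
    and "v \<in> L 2 \<Longrightarrow> br s (br s (br f (br f v))) = 4 *s v"
proof -
  note [simp] = s f
  have sh: "br s (br f u) = br f (br s u) - br ze u" for u
    using jacobi[of s f u] by (simp add: sf br_lin)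
  show "v \<in> L 1 \<Longrightarrow> br s (br f v) = - v" by (simp add: sh)
  show "v \<in> L (-1) \<Longrightarrow> br f (br s v) = - v"
    using sh[of v] by (simp add: eq_neg_iff_add_eq_0)
  show 1: "v \<in> L 2 \<Longrightarrow> br s (br f v) = - (2 *s v)" by (simp add: sh)
  then show "v \<in> L 2 \<Longrightarrow> br s (br s (br f (br f v))) = 4 *s v"
    using sh[of "br f v"] 1 by (simp add: br_lin)
qed

text \<open>
  Choose \<open>t\<close> such that \<open>e(x + s) t\<close> has component \<open>w \<noteq> 0\<close> in degree 2, and remove as much as possible
  of the other components by \<open>e(Y + R)\<close>. What remains is \<open>w\<close>: with \<open>[w, f] = -\<zeta>\<close> the
  element \<open>(ad E)\<^sup>2 f - 2 E\<close> is the image of an element of degree \<open>-2\<close> but has no component in degree 2.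
\<close>

lemma reversal_exists:
  assumes x: "x \<in> L 1" and s: "s \<in> L 2" and xs: "x \<noteq> 0 \<or> s \<noteq> 0" and w: "w \<in> L 2" "w \<noteq> 0"
  obtains Y R Z Q where "Y \<in> L (-1)" "R \<in> L (-2)" "Z \<in> L (-1)" "Q \<in> L (-2)"
    "ex (Y + R) (ex (x + s) (ex (Z + Q) ze)) = - ze"
proof -
  obtain t where t: "t \<in> L (-2)" and top: "top x s t = w"
    using top_surj[OF x s xs w(1)] .
  have t0: "t \<noteq> 0"
    using top w top_lin(2)[of x s 0 0] by auto
  obtain f where f: "f \<in> L (-2)" and wf: "br w f = - ze"
    using skew_inverse[OF w] .
  note [simp] = x s t f w(1)
  define E where "E = ex (x + s) t"
  define b where "b = cp 1 E"
  define T where "T = cp 0 E"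
  \<comment> \<open>[w, [f, b]] = -b, so [Y, w] cancels the component b of degree 1.\<close>
  define Y where "Y = - br f b"
  define T0 where "T0 = T + br Y b + (1/2) *s br Y (br Y w)"
  \<comment> \<open>The component of degree 0 will be T0 - [w, R]. On degree 2, (ad w)^2 (ad f)^2 is
    multiplication by 4, so the factor 1/4 yields [w, [w, R]] = [w, T0].\<close>
  define R where "R = (1/4) *s br f (br f (br w T0))"
  have [simp]: "b \<in> L 1" "T \<in> L 0" by (simp_all add: b_def T_def)
  have [simp]: "Y \<in> L (-1)" by (simp add: Y_def)
  have [simp]: "T0 \<in> L 0" by (simp add: T0_def)
  have [simp]: "R \<in> L (-2)" by (simp add: R_def)
  have E2: "cp 2 E = w" by (simp add: E_def ex_plus top)
  have Yw: "br Y w = - b"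
    using skew_sl2(1)[OF w(1) f wf, of b] br_anti[of Y w] by (simp add: Y_def br_lin)
  have wwR: "br w (br w R) = br w T0"
    using skew_sl2(4)[OF w(1) f wf, of "br w T0"] numeral_neq_zero by (simp add: R_def br_lin)
  define E' where "E' = ex (Y + R) E"
  define T' where "T' = cp 0 E'"
  define a' where "a' = cp (-1) E'"
  define t' where "t' = cp (-2) E'"
  have [simp]: "T' \<in> L 0" "a' \<in> L (-1)" "t' \<in> L (-2)"
    by (simp_all add: T'_def a'_def t'_def)
  have "cp 2 E' = w" "cp 1 E' = 0"
    by (simp_all add: E'_def ex_minus_top E2 b_def[symmetric] Yw)
  moreover have "pr E' = E'" by (simp add: E'_def E_def pr_ex)
  ultimately have E': "E' = t' + a' + T' + w"
    using pr_eq[of E'] by (simp add: T'_def a'_def t'_def)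
  have "T' = T0 - br w R"
    by (simp add: T'_def E'_def ex_minus_top E2 b_def[symmetric] T_def[symmetric] T0_def br_anti[of R w])
  then have wT': "br w T' = 0"
    by (simp add: br_lin wwR)
  have "br w (br T' f) = 0"
    using jacobi[of w T' f] wT' wf by (simp add: br_lin)
  then have T'f: "br T' f = 0"
    using skew_commute[of w "br T' f"] w by simp
  define h where "h u = ex (Y + R) (ex (x + s) u)" for u
  define k where "k u = ex (- (x + s)) (ex (- (Y + R)) u)" for u
  have reg: "reg h"
    unfolding h_def by (rule reg_comp[OF reg_minus reg_plus]) simp_all
  have pn: "pos (x + s)" "neg (Y + R)"
    unfolding pos_def neg_def using x s \<open>Y \<in> L (-1)\<close> \<open>R \<in> L (-2)\<close> by blast+
  have hk: "h (k u) = u" and kh: "k (h u) = u" for u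
    using pn by (simp_all only: h_def k_def ex_inverse simp_thms)
  have pr_k: "pr (k u) = k u" if "pr u = u" for u
    using that by (simp add: k_def pr_ex)
  have ht: "h t = E'" by (simp add: h_def E'_def E_def)
  \<comment> \<open>The preimage under h of (ad E')^2 f - 2 E'. It has degree -2 because (ad t)^2
    maps everything there.\<close>
  define r where "r = br t (br t (k f)) - 2 *s t"
  have r: "r \<in> L (-2)"
    by (simp add: r_def ad_skew_pow2)
  have "br E' f = - ze"
    by (simp add: E' br_lin T'f wf)
  then have hr: "h r = - (2 *s T') - 3 *s a' - 4 *s t'"
    by (intro vec_eqI) (simp add: r_def regD[OF reg] ht hk br_lin, simp add: E' br_lin)
  have "cp 2 (h r) = top x s r"
    using r by (simp add: h_def ex_minus_top ex_plus)
  then have "top x s r = 0"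
    by (simp add: hr cp_lin)
  then have "r = 0"
    by (rule top_inj[OF x s xs r])
  then have "- (2 *s T') - 3 *s a' - 4 *s t' = 0"
    using hr regD(6)[OF reg] by simp
  from arg_cong[OF this, of "cp 0"] arg_cong[OF this, of "cp (-1)"] arg_cong[OF this, of "cp (-2)"]
  have "T' = 0" "a' = 0" "t' = 0"
    using numeral_neq_zero by (simp_all add: cp_lin)
  then have ht: "h t = w"
    by (simp add: ht E')
  \<comment> \<open>Writing \<zeta> = -[\<tau>, t] gives z = [w, q] for the image z of \<zeta>. As w
    has degree 2, z has no component of negative degree, and [w, z] = 2 w determines the component
    of q of degree -2 to be f, so z is -\<zeta> in degree 0.\<close>
  obtain \<tau> where \<tau>: "\<tau> \<in> L 2" "br \<tau> t = - ze"
    using skew_inverse'[OF t t0] .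
  define q where "q = h \<tau>"
  define z where "z = h ze"
  have z: "z = br w q"
    using regD(3)[OF reg, of \<tau> t] \<tau> br_anti[of q w] by (simp add: regD[OF reg] ht q_def z_def)
  have "br z w = - (2 *s w)"
    using regD(3)[OF reg, of ze t] by (simp add: z_def ht regD[OF reg])
  then have "br w z = 2 *s w"
    using br_anti[of w z] by simp
  from arg_cong[OF this, of "cp 2"]
  have "br w (br w (cp (-2) q)) = 2 *s w"
    by (simp add: z cp_lin)
  moreover have "br w (br w f) = 2 *s w"
    by (simp add: wf br_lin)
  ultimately have "br w (br w (cp (-2) q - f)) = 0"
    by (simp add: br_lin)
  then have "cp (-2) q = f"
    using skew_ad2_inj[of w "cp (-2) q - f"] w by simp
  then have z0: "cp 0 z = - ze" "cp (-1) z = 0" "cp (-2) z = 0"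
    by (simp_all add: z wf)
  define c where "c = cp 1 z"
  define d where "d = cp 2 z"
  have [simp]: "c \<in> L 1" "d \<in> L 2" by (simp_all add: c_def d_def)
  have zcd: "z = - ze + c + d"
  proof -
    have "pr z = z" by (simp add: z)
    then show ?thesis
      using pr_eq[of z] by (simp add: z0 c_def d_def)
  qed
  \<comment> \<open>The coefficient 1/2 accounts for [d, -\<zeta>] = 2 d, so that e(-X) removes both
    c and d from z.\<close>
  define X where "X = c + (1/2) *s d"
  have pX: "pos X" unfolding X_def pos_def using \<open>c \<in> L 1\<close> \<open>d \<in> L 2\<close> L_scale by blast
  have Xc: "ex X c = c" "ex X d = d" by (simp_all add: ex_eq X_def br_lin)
  have Xz: "ex (- X) z = - ze"
    using two by (simp add: ex_eq X_def zcd br_lin)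
  define h2 where "h2 u = ex (- X) (h u)" for u
  define k2 where "k2 u = k (ex X u)" for u
  have "- X = (- c) + (- ((1/2) *s d))" by (simp add: X_def)
  then have "reg (ex (- X))"
    using reg_plus[of "- c" "- ((1/2) *s d)"] by simp
  then have reg2: "reg h2"
    unfolding h2_def by (rule reg_comp[OF _ reg])
  have h2k: "h2 (k2 u) = u" and k2h: "k2 (h2 u) = u" for u
    using pX by (simp_all add: h2_def k2_def hk kh ex_inverse)
  have h2z: "h2 ze = - ze"
    by (simp add: h2_def z_def[symmetric] Xz)
  have pr2: "pr (k2 u) = k2 u" if "pr u = u" for u
    using that by (simp add: k2_def pr_k pr_ex)
  \<comment> \<open>e(-X) after h reverses the grading, so c and d have preimages of degrees -1 and
    -2. The correction can thus be made before h, by an exponential of negative degree, as the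
    required form of the product demands.\<close>
  have kc: "k2 c \<in> L (-1)"
    by (rule reversing_inverse_L[where h = h2 and k = k2]) (simp_all add: reg2 h2z k2h h2k pr2)
  have kd: "k2 d \<in> L (-2)"
    by (rule reversing_inverse_L[where h = h2 and k = k2]) (simp_all add: reg2 h2z k2h h2k pr2)
  have "ex (- k2 c + - ((1/2) *s k2 d)) ze = ze - k2 c - k2 d"
    using kc kd two by (simp add: ex_eq br_lin)
  then have "ex (Y + R) (ex (x + s) (ex (- k2 c + - ((1/2) *s k2 d)) ze)) = h (ze - k2 c - k2 d)"
    by (simp add: h_def)
  also have "\<dots> = z - c - d"
    by (simp add: regD[OF reg] z_def k2_def hk Xc)
  also have "\<dots> = - ze"
    by (simp add: zcd)
  finally show ?thesis
    by (rule that[rotated 4]) (simp_all add: kc kd)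
qed

text \<open>On degree -2 only the middle factor is visible: e(Z + Q) fixes that degree, e(Y + R)
  does not change the component of degree 2, and h v is homogeneous of degree 2. The inverse has the
  same shape with x and s negated. \<open>w\<close> witnesses that degree 2 is nonzero.\<close>

lemma reversal:
  assumes x: "x \<in> L 1" and s: "s \<in> L 2" and xs: "x \<noteq> 0 \<or> s \<noteq> 0" and w: "w \<in> L 2" "w \<noteq> 0"
  obtains h k where "reg h" "h ze = - ze" "\<And>u. h (k u) = u" "\<And>u. k (h u) = u"
    "\<And>v. v \<in> L (-2) \<Longrightarrow> h v = top x s v" "\<And>v. v \<in> L (-2) \<Longrightarrow> k v = top (- x) (- s) v"
proof -
  obtain Y R Z Q where L: "Y \<in> L (-1)" "R \<in> L (-2)" "Z \<in> L (-1)" "Q \<in> L (-2)"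
    and rev: "ex (Y + R) (ex (x + s) (ex (Z + Q) ze)) = - ze"
    using reversal_exists[OF x s xs w] .
  define h where "h u = ex (Y + R) (ex (x + s) (ex (Z + Q) u))" for u
  define k where "k u = ex (- (Z + Q)) (ex (- (x + s)) (ex (- (Y + R)) u))" for u
  have pn: "pos (x + s)" "neg (Y + R)" "neg (Z + Q)"
    unfolding pos_def neg_def using x s L by blast+
  have hk: "h (k u) = u" and kh: "k (h u) = u" for u
    using pn by (simp_all only: h_def k_def ex_inverse simp_thms)
  have hz: "h ze = - ze" by (simp add: h_def rev)
  have m: "- (Z + Q) = (- Z) + (- Q)" "- (x + s) = (- x) + (- s)" "- (Y + R) = (- Y) + (- R)"
    by simp_all
  have reg: "reg h"
    unfolding h_def
    by (rule reg_comp[OF reg_minus[OF L(1,2)] reg_comp[OF reg_plus[OF x s] reg_minus[OF L(3,4)]]])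
  have regk: "reg k"
    unfolding k_def m
    by (rule reg_comp[OF reg_minus[OF L(3,4)[THEN L_minus]] reg_comp[OF reg_plus[OF L_minus[OF x] L_minus[OF s]]
          reg_minus[OF L(1,2)[THEN L_minus]]]])
  have kz: "k ze = - ze"
    using kh[of ze] regD(5)[OF regk, of ze] by (simp add: hz minus_equation_iff)
  have low: "ex (y + r) v = v" if "y \<in> L (-1)" "r \<in> L (-2)" "v \<in> L (-2)" for y r v
    using that by (simp add: ex_eq br_lin)
  have "h v = top x s v" if v: "v \<in> L (-2)" for v
  proof -
    have "h v \<in> L 2"
      using reversing_L[OF reg hz v] by simp
    then have "h v = cp 2 (h v)" by simp
    also have "\<dots> = top x s v"
      using x s L v by (simp add: h_def ex_minus_top ex_plus low)
    finally show ?thesis .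
  qed
  moreover have "k v = top (- x) (- s) v" if v: "v \<in> L (-2)" for v
  proof -
    have "k v \<in> L 2"
      using reversing_L[OF regk kz v] by simp
    then have "k v = cp 2 (k v)" by simp
    also have "\<dots> = top (- x) (- s) v"
      unfolding k_def m using x s L v
      by (simp only: ex_minus_top ex_plus low L_minus) simp
    finally show ?thesis .
  qed
  ultimately show ?thesis
    using that[OF reg hz hk kh] by blast
qed

subsection \<open>The system of equations\<close>

text \<open>The system of the theorem inside K(A): [x, u] is V_{x,u}, [s, t] is L_s L_t, (ad x)^3 t
  is U_x(t x), and [s, [x, [x, t]]] is psi(x, s (t x)) up to sign, see
  \<open>system_iff\<close>.\<close>

definition system :: "'b \<Rightarrow> 'b \<Rightarrow> 'b \<Rightarrow> 'b \<Rightarrow> bool" where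
  "system x s u t \<longleftrightarrow> u \<in> L (-1) \<and> t \<in> L (-2) \<and> br x u = ze + br s t
    \<and> br s u = - ((1/3) *s br x (br x (br x t))) \<and> br s (br x (br x t)) = 0"

text \<open>
  The system expresses that the components of degrees 0, 1 and 2 of
  \<open>e(2 x + 2 s) (\<zeta> - u - [x, t] + t)\<close> are those of \<open>-\<zeta>\<close>.
\<close>

lemma system_solvable:
  assumes x: "x \<in> L 1" and s: "s \<in> L 2" "s \<noteq> 0"
  obtains u t where "system x s u t"
proof -
  have xs: "2 *s x \<in> L 1" "2 *s s \<in> L 2" "2 *s x \<noteq> 0 \<or> 2 *s s \<noteq> 0"
    using x s two by simp_all
  obtain Y R Z Q where L: "Y \<in> L (-1)" "R \<in> L (-2)" "Z \<in> L (-1)" "Q \<in> L (-2)"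
    and rev: "ex (Y + R) (ex (2 *s x + 2 *s s) (ex (Z + Q) ze)) = - ze"
    using reversal_exists[OF xs s] .
  \<comment> \<open>The factor 2 comes from [Q, \<zeta>] = 2 Q.\<close>
  define t where "t = 2 *s Q"
  define D where "D = ex (2 *s x + 2 *s s) (ze + Z + t)"
  have [simp]: "t \<in> L (-2)" using L by (simp add: t_def)
  note [simp] = L x s(1)
  have "ex (Z + Q) ze = ze + Z + t"
    by (simp add: ex_eq br_lin t_def)
  then have "ex (Y + R) D = - ze"
    using rev by (simp add: D_def)
  then have D2: "cp 2 D = 0" and D1: "cp 1 D = 0" and D0: "cp 0 D = - ze"
    using ex_minus_top[of Y R D] by simp_all
  \<comment> \<open>The summand [x, t] is split off from Z so that the quadratic term 2 [x, [x, t]]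
    in degree 0 cancels.\<close>
  define u where "u = - (Z + br x t)"
  have [simp]: "u \<in> L (-1)" by (simp add: u_def)
  have Z: "Z = - (u + br x t)" by (simp add: u_def)
  obtain c :: 'k where c: "24 * c = 1" and d: "1 / 2 = 12 * c" "1 / 6 = 4 * c" "1 / 24 = c"
      "1 / 4 = 6 * c" "1 / 3 = 8 * c"
    by (rule denominators)
  have D0': "cp 0 D = ze - 2 *s br x u + 2 *s br s t"
  proof (rule vec_eqI, goal_cases)
    case (1 \<phi>)
    show ?case by (simp add: D_def ex_plus cp_lin br_lin Z d 1) (use c in algebra)
  qed
  have xu: "br x u = ze + br s t"
  proof -
    have "2 *s br x u = 2 *s (ze + br s t)"
    proof (rule vec_eqI, goal_cases)
      case (1 \<phi>)
      show ?case using arg_cong[OF D0[unfolded D0'], of \<phi>] by (simp only: 1) algebra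
    qed
    then show ?thesis using two by simp
  qed
  have xxu: "br x (br x u) = - x + br s (br x t)"
    by (simp add: xu br_lin skew_comm)
  have D1': "cp 1 D = - (2 *s br s u) - (2/3) *s br x (br x (br x t))"
  proof (rule vec_eqI, goal_cases)
    case (1 \<phi>)
    have e: "2 / 3 = 2 * (1 / 3 :: 'k)" by simp
    show ?case
      unfolding e by (simp add: D_def ex_plus cp_lin br_lin Z xxu d 1) (use c in algebra)
  qed
  have su: "br s u = - ((1/3) *s br x (br x (br x t)))"
  proof -
    have "2 *s br s u = 2 *s (- ((1/3) *s br x (br x (br x t))))"
    proof (rule vec_eqI, goal_cases)
      case (1 \<phi>)
      have e: "2 / 3 = 2 * (1 / 3 :: 'k)" by simp
      show ?case
        using arg_cong[OF D1[unfolded D1'], of \<phi>] unfolding e by (simp only: 1 d) (use c in algebra)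
    qed
    then show ?thesis using two by (simp del: scale_minus_right)
  qed
  have sxu: "br s (br x u) = - ((1/3) *s br x (br x (br x (br x t))))"
    using skew_comm[of x s u] by (simp add: su br_lin)
  have x4: "(1/3) *s br x (br x (br x (br x t))) = 2 *s s - br s (br s t)"
    using sxu by (simp add: xu br_lin eq_neg_iff_add_eq_0 add.commute[of "_ *s _"]) (simp add: algebra_simps)
  have D2': "cp 2 D = 4 *s s - 2 *s br s (br s t) - (4/3) *s br s (br x (br x t))
      - (2/3) *s br x (br x (br x (br x t)))"
  proof (rule vec_eqI, goal_cases)
    case (1 \<phi>)
    have e: "2 / 3 = 2 * (1 / 3 :: 'k)" "4 / 3 = 4 * (1 / 3 :: 'k)" by simp_all
    show ?case
      unfolding e
      by (simp add: D_def ex_plus cp_lin br_lin Z top_def skew_comm xxu xu d 1) (use c in algebra)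
  qed
  \<comment> \<open>\<open>x4\<close> is the second equation after applying ad x and inserting the
    first. It cancels all of D in degree 2 except a multiple of [s, [x, [x, t]]].\<close>
  have "4 *s br s (br x (br x t)) = 0"
  proof (rule vec_eqI, goal_cases)
    case (1 \<phi>)
    have e: "2 / 3 = 2 * (1 / 3 :: 'k)" "4 / 3 = 4 * (1 / 3 :: 'k)" by simp_all
    show ?case using arg_cong[OF D2[unfolded D2'], of \<phi>] arg_cong[OF x4, of \<phi>]
      unfolding e by (simp only: d 1) (use c in algebra)
  qed
  then have "br s (br x (br x t)) = 0"
    using numeral_neq_zero by simp
  then show ?thesis
    using that[of u t] xu su by (simp add: system_def)
qed

lemma system_x4:
  assumes x: "x \<in> L 1" and s: "s \<in> L 2" and sys: "system x s u t"
  shows "(1/3) *s br x (br x (br x (br x t))) = 2 *s s - br s (br s t)"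
proof -
  from sys have [simp]: "u \<in> L (-1)" "t \<in> L (-2)" and xu: "br x u = ze + br s t"
    and su: "br s u = - ((1/3) *s br x (br x (br x t)))"
    by (simp_all add: system_def)
  note [simp] = x s
  have "br s (br x u) = - ((1/3) *s br x (br x (br x (br x t))))"
    using skew_comm[of x s u] by (simp add: su br_lin)
  then show ?thesis
    by (simp add: xu br_lin eq_neg_iff_add_eq_0 add.commute[of "_ *s _"]) (simp add: algebra_simps)
qed

text \<open>\<open>top\<close> at (2 x, 2 s) is 2 (ad s)^2 t + 4 [s, [x, [x, t]]] + (2/3) (ad x)^4
  t. The middle term is the only one that feels the sign of (x, s), and it vanishes by the system;
  the other two add up to 4 s by \<open>system_x4\<close>.\<close>

lemma system_top:
  assumes x: "x \<in> L 1" and s: "s \<in> L 2" and sys: "system x s u t"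
  shows "top (2 *s x) (2 *s s) t = 4 *s s" "top (- (2 *s x)) (- (2 *s s)) t = 4 *s s"
proof -
  obtain c :: 'k where c: "24 * c = 1" and d: "1 / 2 = 12 * c" "1 / 6 = 4 * c" "1 / 24 = c"
      "1 / 4 = 6 * c" "1 / 3 = 8 * c"
    by (rule denominators)
  have 0: "br s (br x (br x t)) = 0"
    using sys by (simp add: system_def)
  note x4 = system_x4[OF assms]
  show "top (2 *s x) (2 *s s) t = 4 *s s"
  proof (rule vec_eqI, goal_cases)
    case (1 \<phi>)
    show ?case
      using arg_cong[OF x4, of \<phi>] by (simp add: 0 top_def br_lin d 1) (use c in algebra)
  qed
  show "top (- (2 *s x)) (- (2 *s s)) t = 4 *s s"
  proof (rule vec_eqI, goal_cases)
    case (1 \<phi>)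
    show ?case
      using arg_cong[OF x4, of \<phi>] by (simp add: 0 top_def br_lin d 1) (use c in algebra)
  qed
qed

lemma system_unique:
  assumes x: "x \<in> L 1" "x \<noteq> 0" and s: "s \<in> L 2" and sys: "system x s u t" "system x s u' t'"
  shows "u = u'" "t = t'"
proof -
  have L: "u \<in> L (-1)" "u' \<in> L (-1)" "t \<in> L (-2)" "t' \<in> L (-2)"
    using sys by (simp_all add: system_def)
  have "top (2 *s x) (2 *s s) (t - t') = 0"
    by (simp add: top_lin system_top[OF x(1) s sys(1)] system_top[OF x(1) s sys(2)])
  then have "t - t' = 0"
    by (rule top_inj[rotated -1]) (use x s L two in simp_all)
  then show t: "t = t'" by simp
  have "br x u = ze + br s t" "br x u' = ze + br s t'"
    using sys by (simp_all only: system_def)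
  then have "br x (u - u') = 0"
    by (simp only: br_lin t diff_self)
  then have "u - u' = 0"
    by (rule ad_inj_minus1[OF x, rotated]) (use L in simp)
  then show "u = u'" by simp
qed

section \<open>Inverses attached to the solution\<close>

text \<open>In A: if f is the conjugate inverse of s and y that of x, then f x is the conjugate
  inverse of s y. The bracket is (ad s)(ad g) - (ad g)(ad s) applied to [f, e], which gives 2
  \<zeta> - \<zeta>.\<close>

lemma skew_mult_inverse:
  assumes s: "s \<in> L 2" and f: "f \<in> L (-2)" and sf: "br s f = - ze"
    and e: "e \<in> L 1" and g: "g \<in> L (-1)" and eg: "br e g = ze"
  shows "br (br s g) (br f e) = ze"
proof -
  note [simp] = s f e g
  have "br g (br f e) = - (2 *s f)"
    using jacobi[of g f e] br_anti[of g e] by (simp add: eg br_lin)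
  then have 1: "br s (br g (br f e)) = 2 *s ze"
    by (simp add: sf br_lin)
  have "br s (br f e) = - e"
    using skew_sl2(1)[OF s f sf e] .
  then have 2: "br g (br s (br f e)) = ze"
    using br_anti[of g e] by (simp add: eg br_lin)
  have "2 *s ze = ze + ze"
    using scale_left_distrib[of 1 1 ze] by simp
  then show ?thesis
    using jacobi[of s g "br f e"] by (simp add: 1 2)
qed

text \<open>With f the conjugate inverse of s, (1/6) (ad x)^4 f is q_x(f), so this is the formula
  for t.\<close>

lemma skew_inverse_of_solution:
  assumes x: "x \<in> L 1" and s: "s \<in> L 2" "s \<noteq> 0" and f: "f \<in> L (-2)" and sf: "br s f = - ze"
    and sys: "system x s u t"
  shows "br (s + (1/6) *s br x (br x (br x (br x f)))) t = - ze"
    and "s + (1/6) *s br x (br x (br x (br x f))) \<noteq> 0"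
proof -
  define w where "w = s + (1/6) *s br x (br x (br x (br x f)))"
  have t: "t \<in> L (-2)" using sys by (simp add: system_def)
  note [simp] = x s(1) f t
  have xs: "2 *s x \<in> L 1" "2 *s s \<in> L 2" "2 *s x \<noteq> 0 \<or> 2 *s s \<noteq> 0"
    using s two by simp_all
  obtain h k where reg: "reg h" and hz: "h ze = - ze" and hk: "\<And>u. h (k u) = u"
    and "\<And>u. k (h u) = u" and h: "\<And>v. v \<in> L (-2) \<Longrightarrow> h v = top (2 *s x) (2 *s s) v"
    and k: "\<And>v. v \<in> L (-2) \<Longrightarrow> k v = top (- (2 *s x)) (- (2 *s s)) v"
    by (rule reversal[OF xs s]) (rule that; assumption)
  have "k t = 4 *s s"
    using k[OF t] system_top(2)[OF x s(1) sys] by simp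
  then have hs: "h (4 *s s) = t"
    using hk[of t] by simp
  obtain c :: 'k where c: "24 * c = 1" and d: "1 / 2 = 12 * c" "1 / 6 = 4 * c" "1 / 24 = c"
      "1 / 4 = 6 * c" "1 / 3 = 8 * c"
    by (rule denominators)
  \<comment> \<open>ad s commutes with ad x, so the bracket is -[x, [x, \<zeta>]] = [x, x].\<close>
  have sxxf: "br s (br x (br x f)) = 0"
    using skew_comm[of x s "br x f"] skew_comm[of x s f] by (simp add: sf br_lin)
  have hf: "h f = 4 *s w"
    unfolding h[OF f]
  proof (rule vec_eqI, goal_cases)
    case (1 \<phi>)
    show ?case by (simp add: top_def w_def br_lin sf sxxf d 1) (use c in algebra)
  qed
  have "br t (4 *s w) = h (br (4 *s s) f)"
    using regD(3)[OF reg, of "4 *s s" f] by (simp only: hs hf)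
  also have "\<dots> = 4 *s ze"
    by (simp add: br_lin sf regD[OF reg] hz)
  finally have "br t w = ze"
    using numeral_neq_zero by (simp add: br_lin)
  then show wt: "br (s + (1/6) *s br x (br x (br x (br x f)))) t = - ze"
    using br_anti[of w t] by (simp add: w_def)
  show "s + (1/6) *s br x (br x (br x (br x f))) \<noteq> 0"
  proof
    assume "s + (1/6) *s br x (br x (br x (br x f))) = 0"
    then have "ze = 0"
      using wt by simp
    then show False
      using s two br_ze_simps(1)[OF s(1)] by simp
  qed
qed

text \<open>Here w' is q_{x^}(s) + s^ and t' is q_x(t). The automorphism of (2 x, 0) acts on degree
  -2 as 4 q_x, and q_x undoes q_{x^}, so w' goes to 4 w with w = s + q_x(s^). Applying the
  automorphism to [t, w] = \<zeta> shows that t' and w' are inverse to each other.\<close>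

lemma degree1_of_solution:
  assumes x: "x \<in> L 1" "x \<noteq> 0" and s: "s \<in> L 2" "s \<noteq> 0" and f: "f \<in> L (-2)" and sf: "br s f = - ze"
    and g: "g \<in> L (-1)" and xg: "br x g = ze" and sys: "system x s u t"
  defines "w' \<equiv> f + (1/6) *s br g (br g (br g (br g s)))"
    and "t' \<equiv> (1/6) *s br x (br x (br x (br x t)))"
  shows "br t' w' = - ze" "u = - br f (br t' g)"
    "br (br s (br w' x)) (br f (br t' g)) = ze"
proof -
  have u: "u \<in> L (-1)" and t: "t \<in> L (-2)" using sys by (simp_all add: system_def)
  note [simp] = x(1) s(1) f g t u
  define w where "w = s + (1/6) *s br x (br x (br x (br x f)))"
  have w [simp]: "w \<in> L 2" "w' \<in> L (-2)" "t' \<in> L 2" by (simp_all add: w_def w'_def t'_def)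
  obtain c :: 'k where c: "24 * c = 1" and d: "1 / 2 = 12 * c" "1 / 6 = 4 * c" "1 / 24 = c"
      "1 / 4 = 6 * c" "1 / 3 = 8 * c"
    by (rule denominators)
  have x2: "2 *s x \<in> L 1" "0 \<in> L 2" "2 *s x \<noteq> 0 \<or> (0 :: 'b) \<noteq> 0"
    using x two by simp_all
  obtain h k where reg: "reg h" and hz: "h ze = - ze" and hk: "\<And>u. h (k u) = u"
    and "\<And>u. k (h u) = u" and h: "\<And>v. v \<in> L (-2) \<Longrightarrow> h v = top (2 *s x) 0 v"
    and k: "\<And>v. v \<in> L (-2) \<Longrightarrow> k v = top (- (2 *s x)) (- 0) v"
    by (rule reversal[OF x2 s]) (rule that; assumption)
  have h4: "h v = 4 *s (1/6) *s br x (br x (br x (br x v)))" "k v = h v" if "v \<in> L (-2)" for v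
  proof -
    show "h v = 4 *s (1/6) *s br x (br x (br x (br x v)))"
      unfolding h[OF that]
    proof (rule vec_eqI, goal_cases)
      case (1 \<phi>)
      show ?case by (simp only: top_def br_lin br_zero_left d 1) (simp add: algebra_simps)
    qed
    show "k v = h v"
      by (simp add: h k that top_def br_lin)
  qed
  \<comment> \<open>The relation (ad g)^4 (ad x)^4 = 36 is known on degree -2. Writing s as a
    multiple of (ad x)^4 r gives the relation with x and g exchanged on s.\<close>
  obtain r where r: "r \<in> L (-2)" and "top x 0 r = s"
    using top_surj[of x 0 s] x by auto
  then have s_r: "s = (1/24) *s br x (br x (br x (br x r)))"
    by (simp add: top_def)
  have x4g4: "br x (br x (br x (br x (br g (br g (br g (br g s))))))) = 36 *s s"
    by (simp add: s_r br_lin sl2_raise_lower[OF x(1) g xg r] mult.commute)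
  have "h w' = 4 *s w"
    unfolding h4(1)[OF w(2)]
  proof (rule vec_eqI, goal_cases)
    case (1 \<phi>)
    show ?case
      by (simp only: w'_def w_def br_lin x4g4 d 1) (use c in algebra)
  qed
  then have "k w' = 4 *s w"
    by (simp add: h4(2))
  then have hw: "h (4 *s w) = w'"
    using hk[of w'] by simp
  have ht: "h t = 4 *s t'"
    by (simp add: h4(1) t'_def)
  have "br t w = ze"
    using skew_inverse_of_solution(1)[OF x(1) s f sf sys] br_anti[of t w] by (simp add: w_def)
  then have "br (h t) (h (4 *s w)) = - (4 *s ze)"
    by (simp add: regD(3)[OF reg, symmetric] br_lin) (simp add: regD[OF reg] hz)
  then show tw': "br t' w' = - ze"
    using numeral_neq_zero by (simp add: ht hw br_lin flip: scale_minus_right)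
  \<comment> \<open>Lowering q_x(t) once by g yields the coefficient 1/3 of the second equation,
    which therefore says [s, u] = -[g, t'] and is solved for u by applying ad f.\<close>
  have "br g t' = (1/6) *s 2 *s br x (br x (br x t))"
    by (simp add: t'_def br_lin sl2_lower[OF x(1) g xg t])
  also have "\<dots> = (1/3) *s br x (br x (br x t))"
  proof (rule vec_eqI, goal_cases)
    case (1 \<phi>)
    show ?case by (simp only: d 1) simp
  qed
  finally have "br s u = - br g t'"
    using sys by (simp add: system_def)
  then have "- u = - br f (br g t')"
    using skew_sl2(2)[OF s(1) f sf u] by (simp add: br_lin)
  then have "- u = br f (br t' g)"
    using br_anti[of g t'] by (simp add: br_lin)
  then show "u = - br f (br t' g)"
    by (metis minus_minus)
  have "br (br t' g) (br w' x) = ze"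
    by (rule skew_mult_inverse[OF w(3,2) tw' x(1) g xg])
  then show "br (br s (br w' x)) (br f (br t' g)) = ze"
    by (intro skew_mult_inverse[OF s(1) f sf]) simp_all
qed

end

section \<open>The Lie algebra of a structurable division algebra\<close>

text \<open>The last assumption excludes the zero algebra; in the theorem it follows from x being
  nonzero.\<close>

locale algebraic_division_algebra = structurable_division_algebra scale
  for scale :: "'k::field \<Rightarrow> 'a::algebra_ops \<Rightarrow> 'a" +
  assumes two: "(2 :: 'k) \<noteq> 0" and three: "(3 :: 'k) \<noteq> 0"
    and algebraic: "algebraic scale"
    and nontrivial: "(1 :: 'a) \<noteq> 0"
begin

text \<open>
  The combination of instances of the defining identity was found by linear algebra in the free
  nonassociative algebra with involution.
\<close>

lemma Lop_Lop_eq_Vop: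
  assumes s: "bar s = - s" and t: "bar t = - t"
  shows "scale 2 (s * (t * z)) = Vop (s * t) 1 z - Vop s t z"
proof (rule vec_eqI, goal_cases)
  case (1 \<phi>)
  define D where "D x y z w v = \<phi> (Vop x y (Vop z w v)) - \<phi> (Vop z w (Vop x y v))
        - \<phi> (Vop (Vop x y z) w v) + \<phi> (Vop z (Vop y x w) v)" for x y z w v
  have D: "D x y z w v = 0" for x y z w v
    using arg_cong[OF structurable[of x y z w v], of \<phi>] by (simp add: D_def 1)
  have "12 * \<phi> (scale 2 (s * (t * z)) - (Vop (s * t) 1 z - Vop s t z))
      = - 24 * D 1 s 1 t z - 5 * D 1 s 1 z t - 2 * D 1 s t z 1 - 16 * D 1 s z 1 t
        + 2 * D 1 s z t 1 + 12 * D 1 t z 1 s - 9 * D 1 z 1 s t - 6 * D z 1 s t 1"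
    unfolding D_def Vop_def
    by (simp add: alg_simps s t 1; simp add: algebra_simps)
  then have "12 * \<phi> (scale 2 (s * (t * z)) - (Vop (s * t) 1 z - Vop s t z)) = 0"
    by (simp add: D)
  moreover have "(12 :: 'k) = 2 * 2 * 3" by simp
  ultimately have "\<phi> (scale 2 (s * (t * z)) - (Vop (s * t) 1 z - Vop s t z)) = 0"
    using two three by (metis mult_eq_0_iff)
  then show ?case
    by (simp add: 1)
qed

section \<open>The space \<open>Instrl\<close> and its actions\<close>

sublocale O: vector_space "op_scale scale"
  by unfold_locales
    (simp_all add: op_scale_def fun_eq_iff scale_right_distrib scale_left_distrib)

abbreviation I :: "('a \<Rightarrow> 'a) set" where "I \<equiv> deg0 scale {}"

lemma I_span: "I = O.span {Vop x y |x y. True}"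
  by (simp add: deg0_def)

lemma I_add: "T \<in> I \<Longrightarrow> T' \<in> I \<Longrightarrow> T + T' \<in> I"
  and I_diff: "T \<in> I \<Longrightarrow> T' \<in> I \<Longrightarrow> T - T' \<in> I"
  and I_scale: "T \<in> I \<Longrightarrow> op_scale scale c T \<in> I"
  and I_zero: "0 \<in> I"
  and I_minus: "T \<in> I \<Longrightarrow> - T \<in> I"
  and I_Vop: "Vop x y \<in> I"
  by (auto simp: I_span O.span_add O.span_diff O.span_scale O.span_zero O.span_neg intro: O.span_base)

lemma I_id: "id \<in> I"
  using I_Vop id_eq_Vop by metis

lemma I_induct [consumes 1, case_names zero step]:
  assumes "T \<in> I" "P 0" "\<And>c x y T. P T \<Longrightarrow> P (op_scale scale c (Vop x y) + T)"
  shows "P T"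
  using assms(1) unfolding I_span
proof (induction rule: O.span_induct_alt)
  case base
  show ?case by (rule assms(2))
next
  case (step c v T)
  then obtain x y where v: "v = Vop x y" by blast
  show ?case
    unfolding v by (rule assms(3)[OF step(2)])
qed

lemma I_lin:
  assumes "T \<in> I"
  shows "T (x + y) = T x + T y" "T (scale c x) = scale c (T x)" "T 0 = 0" "T (- x) = - T x"
    "T (x - y) = T x - T y"
proof -
  show 1: "T (x + y) = T x + T y" for x y
    using assms by (induction rule: I_induct)
      (simp_all add: op_scale_def Vop_def alg_simps scale_right_distrib scale_right_diff_distrib algebra_simps)
  show 2: "T (scale c x) = scale c (T x)" for c x
    using assms by (induction rule: I_induct)
      (simp_all add: op_scale_def Vop_def alg_simps scale_right_distrib scale_right_diff_distrib
        mult.commute)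
  show "T 0 = 0" using 1[of 0 0] by simp
  show 3: "T (- x) = - T x" for x using 2[of "-1" x] by simp
  show "T (x - y) = T x - T y" using 1[of x "- y"] 3[of y] by simp
qed

lemma Lop_Lop_in_I: "s \<in> Skew \<Longrightarrow> t \<in> Skew \<Longrightarrow> Lop s \<circ> Lop t \<in> I"
proof -
  assume "s \<in> Skew" "t \<in> Skew"
  then have "op_scale scale 2 (Lop s \<circ> Lop t) = Vop (s * t) 1 - Vop s t"
    by (simp add: op_scale_def Lop_def fun_eq_iff Lop_Lop_eq_Vop Skew_def)
  then have "Lop s \<circ> Lop t = op_scale scale (1 / 2) (Vop (s * t) 1 - Vop s t)"
    using O.scale_scale[of "1/2" 2 "Lop s \<circ> Lop t"] two by simp
  then show ?thesis
    by (simp add: I_scale I_diff I_Vop)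
qed

lemma Vop_lin:
  "Vop (x + x') y z = Vop x y z + Vop x' y z" "Vop x (y + y') z = Vop x y z + Vop x y' z"
  "Vop (scale c x) y z = scale c (Vop x y z)" "Vop x (scale c y) z = scale c (Vop x y z)"
  "Vop 0 y z = 0" "Vop x 0 z = 0"
  by (simp_all add: Vop_def alg_simps scale_right_distrib scale_right_diff_distrib algebra_simps)

lemma Vop_commutator_in_I: "(Vop x y \<circ> T) - (T \<circ> Vop x y) \<in> I" if "T \<in> I"
  using that
proof (induction rule: I_induct)
  case zero
  have "(Vop x y \<circ> 0) - (0 \<circ> Vop x y) = 0"
    by (simp add: fun_eq_iff I_lin[OF I_Vop])
  then show ?case by (simp only: I_zero)
next
  case (step c z w T)
  have "(Vop x y \<circ> (op_scale scale c (Vop z w) + T)) - ((op_scale scale c (Vop z w) + T) \<circ> Vop x y)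
      = op_scale scale c (Vop (Vop x y z) w - Vop z (Vop y x w))
        + ((Vop x y \<circ> T) - (T \<circ> Vop x y))"
    by (simp add: fun_eq_iff op_scale_def I_lin[OF I_Vop] structurable[symmetric]
        scale_right_diff_distrib)
  then show ?case
    using step by (simp only: I_add I_scale I_diff I_Vop)
qed

lemma commutator_in_I: "(T \<circ> T') - (T' \<circ> T) \<in> I" if "T \<in> I" "T' \<in> I"
  using that(1)
proof (induction rule: I_induct)
  case zero
  have "(0 \<circ> T') - (T' \<circ> 0) = 0"
    by (simp add: fun_eq_iff I_lin[OF that(2)])
  then show ?case by (simp only: I_zero)
next
  case (step c x y T)
  have "((op_scale scale c (Vop x y) + T) \<circ> T') - (T' \<circ> (op_scale scale c (Vop x y) + T))
      = op_scale scale c ((Vop x y \<circ> T') - (T' \<circ> Vop x y)) + ((T \<circ> T') - (T' \<circ> T))"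
    by (simp add: fun_eq_iff op_scale_def I_lin[OF that(2)] scale_right_diff_distrib)
  then show ?case
    using step Vop_commutator_in_I[OF that(2)] by (simp only: I_add I_scale)
qed

text \<open>The values of the degree 0 actions found in \<open>act_S_minus_eq\<close>,
  \<open>act_A_minus_eq\<close> and \<open>act_S_plus_eq\<close>. Unlike the definite descriptions
  they are visibly linear in the operator.\<close>

definition aSm :: "('a \<Rightarrow> 'a) \<Rightarrow> 'a \<Rightarrow> 'a" where "aSm T w = T w - (T 1 + bar (T 1)) * w - w * T 1"
definition aAm :: "('a \<Rightarrow> 'a) \<Rightarrow> 'a \<Rightarrow> 'a" where "aAm T w = T w - (T 1 + bar (T 1)) * w"
definition aSp :: "('a \<Rightarrow> 'a) \<Rightarrow> 'a \<Rightarrow> 'a" where "aSp T w = T w + w * bar (T 1)"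

lemma act_lin:
  assumes "T \<in> I"
  shows "aSm T (w + w') = aSm T w + aSm T w'" "aSm T (scale c w) = scale c (aSm T w)"
    "aAm T (w + w') = aAm T w + aAm T w'" "aAm T (scale c w) = scale c (aAm T w)"
    "aSp T (w + w') = aSp T w + aSp T w'" "aSp T (scale c w) = scale c (aSp T w)"
    "aSm T 0 = 0" "aAm T 0 = 0" "aSp T 0 = 0"
  by (simp_all add: aSm_def aAm_def aSp_def I_lin[OF assms] alg_simps scale_right_distrib
      scale_right_diff_distrib algebra_simps)

lemma act_op_lin:
  "aSm (T + T') w = aSm T w + aSm T' w" "aSm (op_scale scale c T) w = scale c (aSm T w)"
  "aAm (T + T') w = aAm T w + aAm T' w" "aAm (op_scale scale c T) w = scale c (aAm T w)"
  "aSp (T + T') w = aSp T w + aSp T' w" "aSp (op_scale scale c T) w = scale c (aSp T w)"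
  "aSm 0 w = 0" "aAm 0 w = 0" "aSp 0 w = 0"
  by (simp_all add: aSm_def aAm_def aSp_def op_scale_def alg_simps scale_right_distrib
      scale_right_diff_distrib algebra_simps)

lemma Skew_add: "s \<in> Skew \<Longrightarrow> t \<in> Skew \<Longrightarrow> s + t \<in> Skew"
  and Skew_diff: "s \<in> Skew \<Longrightarrow> t \<in> Skew \<Longrightarrow> s - t \<in> Skew"
  and Skew_minus: "s \<in> Skew \<Longrightarrow> - s \<in> Skew"
  and Skew_scale: "s \<in> Skew \<Longrightarrow> scale c s \<in> Skew"
  and Skew_zero: "0 \<in> (Skew :: 'a set)"
  and Skew_psi: "psi x (y :: 'a) \<in> Skew"
  by (simp_all add: Skew_def psi_def alg_simps)

lemma aSp_Vop: "s \<in> Skew \<Longrightarrow> aSp (Vop a b) s = - psi a (s * b)"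
  using act_S_plus_eq[OF two three, of s "{}" "Vop a b"] deg0_act_Vop(3)[of "{}" s a b] two three I_Vop
  by (simp add: aSp_def)

lemma aSm_Vop: "t \<in> Skew \<Longrightarrow> aSm (Vop a b) t = psi b (t * a)"
  using act_S_minus_eq[OF two three, of t "{}" "Vop a b"] deg0_act_Vop(4)[of "{}" t a b] two three I_Vop
  by (simp add: aSm_def)

lemma aAm_Vop: "aAm (Vop a b) y = - Vop b a y"
  using act_A_minus_eq[of "{}" "Vop a b" y] deg0_act_Vop(2)[of "{}" a b y] I_Vop
  by (simp add: aAm_def)

lemma aSp_Skew: "T \<in> I \<Longrightarrow> s \<in> Skew \<Longrightarrow> aSp T s \<in> Skew"
  by (induction rule: I_induct) (simp_all add: act_op_lin aSp_Vop Skew_zero Skew_add Skew_scale Skew_minus Skew_diff Skew_psi)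

lemma aSm_Skew: "T \<in> I \<Longrightarrow> s \<in> Skew \<Longrightarrow> aSm T s \<in> Skew"
  by (induction rule: I_induct) (simp_all add: act_op_lin aSm_Vop Skew_zero Skew_add Skew_scale Skew_minus Skew_diff Skew_psi)

section \<open>The bracket on the carrier of K(A)\<close>

abbreviation C :: "'a graded set" where "C \<equiv> graded_carrier scale {}"

lemma graded_bracket_eq:
  assumes "(t, y, T, x, s) \<in> C" "(t', y', T', x', s') \<in> C"
  shows "graded_bracket scale {} c (t, y, T, x, s) (t', y', T', x', s') =
     (aSm T t' - aSm T' t + scale c (psi y y'),
      aAm T y' - aAm T' y + t * x' - t' * x,
      (T \<circ> T') - (T' \<circ> T) + op_scale scale c (Vop x y' - Vop x' y)
        + (Lop s \<circ> Lop t') - (Lop s' \<circ> Lop t),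
      T x' - T' x + s * y' - s' * y,
      aSp T s' - aSp T' s + scale c (psi x x'))"
  using assms two three
  by (simp add: graded_carrier_def act_S_minus_eq act_A_minus_eq act_A_plus_eq act_S_plus_eq
      aSm_def aAm_def aSp_def)

lemma graded_bracket_closed:
  assumes "X \<in> C" "Y \<in> C"
  shows "graded_bracket scale {} c X Y \<in> C"
proof -
  obtain t y T x s where X: "X = (t, y, T, x, s)" by (cases X) auto
  obtain t' y' T' x' s' where Y: "Y = (t', y', T', x', s')" by (cases Y) auto
  show ?thesis
    using assms unfolding X Y graded_bracket_eq[OF assms[unfolded X Y]]
    by (simp add: graded_carrier_def aSm_Skew aSp_Skew Skew_add Skew_diff Skew_scale Skew_psi I_add
        I_diff I_scale I_Vop commutator_in_I Lop_Lop_in_I)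
qed

end

lemma (in finite_dimensional_vector_space) inj_on_subspace_imp_surj:
  assumes S: "subspace S" and f: "Vector_Spaces.linear scale scale f" and fS: "f ` S \<subseteq> S" and inj: "inj_on f S"
  shows "f ` S = S"
proof -
  interpret p: finite_dimensional_vector_space_pair_1 scale Basis scale ..
  have "subspace (f ` S)"
    using f S by (simp add: linear_iff_module_hom module_hom.subspace_image)
  moreover have "dim (f ` S) = dim S"
    using S inj by (intro p.dim_image_eq[OF f]) (simp add: span_eq_iff[THEN iffD2])
  ultimately show ?thesis
    using S fS by (intro subspace_dim_equal) simp_all
qed

context algebraic_division_algebra
begin

text \<open>A linear complement of \<open>I\<close> among all functions gives a total linear
  projection, which serves as the component of degree 0.\<close>

lemma I_projection:
  obtains P where "\<And>T. P T \<in> I" "\<And>T. T \<in> I \<Longrightarrow> P T = T" "\<And>T T'. P (T + T') = P T + P T'"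
    "\<And>c T. P (op_scale scale c T) = op_scale scale c (P T)"
proof -
  interpret p: vector_space_pair "op_scale scale" "op_scale scale" ..
  have "Vector_Spaces.linear (op_scale scale) (op_scale scale) (\<lambda>T. T)"
    by (rule O.linear_ident)
  moreover have "O.subspace I"
    by (simp add: I_span O.subspace_span)
  ultimately obtain g where "g ` UNIV \<subseteq> I" and g: "Vector_Spaces.linear (op_scale scale) (op_scale scale) g"
    and "\<forall>v\<in>I. g v = v"
    using p.linear_exists_left_inverse_on[of "\<lambda>T. T" I] by auto
  moreover have "g (T + T') = g T + g T'" "g (op_scale scale c T) = op_scale scale c (g T)" for c T T'
    by (simp_all only: module_hom.add[OF g[unfolded linear_iff_module_hom]]
        module_hom.scale[OF g[unfolded linear_iff_module_hom]])
  ultimately show ?thesis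
    by (intro that[of g]) auto
qed

definition P0 :: "('a \<Rightarrow> 'a) \<Rightarrow> 'a \<Rightarrow> 'a" where
  "P0 = (SOME P. (\<forall>T. P T \<in> I) \<and> (\<forall>T\<in>I. P T = T) \<and> (\<forall>T T'. P (T + T') = P T + P T')
    \<and> (\<forall>c T. P (op_scale scale c T) = op_scale scale c (P T)))"

lemma P0: "P0 T \<in> I" "T \<in> I \<Longrightarrow> P0 T = T" "P0 (T + T') = P0 T + P0 T'"
  "P0 (op_scale scale c T) = op_scale scale c (P0 T)"
proof -
  have "\<exists>P. (\<forall>T. P T \<in> I) \<and> (\<forall>T\<in>I. P T = T) \<and> (\<forall>T T'. P (T + T') = P T + P T')
      \<and> (\<forall>c T. P (op_scale scale c T) = op_scale scale c (P T))"
    by (rule I_projection) blast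
  from someI_ex[OF this] show "P0 T \<in> I" "T \<in> I \<Longrightarrow> P0 T = T" "P0 (T + T') = P0 T + P0 T'"
    "P0 (op_scale scale c T) = op_scale scale c (P0 T)"
    unfolding P0_def by blast+
qed

definition skp :: "'a \<Rightarrow> 'a" where "skp t = scale (1 / 2) (t - bar t)"

lemma skp: "skp t \<in> Skew" "t \<in> Skew \<Longrightarrow> skp t = t" "skp (s + t) = skp s + skp t"
  "skp (scale c t) = scale c (skp t)"
proof -
  show "skp t \<in> Skew"
    by (simp add: skp_def Skew_def alg_simps scale_right_diff_distrib)
  show "skp t = t" if "t \<in> Skew"
  proof -
    have "t - bar t = scale 2 t"
      using that by (simp add: Skew_def scale_two)
    then show ?thesis using two by (simp add: skp_def)
  qed
  show "skp (s + t) = skp s + skp t"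
    by (simp add: skp_def alg_simps scale_right_distrib[symmetric])
  show "skp (scale c t) = scale c (skp t)"
    by (simp add: skp_def alg_simps scale_right_diff_distrib mult.commute)
qed

text \<open>\<open>skp\<close> and \<open>P0\<close> ensure that every element fixed by a component
  map lies in the carrier.\<close>

fun graded_component :: "int \<Rightarrow> 'a graded \<Rightarrow> 'a graded" where
  "graded_component i (t, y, T, x, s) =
    (if i = -2 then skp t else 0, if i = -1 then y else 0, if i = 0 then P0 T else 0,
     if i = 1 then x else 0, if i = 2 then skp s else 0)"

text \<open>
  The bracket is extended from the carrier to the whole type by a linear projection, so that
  bilinearity and the Jacobi identity hold without membership assumptions.
\<close>

fun carrier_projection :: "'a graded \<Rightarrow> 'a graded" where
  "carrier_projection (t, y, T, x, s) = (skp t, y, P0 T, x, skp s)"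

definition bracket :: "'a graded \<Rightarrow> 'a graded \<Rightarrow> 'a graded" where
  "bracket X Y = graded_bracket scale {} 1 (carrier_projection X) (carrier_projection Y)"

lemma projection_carrier: "carrier_projection X \<in> C"
  by (cases X rule: carrier_projection.cases) (simp add: graded_carrier_def skp P0)

lemma projection_id: "X \<in> C \<Longrightarrow> carrier_projection X = X"
  by (cases X rule: carrier_projection.cases) (simp add: graded_carrier_def skp P0)

lemma bracket_carrier: "X \<in> C \<Longrightarrow> Y \<in> C \<Longrightarrow> bracket X Y = graded_bracket scale {} 1 X Y"
  by (simp add: bracket_def projection_id)

abbreviation M2 :: "'a \<Rightarrow> 'a graded" where "M2 t \<equiv> (t, 0, 0, 0, 0)"
abbreviation M1 :: "'a \<Rightarrow> 'a graded" where "M1 y \<equiv> (0, y, 0, 0, 0)"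
abbreviation Z0 :: "('a \<Rightarrow> 'a) \<Rightarrow> 'a graded" where "Z0 T \<equiv> (0, 0, T, 0, 0)"
abbreviation P1 :: "'a \<Rightarrow> 'a graded" where "P1 x \<equiv> (0, 0, 0, x, 0)"
abbreviation P2 :: "'a \<Rightarrow> 'a graded" where "P2 s \<equiv> (0, 0, 0, 0, s)"

lemma hom_in_C:
  "t \<in> Skew \<Longrightarrow> M2 t \<in> C" "M1 y \<in> C" "T \<in> I \<Longrightarrow> Z0 T \<in> C" "P1 x \<in> C" "s \<in> Skew \<Longrightarrow> P2 s \<in> C"
  by (simp_all add: graded_carrier_def Skew_zero I_zero)

lemma zero_comp [simp]: "T \<in> I \<Longrightarrow> T \<circ> 0 = 0" "0 \<circ> f = 0"
  by (simp_all add: fun_eq_iff I_lin)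

lemma Lop_zero [simp]: "Lop (0 :: 'a) = 0"
  by (simp add: Lop_def fun_eq_iff alg_simps)

lemma Lop_comp_zero [simp]: "Lop s \<circ> 0 = (0 :: 'a \<Rightarrow> 'a)"
  by (simp add: Lop_def fun_eq_iff alg_simps)

lemma Vop_zero [simp]: "Vop 0 (y :: 'a) = 0" "Vop (x :: 'a) 0 = 0"
  by (simp_all add: fun_eq_iff Vop_lin)

lemma psi_zero [simp]: "psi 0 (y :: 'a) = 0" "psi (x :: 'a) 0 = 0"
  by (simp_all add: psi_def alg_simps)

lemma op_scale_zero [simp]: "op_scale scale c 0 = 0" "op_scale scale 1 T = T"
  by (simp_all add: op_scale_def fun_eq_iff)

lemmas bracket_hom_simps = bracket_carrier hom_in_C graded_bracket_eq act_lin act_op_lin alg_simps I_lin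
  I_zero Skew_zero

lemma bracket_hom:
  shows "t \<in> Skew \<Longrightarrow> t' \<in> Skew \<Longrightarrow> bracket (M2 t) (M2 t') = 0"
    and "t \<in> Skew \<Longrightarrow> bracket (M2 t) (M1 y) = 0"
    and "t \<in> Skew \<Longrightarrow> T \<in> I \<Longrightarrow> bracket (M2 t) (Z0 T) = M2 (- aSm T t)"
    and "t \<in> Skew \<Longrightarrow> bracket (M2 t) (P1 x) = M1 (t * x)"
    and "t \<in> Skew \<Longrightarrow> s \<in> Skew \<Longrightarrow> bracket (M2 t) (P2 s) = Z0 (- (Lop s \<circ> Lop t))"
    and "t \<in> Skew \<Longrightarrow> bracket (M1 y) (M2 t) = 0"
    and "bracket (M1 y) (M1 y') = M2 (psi y y')"
    and "T \<in> I \<Longrightarrow> bracket (M1 y) (Z0 T) = M1 (- aAm T y)"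
    and "bracket (M1 y) (P1 x) = Z0 (- Vop x y)"
    and "s \<in> Skew \<Longrightarrow> bracket (M1 y) (P2 s) = P1 (- (s * y))"
    and "T \<in> I \<Longrightarrow> t \<in> Skew \<Longrightarrow> bracket (Z0 T) (M2 t) = M2 (aSm T t)"
    and "T \<in> I \<Longrightarrow> bracket (Z0 T) (M1 y) = M1 (aAm T y)"
    and "T \<in> I \<Longrightarrow> T' \<in> I \<Longrightarrow> bracket (Z0 T) (Z0 T') = Z0 ((T \<circ> T') - (T' \<circ> T))"
    and "T \<in> I \<Longrightarrow> bracket (Z0 T) (P1 x) = P1 (T x)"
    and "T \<in> I \<Longrightarrow> s \<in> Skew \<Longrightarrow> bracket (Z0 T) (P2 s) = P2 (aSp T s)"
    and "t \<in> Skew \<Longrightarrow> bracket (P1 x) (M2 t) = M1 (- (t * x))"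
    and "bracket (P1 x) (M1 y) = Z0 (Vop x y)"
    and "T \<in> I \<Longrightarrow> bracket (P1 x) (Z0 T) = P1 (- T x)"
    and "bracket (P1 x) (P1 x') = P2 (psi x x')"
    and "s \<in> Skew \<Longrightarrow> bracket (P1 x) (P2 s) = 0"
    and "t \<in> Skew \<Longrightarrow> s \<in> Skew \<Longrightarrow> bracket (P2 s) (M2 t) = Z0 (Lop s \<circ> Lop t)"
    and "s \<in> Skew \<Longrightarrow> bracket (P2 s) (M1 y) = P1 (s * y)"
    and "T \<in> I \<Longrightarrow> s \<in> Skew \<Longrightarrow> bracket (P2 s) (Z0 T) = P2 (- aSp T s)"
    and "s \<in> Skew \<Longrightarrow> bracket (P2 s) (P1 x) = 0"
    and "s \<in> Skew \<Longrightarrow> s' \<in> Skew \<Longrightarrow> bracket (P2 s) (P2 s') = 0"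
  by (simp_all add: bracket_hom_simps zero_prod_def del: graded_bracket.simps)

lemma component_hom:
  assumes "graded_component i v = v"
  obtains t where "i = -2" "t \<in> Skew" "v = M2 t" | y where "i = -1" "v = M1 y"
    | T where "i = 0" "T \<in> I" "v = Z0 T" | x where "i = 1" "v = P1 x"
    | s where "i = 2" "s \<in> Skew" "v = P2 s" | "v = 0"
proof (cases v rule: carrier_projection.cases)
  case (1 t y T x s)
  from assms have *: "(if i = -2 then skp t else 0) = t" "(if i = -1 then y else 0) = y"
    "(if i = 0 then P0 T else 0) = T" "(if i = 1 then x else 0) = x" "(if i = 2 then skp s else 0) = s"
    by (simp_all add: 1)
  consider "i = -2" | "i = -1" | "i = 0" | "i = 1" | "i = 2" | "i \<notin> {-2, -1, 0, 1, 2}"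
    by auto
  then show ?thesis
  proof cases
    assume "i = -2" then show ?thesis using that(1)[of t] * skp(1)[of t] 1 by auto
  next
    assume "i = -1" then show ?thesis using that(2)[of y] * 1 by auto
  next
    assume "i = 0" then show ?thesis using that(3)[of T] * P0(1)[of T] 1 by auto
  next
    assume "i = 1" then show ?thesis using that(4)[of x] * 1 by auto
  next
    assume "i = 2" then show ?thesis using that(5)[of s] * skp(1)[of s] 1 by auto
  next
    assume "i \<notin> {-2, -1, 0, 1, 2}" then show ?thesis using that(6) * 1 by (auto simp: zero_prod_def)
  qed
qed

lemma projection_lin:
  "carrier_projection (X + Y) = carrier_projection X + carrier_projection Y"
  "carrier_projection (graded_scale scale c X) = graded_scale scale c (carrier_projection X)"
  by (cases X rule: carrier_projection.cases; cases Y rule: carrier_projection.cases; simp add: skp P0)+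

lemma graded_bracket_add_left:
  assumes "X \<in> C" "X' \<in> C" "Y \<in> C"
  shows "graded_bracket scale {} 1 (X + X') Y = graded_bracket scale {} 1 X Y + graded_bracket scale {} 1 X' Y"
proof -
  obtain t y T x s where X: "X = (t, y, T, x, s)" by (cases X) auto
  obtain t' y' T' x' s' where X': "X' = (t', y', T', x', s')" by (cases X') auto
  obtain t'' y'' T'' x'' s'' where Y: "Y = (t'', y'', T'', x'', s'')" by (cases Y) auto
  have XX: "(t + t', y + y', T + T', x + x', s + s') \<in> C"
    using assms(1,2) by (simp add: X X' graded_carrier_def Skew_add I_add)
  have I: "T \<in> I" "T' \<in> I" "T'' \<in> I"
    using assms by (simp_all add: X X' Y graded_carrier_def)
  show ?thesis
    using assms XX unfolding X X' Y
    by (simp add: graded_bracket_eq del: graded_bracket.simps)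
      (simp add: act_lin act_op_lin I alg_simps psi_def Vop_lin I_lin Lop_def fun_eq_iff op_scale_def
        algebra_simps)
qed

lemma graded_bracket_scale_left:
  assumes "X \<in> C" "Y \<in> C"
  shows "graded_bracket scale {} 1 (graded_scale scale c X) Y
    = graded_scale scale c (graded_bracket scale {} 1 X Y)"
proof -
  obtain t y T x s where X: "X = (t, y, T, x, s)" by (cases X) auto
  obtain t'' y'' T'' x'' s'' where Y: "Y = (t'', y'', T'', x'', s'')" by (cases Y) auto
  have XX: "(scale c t, scale c y, op_scale scale c T, scale c x, scale c s) \<in> C"
    using assms(1) by (simp add: X graded_carrier_def Skew_scale I_scale)
  have I: "T \<in> I" "T'' \<in> I"
    using assms by (simp_all add: X Y graded_carrier_def)
  show ?thesis
    using assms XX unfolding X Y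
    by (simp add: graded_bracket_eq del: graded_bracket.simps)
      (simp add: act_lin I alg_simps psi_def Vop_lin I_lin Lop_def fun_eq_iff op_scale_def
        aSm_def aAm_def aSp_def scale_right_distrib scale_right_diff_distrib)
qed

lemma graded_bracket_anti: "graded_bracket scale {} 1 X Y = - graded_bracket scale {} 1 Y (X :: 'a graded)"
proof -
  obtain t y T x s where X: "X = (t, y, T, x, s)" by (cases X) auto
  obtain t'' y'' T'' x'' s'' where Y: "Y = (t'', y'', T'', x'', s'')" by (cases Y) auto
  show ?thesis
    unfolding X Y by (simp add: psi_def fun_eq_iff op_scale_def scale_right_diff_distrib)
qed

lemma bracket_pow: "X \<in> C \<Longrightarrow> Z \<in> C \<Longrightarrow>
    (graded_bracket scale {} 1 X ^^ i) Z = (bracket X ^^ i) Z \<and> (bracket X ^^ i) Z \<in> C"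
  by (induction i) (simp_all add: bracket_carrier graded_bracket_closed)

lemma trunc_exp_eq: "X \<in> C \<Longrightarrow> Z \<in> C \<Longrightarrow>
    trunc_exp (graded_scale scale) bracket X Z = graded_exp scale {} 1 X Z"
  by (simp add: trunc_exp_def graded_exp_def bracket_pow)

lemma elt_in_C: "s \<in> Skew \<Longrightarrow> elt_plus x s \<in> C" "s \<in> Skew \<Longrightarrow> elt_minus x s \<in> C"
  by (simp_all add: elt_plus_def elt_minus_def graded_carrier_def Skew_zero I_zero)

text \<open>Algebraicity enters here; \<open>trunc_exp\<close> with the extended bracket agrees with
  \<open>graded_exp\<close> on the carrier.\<close>

lemma exp_automorphism:
  assumes "s \<in> Skew" "E = elt_plus x s \<or> E = elt_minus x s" "X \<in> C" "Y \<in> C"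
  shows "trunc_exp (graded_scale scale) bracket E (bracket X Y)
    = bracket (trunc_exp (graded_scale scale) bracket E X) (trunc_exp (graded_scale scale) bracket E Y)"
proof -
  let ?f = "graded_exp scale {} 1 E"
  have aut: "is_automorphism scale {} 1 ?f"
    using algebraic assms(1,2) by (auto simp: algebraic_def)
  have E: "E \<in> C" using assms(1,2) elt_in_C by auto
  have "?f X \<in> C" "?f Y \<in> C"
    using aut assms(3,4) by (auto simp: is_automorphism_def bij_betw_def)
  moreover have "?f (graded_bracket scale {} 1 X Y) = graded_bracket scale {} 1 (?f X) (?f Y)"
    using aut assms(3,4) by (simp add: is_automorphism_def)
  ultimately show ?thesis
    using assms(3,4) E by (simp add: trunc_exp_eq bracket_carrier graded_bracket_closed)
qed

section \<open>K(A) as an instance of the abstract graded algebra\<close>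

text \<open>The operator V_{u,v} determines its action -V_{v,u} on degree -1, where the identity
  acts as -id.\<close>

lemma Vop_id_sym: "Vop u v = id \<Longrightarrow> Vop v u = (id :: 'a \<Rightarrow> 'a)"
proof
  fix y :: 'a
  assume "Vop u v = id"
  then have "- Vop v u y = aAm id y"
    by (simp flip: aAm_Vop)
  then have "- Vop v u y = - y"
    by (simp add: aAm_def alg_simps)
  then show "Vop v u y = id y" by simp
qed

lemma graded_vector_space: "vector_space (graded_scale scale)"
proof
  fix a b :: 'k and X Y :: "'a graded"
  show "graded_scale scale a (X + Y) = graded_scale scale a X + graded_scale scale a Y"
    by (cases X; cases Y; simp add: scale_right_distrib O.scale_right_distrib)
  show "graded_scale scale (a + b) X = graded_scale scale a X + graded_scale scale b X"
    by (cases X; simp add: scale_left_distrib O.scale_left_distrib)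
  show "graded_scale scale a (graded_scale scale b X) = graded_scale scale (a * b) X"
    by (cases X; simp)
  show "graded_scale scale 1 X = X"
    by (cases X; simp)
qed

lemma component_in_C: "graded_component i v = v \<Longrightarrow> v \<in> C"
  by (erule component_hom) (auto simp: hom_in_C Skew_zero I_zero graded_carrier_def zero_prod_def)

lemma skew_surj:
  assumes add: "\<And>u v. f (u + v) = f u + f v" and scl: "\<And>c v. f (scale c v) = scale c (f v)"
    and S: "\<And>s. s \<in> Skew \<Longrightarrow> f s \<in> Skew" and inj: "\<And>s. s \<in> Skew \<Longrightarrow> f s = 0 \<Longrightarrow> s = 0"
    and w: "w \<in> (Skew :: 'a set)"
  obtains s where "s \<in> Skew" "f s = w"
proof -
  obtain B0 where B0: "finite B0" "span B0 = UNIV"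
    using finite_dimensional by blast
  obtain B where B: "B \<subseteq> B0" "independent B" "B0 \<subseteq> span B"
    using maximal_independent_subset[of B0] by blast
  then have "span B = UNIV"
    using B0 by (metis span_minimal subspace_span top.extremum_uniqueI)
  then interpret fd: finite_dimensional_vector_space scale B
    using B B0 by unfold_locales (auto intro: finite_subset)
  have lin: "Vector_Spaces.linear scale scale f"
    using add scl by (auto simp: Vector_Spaces.linear_iff vector_space_axioms)
  have "subspace (Skew :: 'a set)"
    by (simp add: subspace_def Skew_add Skew_scale Skew_zero)
  moreover have "inj_on f Skew"
  proof (rule inj_onI)
    fix a b assume ab: "a \<in> Skew" "b \<in> Skew" "f a = f b"
    have "f (a - b) = 0"
      using add[of "a - b" b] ab(3) by simp
    then show "a = b"
      using inj[of "a - b"] ab by (simp add: Skew_diff)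
  qed
  ultimately have "f ` Skew = Skew"
    using S by (intro fd.inj_on_subspace_imp_surj lin) auto
  then show ?thesis
    using that w by (metis imageE)
qed

lemma bracket_add: "bracket (u + v) w = bracket u w + bracket v w"
  by (simp add: bracket_def projection_lin graded_bracket_add_left projection_carrier)

lemma bracket_scale: "bracket (graded_scale scale c v) w = graded_scale scale c (bracket v w)"
  by (simp add: bracket_def projection_lin graded_bracket_scale_left projection_carrier)

lemma bracket_anti: "bracket v w = - bracket w v"
  unfolding bracket_def by (rule graded_bracket_anti)

lemma bracket_zero: "bracket 0 w = 0" "bracket v 0 = 0"
proof -
  show *: "bracket 0 w = 0" for w
    using bracket_add[of 0 0 w] by simp
  show "bracket v 0 = 0"
    using bracket_anti[of v 0] by (simp add: *)
qed

lemma P0_zero: "P0 0 = 0" and skp_zero: "skp 0 = 0"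
  by (simp_all add: P0 I_zero skp Skew_zero)

lemma component_add: "graded_component i (u + v) = graded_component i u + graded_component i v"
  by (cases u rule: carrier_projection.cases; cases v rule: carrier_projection.cases; simp add: skp P0)

lemma component_scale:
  "graded_component i (graded_scale scale c v) = graded_scale scale c (graded_component i v)"
  by (cases v rule: carrier_projection.cases; simp add: skp P0)

lemma component_component:
  "graded_component i (graded_component j v) = (if i = j then graded_component i v else 0)"
  by (cases v rule: carrier_projection.cases) (auto simp: skp P0 P0_zero skp_zero zero_prod_def)

lemma component_zero: "graded_component i 0 = 0"
  by (simp add: zero_prod_def P0_zero skp_zero)

lemma sum_component: "(\<Sum>i = -2..2. graded_component i v) = carrier_projection v"
proof -
  have "{-2..2 :: int} = {-2, -1, 0, 1, 2}" by auto
  then show ?thesis by (cases v rule: carrier_projection.cases) simp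
qed

lemma component_iff:
  "graded_component (-2) v = v \<longleftrightarrow> (\<exists>t\<in>Skew. v = M2 t)"
  "graded_component (-1) v = v \<longleftrightarrow> (\<exists>y. v = M1 y)"
  "graded_component 0 v = v \<longleftrightarrow> (\<exists>T\<in>I. v = Z0 T)"
  "graded_component 1 v = v \<longleftrightarrow> (\<exists>x. v = P1 x)"
  "graded_component 2 v = v \<longleftrightarrow> (\<exists>s\<in>Skew. v = P2 s)"
  by (auto elim!: component_hom simp: skp P0 P0_zero skp_zero zero_prod_def Skew_zero I_zero)

lemma component_bracket:
  assumes "graded_component i v = v" "graded_component j w = w"
  shows "graded_component (i + j) (bracket v w) = bracket v w"
  by (rule component_hom[OF assms(1)]; rule component_hom[OF assms(2)])
    (auto simp: bracket_hom bracket_zero component_zero skp P0 P0_zero skp_zero aSm_Skew aSp_Skew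
      Skew_psi Skew_minus I_minus I_Vop Lop_Lop_in_I commutator_in_I)

lemma bracket_zeta_hom:
  assumes "graded_component i v = v"
  shows "bracket zeta v = graded_scale scale (of_int i) v"
  by (rule component_hom[OF assms])
    (auto simp: zeta_def bracket_hom bracket_zero I_id aSm_def aAm_def aSp_def alg_simps scale_two
      zero_prod_def Skew_def)

lemma deg0_in_span:
  assumes "T \<in> I"
  shows "Z0 T \<in> module.span (graded_scale scale)
    {bracket X Y |X Y. graded_component 1 X = X \<and> graded_component (-1) Y = Y}"
proof -
  interpret G: vector_space "graded_scale scale" by (rule graded_vector_space)
  let ?S = "{bracket X Y |X Y. graded_component 1 X = X \<and> graded_component (-1) Y = Y}"
  show ?thesis
    using assms
  proof (induction rule: I_induct)
    case zero
    show ?case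
      using G.span_zero[of ?S] by (simp only: zero_prod_def)
  next
    case (step c x y T)
    have "bracket (P1 x) (M1 y) \<in> ?S"
      using component_iff(2)[of "M1 y"] component_iff(4)[of "P1 x"] by blast
    then have "graded_scale scale c (Z0 (Vop x y)) + Z0 T \<in> G.span ?S"
      using step by (simp only: bracket_hom G.span_add G.span_scale G.span_base)
    moreover have "graded_scale scale c (Z0 (Vop x y)) + Z0 T = Z0 (op_scale scale c (Vop x y) + T)"
      by simp
    ultimately show ?case by (simp only:)
  qed
qed

lemma division_Vop: "x \<noteq> 0 \<Longrightarrow> \<exists>y. Vop x y = (id :: 'a \<Rightarrow> 'a)"
  using division[of x] by (simp add: conj_invertible_def)

sublocale K: graded_exp_algebra "graded_scale scale" bracket graded_component zeta
proof (intro graded_exp_algebra.intro graded_vector_space graded_exp_algebra_axioms.intro)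
  fix i j :: int and v w x s y t :: "'a graded" and F :: "'a graded \<Rightarrow> 'a graded"
  show "(2 :: 'k) \<noteq> 0" by (rule two)
  show "(3 :: 'k) \<noteq> 0" by (rule three)
  show "i < -2 \<or> 2 < i \<Longrightarrow> graded_component i v = 0"
    by (cases v rule: carrier_projection.cases) (auto simp: zero_prod_def)
  show "bracket (\<Sum>i = -2..2. graded_component i v) w = bracket v w"
    by (simp add: sum_component bracket_def projection_id projection_carrier)
  show "graded_component 0 zeta = zeta"
    by (simp add: zeta_def P0(2)[OF I_id] skp_zero)
  show "trunc_exp (graded_scale scale) bracket (x + s) (bracket v w)
      = bracket (trunc_exp (graded_scale scale) bracket (x + s) v)
          (trunc_exp (graded_scale scale) bracket (x + s) w)"
    if xs: "graded_component 1 x = x" "graded_component 2 s = s"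
      and vw: "graded_component i v = v" "graded_component j w = w"
  proof -
    obtain a b where "b \<in> Skew" "x + s = elt_plus a b"
      using xs by (auto simp: component_iff elt_plus_def)
    then show ?thesis
      by (intro exp_automorphism[where s = b] component_in_C[OF vw(1)] component_in_C[OF vw(2)]) auto
  qed
  show "trunc_exp (graded_scale scale) bracket (y + t) (bracket v w)
      = bracket (trunc_exp (graded_scale scale) bracket (y + t) v)
          (trunc_exp (graded_scale scale) bracket (y + t) w)"
    if yt: "graded_component (-1) y = y" "graded_component (-2) t = t"
      and vw: "graded_component i v = v" "graded_component j w = w"
  proof -
    obtain a b where "b \<in> Skew" "y + t = elt_minus a b"
      using yt by (auto simp: component_iff elt_minus_def)
    then show ?thesis
      by (intro exp_automorphism[where s = b] component_in_C[OF vw(1)] component_in_C[OF vw(2)]) auto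
  qed
  show "graded_component 0 v = v \<Longrightarrow> v \<in> module.span (graded_scale scale)
      {bracket x y |x y. graded_component 1 x = x \<and> graded_component (-1) y = y}"
    using deg0_in_span by (auto simp only: component_iff(3))
  show "\<exists>x. graded_component 1 x = x \<and> x \<noteq> 0"
    using nontrivial by (intro exI[of _ "P1 1"]) (simp add: P0_zero skp_zero zero_prod_def)
  show "\<exists>y. graded_component (-1) y = y \<and> bracket x y = zeta"
    if x: "graded_component 1 x = x" "x \<noteq> 0"
  proof -
    obtain a where a: "x = P1 a" "a \<noteq> 0"
      using x by (auto simp: component_iff zero_prod_def)
    then obtain b where "Vop a b = id" using division_Vop by blast
    then have "bracket x (M1 b) = zeta" by (simp add: a bracket_hom zeta_def)
    then show ?thesis using component_iff(2) by blast
  qed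
  show "\<exists>x. graded_component 1 x = x \<and> bracket x y = zeta"
    if y: "graded_component (-1) y = y" "y \<noteq> 0"
  proof -
    obtain a where a: "y = M1 a" "a \<noteq> 0"
      using y by (auto simp: component_iff zero_prod_def)
    then obtain b where "Vop b a = id" using division_Vop Vop_id_sym by blast
    then have "bracket (P1 b) y = zeta" by (simp add: a bracket_hom zeta_def)
    then show ?thesis using component_iff(4) by blast
  qed
  show "v = 0" if v: "graded_component 0 v = v"
    and ann: "\<And>x. graded_component 1 x = x \<Longrightarrow> bracket v x = 0"
  proof -
    obtain T where T: "v = Z0 T" "T \<in> I" using v by (auto simp: component_iff)
    have "T x = 0" for x
      using ann[of "P1 x"] component_iff(4) T by (auto simp: bracket_hom zero_prod_def)
    then have "T = 0" by (simp add: fun_eq_iff)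
    then show ?thesis by (simp add: T zero_prod_def)
  qed
  show "v = 0" if v: "graded_component 0 v = v"
    and ann: "\<And>y. graded_component (-1) y = y \<Longrightarrow> bracket v y = 0"
  proof -
    obtain T where T: "v = Z0 T" "T \<in> I" using v by (auto simp: component_iff)
    have aAm: "aAm T y = 0" for y
      using ann[of "M1 y"] component_iff(2) T by (auto simp: bracket_hom zero_prod_def)
    \<comment> \<open>At 1 the action on degree -1 is -\<open>bar (T 1)\<close>. Once
      \<open>T 1\<close> vanishes, the action on every y is \<open>T y\<close>.\<close>
    from aAm[of 1] have "bar (bar (T 1)) = bar 0"
      by (simp add: aAm_def alg_simps)
    then have "T 1 = 0" by (simp add: alg_simps)
    then have "T y = 0" for y
      using aAm[of y] by (simp add: aAm_def alg_simps)
    then have "T = 0" by (simp add: fun_eq_iff)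
    then show ?thesis by (simp add: T zero_prod_def)
  qed
  \<comment> \<open>Both degrees are copies of \<open>Skew\<close>, so F becomes an endomorphism of
    a finite-dimensional space.\<close>
  show "\<exists>v. graded_component i v = v \<and> F v = w"
    if i: "i = 2 \<or> i = -2" and add: "\<And>u v. F (u + v) = F u + F v"
      and scl: "\<And>c v. F (graded_scale scale c v) = graded_scale scale c (F v)"
      and FL: "\<And>v. graded_component i v = v \<Longrightarrow> graded_component (- i) (F v) = F v"
      and inj: "\<And>v. graded_component i v = v \<Longrightarrow> F v = 0 \<Longrightarrow> v = 0"
      and w: "graded_component (- i) w = w"
    using i
  proof
    assume i: "i = 2"
    define f where "f s = fst (F (P2 s))" for s
    have F: "\<exists>t\<in>Skew. F (P2 s) = M2 t" if "s \<in> Skew" for s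
      using FL[of "P2 s"] component_iff(5)[of "P2 s"] component_iff(1)[of "F (P2 s)"] that
      by (simp add: i)
    obtain b where b: "b \<in> Skew" "w = M2 b"
      using w by (auto simp: i component_iff)
    have "f (u + v) = f u + f v" for u v
      using add[of "P2 u" "P2 v"] by (simp add: f_def)
    moreover have "f (scale c v) = scale c (f v)" for c v
      using scl[of c "P2 v"] by (cases "F (P2 v)") (simp add: f_def)
    moreover have "f s \<in> Skew" if "s \<in> Skew" for s
      using F[OF that] by (auto simp: f_def)
    moreover have "s = 0" if "s \<in> Skew" "f s = 0" for s
      using F[OF that(1)] inj[of "P2 s"] that component_iff(5)[of "P2 s"]
      by (auto simp: i f_def zero_prod_def)
    ultimately obtain a where a: "a \<in> Skew" "f a = b"
      using skew_surj[of f b] b by blast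
    then have "F (P2 a) = w"
      using F[of a] b by (auto simp: f_def)
    then show ?thesis
      using a component_iff(5)[of "P2 a"] by (auto simp: i)
  next
    assume i: "i = -2"
    define f where "f t = snd (snd (snd (snd (F (M2 t)))))" for t
    have F: "\<exists>s\<in>Skew. F (M2 t) = P2 s" if "t \<in> Skew" for t
      using FL[of "M2 t"] component_iff(1)[of "M2 t"] component_iff(5)[of "F (M2 t)"] that
      by (simp add: i)
    obtain b where b: "b \<in> Skew" "w = P2 b"
      using w by (auto simp: i component_iff)
    have "f (u + v) = f u + f v" for u v
      using add[of "M2 u" "M2 v"] by (simp add: f_def)
    moreover have "f (scale c v) = scale c (f v)" for c v
      using scl[of c "M2 v"] by (cases "F (M2 v)") (simp add: f_def)
    moreover have "f t \<in> Skew" if "t \<in> Skew" for t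
      using F[OF that] by (auto simp: f_def)
    moreover have "t = 0" if "t \<in> Skew" "f t = 0" for t
      using F[OF that(1)] inj[of "M2 t"] that component_iff(1)[of "M2 t"]
      by (auto simp: i f_def zero_prod_def)
    ultimately obtain a where a: "a \<in> Skew" "f a = b"
      using skew_surj[of f b] b by blast
    then have "F (M2 a) = w"
      using F[of a] b by (auto simp: f_def)
    then show ?thesis
      using a component_iff(1)[of "M2 a"] by (auto simp: i)
  qed
qed (rule bracket_add bracket_scale bracket_anti component_add component_scale component_component
    component_bracket bracket_zeta_hom; assumption?)+

section \<open>Conjugate inverses and the system in A\<close>

lemma hom_L:
  "t \<in> Skew \<Longrightarrow> M2 t \<in> K.L (-2)" "M1 y \<in> K.L (-1)" "P1 x \<in> K.L 1" "s \<in> Skew \<Longrightarrow> P2 s \<in> K.L 2"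
  by (auto intro!: K.LI simp del: graded_component.simps simp: component_iff)

lemma L_hom:
  "v \<in> K.L (-2) \<Longrightarrow> \<exists>t\<in>Skew. v = M2 t" "v \<in> K.L (-1) \<Longrightarrow> \<exists>y. v = M1 y"
  "v \<in> K.L 1 \<Longrightarrow> \<exists>x. v = P1 x" "v \<in> K.L 2 \<Longrightarrow> \<exists>s\<in>Skew. v = P2 s"
  using component_iff by (blast dest: K.LD)+

text \<open>Two candidates differ by an element of degree -1 that ad u annihilates.\<close>

lemma conj_inv_eqI: "Vop u v = id \<Longrightarrow> conj_inv u = (v :: 'a)"
proof -
  assume uv: "Vop u v = id"
  have "u \<noteq> 0"
    using fun_cong[OF uv, of 1] nontrivial by (auto simp: Vop_lin)
  have uniq: "v' = v" if "Vop u v' = id" for v'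
  proof -
    have "bracket (P1 u) (M1 v' - M1 v) = 0"
      unfolding K.br_diff_right by (simp add: bracket_hom uv that)
    then have "M1 v' - M1 v = 0"
      by (rule K.ad_inj_minus1[rotated -1])
        (use \<open>u \<noteq> 0\<close> in \<open>simp_all only: hom_L K.L_diff zero_prod_def prod.inject simp_thms\<close>)
    then show ?thesis by (simp add: zero_prod_def)
  qed
  show ?thesis
    unfolding conj_inv_def by (rule the_equality[where P = "\<lambda>v. Vop u v = id", OF uv]) (rule uniq)
qed

lemma Vop_conj_inv: "u \<noteq> 0 \<Longrightarrow> Vop u (conj_inv u) = (id :: 'a \<Rightarrow> 'a)"
  using division_Vop conj_inv_eqI by blast

lemma bracket_P2_M2_iff:
  assumes "s \<in> Skew" "f \<in> Skew"
  shows "bracket (P2 s) (M2 f) = - zeta \<longleftrightarrow> Lop s \<circ> Lop f = - id"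
  using assms by (simp add: bracket_hom zeta_def)

lemma Lop_inverse_Vop:
  fixes s f x y :: 'a
  assumes s: "s \<in> Skew" and f: "f \<in> Skew" and sf: "Lop s \<circ> Lop f = - id" and xy: "Vop x y = id"
  shows "Vop (s * y) (f * x) = id"
proof -
  have "bracket (bracket (P2 s) (M1 y)) (bracket (M2 f) (P1 x)) = zeta"
    by (rule K.skew_mult_inverse)
      (use s f sf xy in \<open>simp_all add: hom_L bracket_P2_M2_iff bracket_hom zeta_def\<close>)
  then show ?thesis
    using s f by (simp add: bracket_hom zeta_def)
qed

text \<open>This is \<open>Lop_inverse_Vop\<close> applied to V_{1,1} = id.\<close>

lemma Lop_inverse_conj_inv:
  fixes s f :: 'a
  assumes "s \<in> Skew" "f \<in> Skew" "Lop s \<circ> Lop f = - id"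
  shows "conj_inv s = f" "conj_inv f = s" "f \<noteq> 0"
proof -
  have "Vop s f = id"
    using Lop_inverse_Vop[OF assms id_eq_Vop[symmetric]] by (simp add: alg_simps)
  then show "conj_inv s = f" "conj_inv f = s"
    using conj_inv_eqI Vop_id_sym by blast+
  show "f \<noteq> 0"
    using fun_cong[OF assms(3), of 1] nontrivial by (auto simp: Lop_def alg_simps)
qed

lemma conj_inv_Skew:
  fixes s :: 'a
  assumes "s \<in> Skew" "s \<noteq> 0"
  shows "conj_inv s \<in> Skew" "Lop s \<circ> Lop (conj_inv s) = - id"
proof -
  obtain F where F: "F \<in> K.L (-2)" "bracket (P2 s) F = - zeta"
    by (rule K.skew_inverse[of "P2 s"]) (use assms in \<open>auto simp: hom_L zero_prod_def\<close>)
  then obtain f where "f \<in> Skew" "F = M2 f" using L_hom(1) by blast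
  then have "f \<in> Skew" "Lop s \<circ> Lop f = - id"
    using F assms by (simp_all add: bracket_P2_M2_iff)
  then show "conj_inv s \<in> Skew" "Lop s \<circ> Lop (conj_inv s) = - id"
    using Lop_inverse_conj_inv(1)[of s f] assms by simp_all
qed

lemma bracket_words:
  assumes t: "t \<in> Skew"
  shows "bracket (P1 x) (bracket (P1 x) (M2 t)) = Z0 (- Vop x (t * x))"
    and "bracket (P1 x) (bracket (P1 x) (bracket (P1 x) (M2 t))) = P1 (Uop x (t * x))"
    and "bracket (P1 x) (bracket (P1 x) (bracket (P1 x) (bracket (P1 x) (M2 t)))) = P2 (scale 6 (qmap scale x t))"
    and "bracket (M1 x) (bracket (M1 x) (bracket (M1 x) (bracket (M1 x) (P2 t)))) = M2 (scale 6 (qmap scale x t))"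
proof -
  have six: "(6 :: 'k) \<noteq> 0" using K.numeral_neq_zero' by simp
  have m: "Vop x (- y) = - Vop x y" "Vop (- x) y = - Vop x y" for x y :: 'a
    by (simp_all add: fun_eq_iff Vop_def alg_simps)
  show 2: "bracket (P1 x) (bracket (P1 x) (M2 t)) = Z0 (- Vop x (t * x))"
    using t by (simp add: bracket_hom m)
  show 3: "bracket (P1 x) (bracket (P1 x) (bracket (P1 x) (M2 t))) = P1 (Uop x (t * x))"
    unfolding 2 by (simp add: bracket_hom I_minus I_Vop Uop_def Uop2_def)
  show "bracket (P1 x) (bracket (P1 x) (bracket (P1 x) (bracket (P1 x) (M2 t)))) = P2 (scale 6 (qmap scale x t))"
    unfolding 3 using six by (simp add: bracket_hom qmap_def)
  show "bracket (M1 x) (bracket (M1 x) (bracket (M1 x) (bracket (M1 x) (P2 t)))) = M2 (scale 6 (qmap scale x t))"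
    using t six by (simp add: bracket_hom I_minus I_Vop m aAm_Vop Uop_def Uop2_def qmap_def)
qed

lemma qmap_Skew: "qmap scale x (t :: 'a) \<in> Skew"
  by (simp add: qmap_def Skew_scale Skew_psi)

lemma aSp_uminus: "aSp (- T) w = - aSp T w"
  by (simp add: aSp_def alg_simps)

lemma system_iff:
  assumes s: "s \<in> Skew" and t: "t \<in> Skew"
  shows "K.system (P1 x) (P2 s) (M1 u) (M2 t) \<longleftrightarrow>
    Vop x u = id + (Lop s \<circ> Lop t) \<and> s * u = - scale (1 / 3) (Uop x (t * x)) \<and> psi x (s * (t * x)) = 0"
  unfolding K.system_def bracket_words[OF t]
  using s t by (auto simp: hom_L bracket_hom zeta_def I_minus I_Vop zero_prod_def aSp_uminus aSp_Vop
      Uop_def Uop2_def)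

lemma system_solution:
  assumes x: "x \<noteq> 0" and s: "s \<in> Skew" "s \<noteq> 0"
  defines "w \<equiv> s + qmap scale x (conj_inv s)"
    and "w' \<equiv> qmap scale (conj_inv x) s + conj_inv s"
    and "v \<equiv> x - s * (qmap scale (conj_inv x) s * x)"
  shows "{(u, t). t \<in> Skew \<and> Vop x u = id + (Lop s \<circ> Lop t)
        \<and> s * u = - scale (1 / 3) (Uop x (t * x)) \<and> psi x (s * (t * x)) = 0}
      = {(conj_inv v, conj_inv w)}"
    and "conj_inv v = - (conj_inv s * (conj_inv w' * conj_inv x))"
    and "v \<noteq> 0" "w' \<noteq> 0" "w \<noteq> 0"
proof -
  define g where "g = conj_inv x"
  define f where "f = conj_inv s"
  have xg: "Vop x g = id" using Vop_conj_inv[OF x] by (simp add: g_def)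
  have f: "f \<in> Skew" and sf: "Lop s \<circ> Lop f = - id"
    using conj_inv_Skew[OF s] by (simp_all add: f_def)
  have six: "(6 :: 'k) \<noteq> 0" using K.numeral_neq_zero' by simp
  have wS: "w \<in> Skew" "w' \<in> Skew"
    using s f by (simp_all add: w_def w'_def Skew_add qmap_Skew f_def[symmetric])
  have x0: "P1 x \<noteq> 0" and s0: "P2 s \<noteq> 0" using x s by (simp_all add: zero_prod_def)
  have brxg: "bracket (P1 x) (M1 g) = zeta" by (simp add: bracket_hom xg zeta_def)
  have brsf: "bracket (P2 s) (M2 f) = - zeta" using s f sf by (simp add: bracket_P2_M2_iff)
  obtain U T where "K.system (P1 x) (P2 s) U T"
    by (rule K.system_solvable[OF hom_L(3) hom_L(4)[OF s(1)] s0])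
  moreover from this obtain u t where t: "t \<in> Skew" and "U = M1 u" "T = M2 t"
    using L_hom(1)[of T] L_hom(2)[of U] by (auto simp: K.system_def)
  ultimately have sys: "K.system (P1 x) (P2 s) (M1 u) (M2 t)" by simp
  define t' where "t' = qmap scale x t"
  have t': "t' \<in> Skew" by (simp add: t'_def qmap_Skew)
  have W: "P2 s + graded_scale scale (1 / 6)
      (bracket (P1 x) (bracket (P1 x) (bracket (P1 x) (bracket (P1 x) (M2 f))))) = P2 w"
    unfolding bracket_words(3)[OF f] using six by (simp add: w_def f_def)
  have W': "M2 f + graded_scale scale (1 / 6)
      (bracket (M1 g) (bracket (M1 g) (bracket (M1 g) (bracket (M1 g) (P2 s))))) = M2 w'"
    unfolding bracket_words(4)[OF s(1)] using six by (simp add: w'_def f_def g_def add.commute)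
  have T': "graded_scale scale (1 / 6)
      (bracket (P1 x) (bracket (P1 x) (bracket (P1 x) (bracket (P1 x) (M2 t))))) = P2 t'"
    unfolding bracket_words(3)[OF t] using six by (simp add: t'_def)
  note inv = K.skew_inverse_of_solution[OF hom_L(3) hom_L(4)[OF s(1)] s0 hom_L(1)[OF f] brsf sys,
      unfolded W]
  note deg1 = K.degree1_of_solution[OF hom_L(3) x0 hom_L(4)[OF s(1)] s0 hom_L(1)[OF f] brsf hom_L(2)
      brxg sys, unfolded W' T']
  have wt: "Lop w \<circ> Lop t = - id"
    using inv(1) wS t by (simp add: bracket_P2_M2_iff)
  have t'w': "Lop t' \<circ> Lop w' = - id"
    using deg1(1) wS t' by (simp add: bracket_P2_M2_iff)
  have u: "u = - (f * (t' * g))"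
    using deg1(2) f t' by (simp add: bracket_hom)
  have "Vop (s * (w' * x)) (f * (t' * g)) = id"
    using deg1(3) s f t' wS by (simp add: bracket_hom zeta_def)
  then have "Vop (- (s * (w' * x))) u = id"
    by (simp add: u fun_eq_iff Vop_def alg_simps)
  \<comment> \<open>s (s^ x) = -x, so the summand s^ of w' contributes the x in v.\<close>
  moreover have "v = - (s * (w' * x))"
    using fun_cong[OF sf, of x] by (simp add: v_def w'_def f_def[symmetric] g_def[symmetric] Lop_def alg_simps)
  ultimately have vu: "Vop v u = id" by simp
  have ci: "conj_inv v = u" "conj_inv w = t" "conj_inv w' = t'"
    using conj_inv_eqI[OF vu] Lop_inverse_conj_inv(1)[OF wS(1) t wt]
      Lop_inverse_conj_inv(2)[OF t' wS(2) t'w'] by simp_all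
  show "v \<noteq> 0"
    using fun_cong[OF vu, of 1] nontrivial by (auto simp: Vop_lin)
  show "w' \<noteq> 0"
    by (rule Lop_inverse_conj_inv(3)[OF t' wS(2) t'w'])
  show "w \<noteq> 0"
    using inv(2) by (auto simp: zero_prod_def)
  show "conj_inv v = - (conj_inv s * (conj_inv w' * conj_inv x))"
    by (simp add: ci u f_def g_def)
  have "a = u \<and> b = t" if "K.system (P1 x) (P2 s) (M1 a) (M2 b)" for a b
    using K.system_unique[OF hom_L(3) x0 hom_L(4)[OF s(1)] that sys] by simp
  then have iff: "b \<in> Skew \<and> K.system (P1 x) (P2 s) (M1 a) (M2 b) \<longleftrightarrow> a = u \<and> b = t" for a b
    using sys t by blast
  show "{(u, t). t \<in> Skew \<and> Vop x u = id + (Lop s \<circ> Lop t)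
        \<and> s * u = - scale (1 / 3) (Uop x (t * x)) \<and> psi x (s * (t * x)) = 0}
      = {(conj_inv v, conj_inv w)}" (is "?S = _")
  proof -
    have "?S = {(a, b). b \<in> Skew \<and> K.system (P1 x) (P2 s) (M1 a) (M2 b)}"
      using system_iff[OF s(1)] by auto
    also have "\<dots> = {(u, t)}"
      unfolding iff by auto
    finally show ?thesis by (simp add: ci)
  qed
qed

subsection \<open>Transport to the algebra \<open>K'\<close>\<close>

text \<open>An isomorphism of K'(A) to K(A) that scales each component. With the factor 1 in degree
  -1, the bracket of degrees 1 and -1 forces -2 in degree 1, the bracket within degree -1 forces
  -1/2 in degree -2, and the bracket within degree 1 forces -2 in degree 2.\<close>

fun from_K' :: "'a graded \<Rightarrow> 'a graded" where
  "from_K' (t, y, T, x, s) = (scale (- 1 / 2) t, y, T, scale (- 2) x, scale (- 2) s)"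

fun to_K' :: "'a graded \<Rightarrow> 'a graded" where
  "to_K' (t, y, T, x, s) = (scale (- 2) t, y, T, scale (- 1 / 2) x, scale (- 1 / 2) s)"

lemma K'_inverse: "to_K' (from_K' X) = X" "from_K' (to_K' X) = X"
  using two by (cases X rule: from_K'.cases; simp)+

lemma K'_C: "X \<in> C \<Longrightarrow> from_K' X \<in> C" "X \<in> C \<Longrightarrow> to_K' X \<in> C"
  by (cases X rule: from_K'.cases; simp add: graded_carrier_def Skew_scale Skew_minus)+

lemma from_K'_lin: "from_K' (X + Y) = from_K' X + from_K' Y"
  "from_K' (graded_scale scale c X) = graded_scale scale c (from_K' X)"
  by (cases X rule: from_K'.cases; cases Y rule: from_K'.cases;
      simp add: scale_right_distrib mult.commute)+

lemma g_carrier_eq: "g_carrier scale = C"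
  by (simp add: g_carrier_def graded_carrier_def deg0_id Instrl_def)

lemma act_uminus:
  assumes "T \<in> I"
  shows "aSm T (- w) = - aSm T w" "aAm T (- w) = - aAm T w" "aSp T (- w) = - aSp T w"
  by (simp_all add: aSm_def aAm_def aSp_def I_lin[OF assms] alg_simps)

lemma Vop_uminus: "Vop (- x) y z = - Vop x y (z :: 'a)" "Vop x (- y) z = - Vop x y (z :: 'a)"
  by (simp_all add: Vop_def alg_simps)

lemma K'_bracket:
  assumes "X \<in> C" "Y \<in> C"
  shows "graded_bracket scale {id} (- 2) X Y = to_K' (graded_bracket scale {} 1 (from_K' X) (from_K' Y))"
proof -
  obtain t y T x s where X: "X = (t, y, T, x, s)" by (cases X) auto
  obtain t' y' T' x' s' where Y: "Y = (t', y', T', x', s')" by (cases Y) auto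
  have I: "T \<in> I" "T' \<in> I"
    using assms by (simp_all add: X Y graded_carrier_def)
  have "graded_bracket scale {id} (- 2) X Y = graded_bracket scale {} (- 2) X Y"
    using assms two three
    by (simp add: X Y graded_carrier_def act_S_minus_eq act_A_minus_eq act_A_plus_eq act_S_plus_eq
        deg0_id Instrl_def)
  moreover have "from_K' (graded_bracket scale {} (- 2) X Y)
      = graded_bracket scale {} 1 (from_K' X) (from_K' Y)"
    using assms K'_C(1)[OF assms(1)] K'_C(1)[OF assms(2)] two unfolding X Y
    by (simp add: graded_bracket_eq act_lin[OF I(1)] act_lin[OF I(2)] act_uminus[OF I(1)]
        act_uminus[OF I(2)] del: graded_bracket.simps)
      (simp add: I_lin[OF I(1)] I_lin[OF I(2)] psi_def Vop_lin Vop_uminus Lop_def fun_eq_iff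
        op_scale_def alg_simps scale_right_distrib scale_right_diff_distrib)
  ultimately show ?thesis
    by (metis K'_inverse(1))
qed

lemma K'_exp:
  assumes E: "E \<in> C" and X: "X \<in> C"
  shows "graded_exp scale {id} (- 2) E X = to_K' (graded_exp scale {} 1 (from_K' E) (from_K' X))"
proof -
  have *: "from_K' ((graded_bracket scale {id} (- 2) E ^^ i) X)
      = (graded_bracket scale {} 1 (from_K' E) ^^ i) (from_K' X)
    \<and> (graded_bracket scale {id} (- 2) E ^^ i) X \<in> C" for i
  proof (induction i)
    case (Suc i)
    let ?Y = "(graded_bracket scale {id} (- 2) E ^^ i) X"
    from Suc have Y: "?Y \<in> C" by blast
    have "graded_bracket scale {id} (- 2) E ?Y \<in> C"
      unfolding K'_bracket[OF E Y] by (intro K'_C graded_bracket_closed E Y)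
    moreover have "from_K' (graded_bracket scale {id} (- 2) E ?Y)
        = graded_bracket scale {} 1 (from_K' E) (from_K' ?Y)"
      unfolding K'_bracket[OF E Y] by (rule K'_inverse)
    ultimately show ?case
      using Suc by (simp only: funpow.simps o_apply simp_thms)
  qed (use X in simp)
  have sum: "from_K' (sum F A) = (\<Sum>i\<in>A. from_K' (F i))" for F and A :: "nat set"
    by (induction A rule: infinite_finite_induct) (simp_all add: from_K'_lin zero_prod_def)
  have "from_K' (graded_exp scale {id} (- 2) E X) = graded_exp scale {} 1 (from_K' E) (from_K' X)"
    using X K'_C(1)[OF X]
    by (simp add: graded_exp_def g_carrier_eq[unfolded g_carrier_def] sum from_K'_lin *)
  then show ?thesis
    by (metis K'_inverse(1))
qed

lemma K'_exp_bij:
  assumes s: "s \<in> Skew" and E: "E = elt_plus x s \<or> E = elt_minus x s"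
  shows "graded_exp scale {id} (- 2) E \<in> Bij C"
proof -
  have "\<exists>x' s'. s' \<in> Skew \<and> (from_K' E = elt_plus x' s' \<or> from_K' E = elt_minus x' s')"
    using E
  proof
    assume "E = elt_plus x s"
    then have "from_K' E = elt_plus (scale (- 2) x) (scale (- 2) s)"
      by (simp add: elt_plus_def)
    then show ?thesis using s Skew_scale by blast
  next
    assume "E = elt_minus x s"
    then have "from_K' E = elt_minus x (scale (- 1 / 2) s)"
      by (simp add: elt_minus_def)
    then show ?thesis using s Skew_scale by blast
  qed
  then have "is_automorphism scale {} 1 (graded_exp scale {} 1 (from_K' E))"
    using algebraic by (auto simp: algebraic_def)
  then have bij: "bij_betw (graded_exp scale {} 1 (from_K' E)) C C"
    by (simp add: is_automorphism_def)
  have "bij_betw from_K' C C"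
    by (rule bij_betw_byWitness[where f' = to_K']) (use K'_inverse K'_C in blast)+
  moreover have "bij_betw to_K' C C"
    by (rule bij_betw_byWitness[where f' = from_K']) (use K'_inverse K'_C in blast)+
  ultimately have "bij_betw (to_K' \<circ> (graded_exp scale {} 1 (from_K' E) \<circ> from_K')) C C"
    using bij by (intro bij_betw_trans)
  moreover have "E \<in> C" using E s elt_in_C by blast
  ultimately have "bij_betw (graded_exp scale {id} (- 2) E) C C"
    by (subst bij_betw_cong[of C _ "to_K' \<circ> (graded_exp scale {} 1 (from_K' E) \<circ> from_K')"])
      (simp_all add: K'_exp)
  moreover have "graded_exp scale {id} (- 2) E \<in> extensional C"
    by (simp add: graded_exp_def g_carrier_eq[unfolded g_carrier_def])
  ultimately show ?thesis
    by (simp add: Bij_def)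
qed

text \<open>\<open>reversal_exists\<close> is applied to (-2 x, -2 s), the image of (x, s) in K(A).
  The factor acting first is the leftmost one in the right action, hence the innermost
  exponential.\<close>

lemma one_invertible:
  assumes x: "x \<noteq> 0" and s: "s \<in> Skew" "s \<noteq> 0"
  shows "one_invertible scale x s"
proof -
  have L: "P1 (scale (- 2) x) \<in> K.L 1" "P2 (scale (- 2) s) \<in> K.L 2" "P2 s \<in> K.L 2" "P2 s \<noteq> 0"
    "P1 (scale (- 2) x) \<noteq> 0 \<or> P2 (scale (- 2) s) \<noteq> 0"
    using s two by (auto simp: hom_L Skew_scale Skew_minus zero_prod_def)
  obtain Y R Z Q where "Y \<in> K.L (-1)" "R \<in> K.L (-2)" "Z \<in> K.L (-1)" "Q \<in> K.L (-2)"
    and rev: "K.ex (Y + R) (K.ex (P1 (scale (- 2) x) + P2 (scale (- 2) s)) (K.ex (Z + Q) zeta)) = - zeta"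
    by (rule K.reversal_exists[OF L(1,2,5,3,4)])
  then obtain y r z q where "Y = M1 y" "R = M2 r" "Z = M1 z" "Q = M2 q" and S: "r \<in> Skew" "q \<in> Skew"
    using L_hom(1,2) by meson
  then have rev: "K.ex (elt_minus y r) (K.ex (elt_plus (scale (- 2) x) (scale (- 2) s))
      (K.ex (elt_minus z q) zeta)) = - zeta"
    using rev by (simp add: elt_minus_def elt_plus_def)
  \<comment> \<open>The factor -2 undoes the scaling by -1/2 in degree -2.\<close>
  define r' where "r' = scale (- 2) r"
  define q' where "q' = scale (- 2) q"
  have S': "r' \<in> Skew" "q' \<in> Skew"
    using S by (simp_all only: r'_def q'_def Skew_scale)
  let ?a = "e_minus scale z q'" and ?b = "e_plus scale x s" and ?d = "e_minus scale y r'"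
  have em: "e_minus scale y' (scale (- 2) r) X = to_K' (K.ex (elt_minus y' r) (from_K' X))"
    if "r \<in> Skew" "X \<in> C" for y' r X
  proof -
    have "from_K' (elt_minus y' (scale (- 2) r)) = elt_minus y' r"
      using two by (simp add: elt_minus_def)
    then show ?thesis
      unfolding e_minus_def
      using K'_exp[OF elt_in_C(2)[OF Skew_scale[OF that(1)]] that(2), of y' "- 2"]
      by (simp add: trunc_exp_eq elt_in_C that K'_C)
  qed
  have ep: "?b X = to_K' (K.ex (elt_plus (scale (- 2) x) (scale (- 2) s)) (from_K' X))"
    if "X \<in> C" for X
  proof -
    have "from_K' (elt_plus x s) = elt_plus (scale (- 2) x) (scale (- 2) s)"
      by (simp add: elt_plus_def)
    then show ?thesis
      unfolding e_plus_def
      using K'_exp[OF elt_in_C(1)[OF s(1)] that, of x] elt_in_C(1)[OF Skew_scale[OF s(1)], of "scale (- 2) x" "- 2"]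
      by (simp only: trunc_exp_eq that K'_C)
  qed
  have bij: "?a \<in> Bij C" "?b \<in> Bij C" "?d \<in> Bij C"
    unfolding e_minus_def e_plus_def
    by (rule K'_exp_bij[OF S'(2) disjI2[OF refl]] K'_exp_bij[OF s(1) disjI1[OF refl]]
        K'_exp_bij[OF S'(1) disjI2[OF refl]])+
  then have maps: "?a X \<in> C" "?b X \<in> C" if "X \<in> C" for X
    using that by (auto simp: Bij_def bij_betw_def)
  have zC: "zeta \<in> C"
    by (simp add: zeta_def hom_in_C I_id)
  have fz: "from_K' zeta = zeta" "to_K' (- zeta) = - zeta"
    by (simp_all add: zeta_def)
  let ?h = "right_comp scale (right_comp scale ?a ?b) ?d"
  have az: "?a zeta = to_K' (K.ex (elt_minus z q) zeta)"
    using em[OF S(2) zC, of z] by (simp only: q'_def fz)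
  have bz: "?b (?a zeta)
      = to_K' (K.ex (elt_plus (scale (- 2) x) (scale (- 2) s)) (K.ex (elt_minus z q) zeta))"
    unfolding ep[OF maps(1)[OF zC]] unfolding az K'_inverse ..
  have "?h zeta = ?d (?b (?a zeta))"
    using zC maps by (simp add: right_comp_def g_carrier_eq compose_def)
  also have "\<dots> = to_K' (K.ex (elt_minus y r) (from_K' (?b (?a zeta))))"
    unfolding r'_def by (rule em[OF S(1) maps(2)[OF maps(1)[OF zC]]])
  also have "\<dots> = - zeta"
    by (simp only: bz K'_inverse rev fz)
  finally have "?h zeta = - zeta" .
  moreover have "?h \<in> elementary_group scale"
  proof -
    let ?G = "{e_plus scale x s |x s. s \<in> Skew} \<union> {e_minus scale x s |x s. s \<in> Skew}"
    have "?a \<in> ?G" "?b \<in> ?G" "?d \<in> ?G"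
      using s S' by blast+
    then have gen: "?a \<in> generate (BijGroup C) ?G" "?b \<in> generate (BijGroup C) ?G"
      "?d \<in> generate (BijGroup C) ?G"
      by (simp_all only: generate.incl)
    have "compose C ?b ?a \<in> Bij C"
      using bij by (intro compose_Bij)
    then have "?h = ?d \<otimes>\<^bsub>BijGroup C\<^esub> (?b \<otimes>\<^bsub>BijGroup C\<^esub> ?a)"
      using bij by (simp add: right_comp_def g_carrier_eq BijGroup_def)
    then show ?thesis
      using gen by (simp add: elementary_group_def g_carrier_eq generate.eng)
  qed
  ultimately have "?h \<in> H_minus scale"
    by (simp add: H_minus_def)
  then show ?thesis
    unfolding one_invertible_def using S' by blast
qed

end

section \<open>The characteristic and the conclusion\<close>

lemma CHAR_numeral_neq_zero:
  "CHAR('k::field) \<noteq> 2 \<Longrightarrow> (2 :: 'k) \<noteq> 0" "CHAR('k::field) \<noteq> 3 \<Longrightarrow> (3 :: 'k) \<noteq> 0"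
proof -
  have *: "CHAR('k) dvd p \<and> CHAR('k) \<le> p \<and> CHAR('k) \<noteq> 0" if "of_nat p = (0 :: 'k)" "p \<noteq> 0"
    for p :: nat
  proof -
    have "CHAR('k) dvd p"
      using that(1) by (simp only: of_nat_eq_0_iff_char_dvd)
    then show ?thesis
      using that(2) by (auto intro: dvd_imp_le)
  qed
  have 1: "CHAR('k) \<noteq> 1"
    by simp
  show "(2 :: 'k) \<noteq> 0" if "CHAR('k) \<noteq> 2"
  proof
    assume "(2 :: 'k) = 0"
    then have "CHAR('k) \<le> 2" "CHAR('k) \<noteq> 0"
      using *[of 2] by simp_all
    then show False
      using 1 that by linarith
  qed
  show "(3 :: 'k) \<noteq> 0" if "CHAR('k) \<noteq> 3"
  proof
    assume "(3 :: 'k) = 0"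
    then have "CHAR('k) \<le> 3" "CHAR('k) \<noteq> 0" "CHAR('k) dvd 3"
      using *[of 3] by simp_all
    then have "CHAR('k) = 2" "CHAR('k) dvd 3"
      using 1 that by linarith+
    then show False
      by simp
  qed
qed

theorem theorem3p3p7:
  fixes scale :: "'k::field \<Rightarrow> 'a::algebra_ops \<Rightarrow> 'a"
    and x s :: 'a
  assumes "CHAR('k) \<noteq> 2" and "CHAR('k) \<noteq> 3"
    and "structurable_division_algebra scale"
    and "algebraic scale"
    and "x \<noteq> 0"
    and "s \<in> Skew" and "s \<noteq> 0"
  shows "one_invertible scale x s
    \<and> {(u, t). t \<in> Skew
            \<and> Vop x u = id + (Lop s \<circ> Lop t)
            \<and> s * u = - scale (1 / 3) (Uop x (t * x))
            \<and> psi x (s * (t * x)) = 0}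
        = {(conj_inv (x - s * (qmap scale (conj_inv x) s * x)),
            conj_inv (s + qmap scale x (conj_inv s)))}
    \<and> conj_inv (x - s * (qmap scale (conj_inv x) s * x))
        = - (conj_inv s * (conj_inv (qmap scale (conj_inv x) s + conj_inv s) * conj_inv x))
    \<and> x - s * (qmap scale (conj_inv x) s * x) \<noteq> 0
    \<and> qmap scale (conj_inv x) s + conj_inv s \<noteq> 0
    \<and> s + qmap scale x (conj_inv s) \<noteq> 0"
proof -
  interpret D: structurable_division_algebra scale by (rule assms(3))
  have "(1 :: 'a) \<noteq> 0"
    using D.one_left[of x] assms(5) by (auto simp: D.mult_zero_left')
  then interpret algebraic_division_algebra scale
    using assms(4) CHAR_numeral_neq_zero(1)[OF assms(1)] CHAR_numeral_neq_zero(2)[OF assms(2)]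
    by unfold_locales
  show ?thesis
    by (intro conjI one_invertible system_solution assms)
qed

end
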